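(* Let $x\colon M\to\mathbb{R}^3$ be an isometric immersion of a smooth oriented surface with constant mean curvature $H$. Suppose that a plane $\pi\subset\mathbb{R}^3$ intersects $x(M)$ transversally in a closed unit speed curve $\gamma\colon[0,L]\to M$. Then the component of the force of $\gamma$ orthogonal to $\pi$ is $$\langle W([\gamma]),V\rangle=\int_0^L\frac{1}{\langle x_*(J\dot\gamma),V\rangle}\left\{\langle x_*(J\dot\gamma),V\rangle^2+H\langle x\circ\gamma,\xi\rangle\right\}ds,$$ where $V$ is a unit vector normal to $\pi$. If $$\int_0^L\frac{1}{\langle x_*(J\dot\gamma),V\rangle}\left\{\langle x_*(J\dot\gamma),V\rangle^2+H\langle x\circ\gamma,\xi\rangle\right\}ds\neq 0,$$ then $x$ does not admit a nontrivial isometric deformation through surfaces of constant mean curvature $H$. In particular, if $x$ is minimal ($H=0$) and the plane intersects it transversally in a closed curve, then, to within congruences, $M$ admits only one other minimal isometric immersion in $\mathbb{R}^3$, namely $-x$.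
   Context: $M$ carries the metric induced by $x$; an isometric immersion of $M$ is a smooth immersion $M\to\mathbb{R}^3$ inducing this same metric. $J$ is the complex structure on $M$ (rotation by $+\pi/2$) given by metric and orientation; $\xi$ is the oriented unit normal of $x$ (so $\xi\times x_*(X)=x_*(JX)$); the second fundamental form $A$ is given by $X\xi=-x_*(AX)$ and the mean curvature is $H=\frac12\mathrm{Tr}\,A$. In the integrals $\xi$ is evaluated along $\gamma$. That $\pi$ intersects $x(M)$ transversally in the closed curve $\gamma$ means that $\gamma$ is a smooth closed curve in $M$ with $x\circ\gamma\subset\pi$ and that $x$ is transversal to $\pi$ along $\gamma$ (so $\langle x_*(J\dot\gamma),V\rangle\ne0$ everywhere on $\gamma$). The force of a cycle $\gamma$ is $W([\gamma])=\int_\gamma\omega$, where $\omega$ is the closed $\mathbb{R}^3$-valued 1-form $\omega(X)=(Hx+\xi)\times x_*(X)$ on $M$; it depends only on the homology class of $\gamma$. A congruence is an orientation-preserving isometry of $\mathbb{R}^3$; two immersions $y_1,y_2$ of $M$ are congruent if $y_2=\Phi\circ y_1$ for a congruence $\Phi$. An isometric deformation of $x$ through surfaces of constant mean curvature $H$ is a smooth 1-parameter family $x_t\colon M\to\mathbb{R}^3$, $0\le t<\varepsilon$, of isometric immersions of $M$ with constant mean curvature $H$ and $x_0=x$; it is nontrivial if the $x_t$ are not all congruent to $x$.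
   Formalization: In the integrals the position vector is measured from an arbitrary point of π (x∘γ minus that point), since the literal formula fails when H≠0 and π misses the origin (parallels of a sphere); M is assumed connected, without which rigidity up to congruence fails. *)

theory Defs
  imports "HOL-Analysis.Analysis"
begin

section \<open>Smooth maps between Euclidean spaces\<close>

fun Ck_on :: "nat \<Rightarrow> 'a::euclidean_space set \<Rightarrow> ('a \<Rightarrow> 'b::real_normed_vector) \<Rightarrow> bool" where
  "Ck_on 0 S f \<longleftrightarrow> continuous_on S f"
| "Ck_on (Suc k) S f \<longleftrightarrow> (\<forall>p\<in>S. f differentiable (at p)) \<and>
     (\<forall>v. Ck_on k S (\<lambda>p. frechet_derivative f (at p) v))"

text \<open>\<open>smooth_open\<close> is meant for open sets. On an arbitrary set (a half-open parameter interval
  times an open set, below) smoothness means local smooth extendability.\<close>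

definition smooth_open :: "'a::euclidean_space set \<Rightarrow> ('a \<Rightarrow> 'b::real_normed_vector) \<Rightarrow> bool" where
  "smooth_open S f \<longleftrightarrow> (\<forall>k. Ck_on k S f)"

definition smooth_extendable_on ::
  "'a::euclidean_space set \<Rightarrow> ('a \<Rightarrow> 'b::real_normed_vector) \<Rightarrow> bool" where
  "smooth_extendable_on S f \<longleftrightarrow>
     (\<forall>p\<in>S. \<exists>U g. open U \<and> p \<in> U \<and> smooth_open U g \<and> (\<forall>q\<in>S \<inter> U. f q = g q))"

section \<open>Oriented surfaces\<close>

text \<open>The surface is the whole type \<open>'m\<close>. A chart is a pair \<open>(U, \<phi>)\<close>; values of \<open>\<phi>\<close> outside \<open>U\<close>
  are irrelevant. The atlas need not be maximal; it carries the orientation because its transition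
  maps have positive Jacobian determinant.\<close>

type_synonym 'm chart = "'m set \<times> ('m \<Rightarrow> real^2)"

definition oriented_smooth_atlas :: "'m::topological_space chart set \<Rightarrow> bool" where
  "oriented_smooth_atlas \<A> \<longleftrightarrow>
     (\<forall>(U, \<phi>)\<in>\<A>. open U \<and> open (\<phi> ` U) \<and> homeomorphism U (\<phi> ` U) \<phi> (inv_into U \<phi>)) \<and>
     (\<Union>(U, \<phi>)\<in>\<A>. U) = UNIV \<and>
     (\<forall>(U, \<phi>)\<in>\<A>. \<forall>(W, \<psi>)\<in>\<A>.
        smooth_open (\<phi> ` (U \<inter> W)) (\<psi> \<circ> inv_into U \<phi>) \<and>
        (\<forall>u\<in>\<phi> ` (U \<inter> W). det (matrix (frechet_derivative (\<psi> \<circ> inv_into U \<phi>) (at u))) > 0))"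

definition oriented_surface :: "'m::{t2_space, second_countable_topology} chart set \<Rightarrow> bool" where
  "oriented_surface \<A> \<longleftrightarrow> oriented_smooth_atlas \<A> \<and> connected (UNIV :: 'm set)"

text \<open>The tangent space at \<open>p\<close> is \<open>\<real>\<^sup>2\<close>, read in the coordinates of one chart \<open>chart_at \<A> p\<close> of the
  oriented atlas that is selected once and for all. Every pointwise notion below is independent of
  the selection, up to the coordinate change between tangent vectors.\<close>

definition chart_at :: "'m chart set \<Rightarrow> 'm \<Rightarrow> 'm chart" where
  "chart_at \<A> p = (SOME c. c \<in> \<A> \<and> p \<in> fst c)"

definition differential ::
  "'m chart set \<Rightarrow> ('m \<Rightarrow> 'b::real_normed_vector) \<Rightarrow> 'm \<Rightarrow> real^2 \<Rightarrow> 'b" where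
  "differential \<A> F p v =
     (case chart_at \<A> p of (U, \<phi>) \<Rightarrow> frechet_derivative (F \<circ> inv_into U \<phi>) (at (\<phi> p)) v)"

definition smooth_map :: "'m chart set \<Rightarrow> ('m \<Rightarrow> 'b::real_normed_vector) \<Rightarrow> bool" where
  "smooth_map \<A> F \<longleftrightarrow> (\<forall>(U, \<phi>)\<in>\<A>. smooth_open (\<phi> ` U) (F \<circ> inv_into U \<phi>))"

definition smooth_curve :: "'m::topological_space chart set \<Rightarrow> (real \<Rightarrow> 'm) \<Rightarrow> bool" where
  "smooth_curve \<A> \<gamma> \<longleftrightarrow>
     continuous_on UNIV \<gamma> \<and> (\<forall>(U, \<phi>)\<in>\<A>. smooth_open (\<gamma> -` U) (\<phi> \<circ> \<gamma>))"

text \<open>A smooth closed curve of length parameter \<open>L\<close> is a smooth map on \<open>\<real>/L\<int>\<close>, i.e. an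
  \<open>L\<close>-periodic smooth curve; the curve on \<open>[0, L]\<close> is its restriction.\<close>

definition smooth_closed_curve ::
  "'m::topological_space chart set \<Rightarrow> real \<Rightarrow> (real \<Rightarrow> 'm) \<Rightarrow> bool" where
  "smooth_closed_curve \<A> L \<gamma> \<longleftrightarrow> L > 0 \<and> smooth_curve \<A> \<gamma> \<and> (\<forall>s. \<gamma> (s + L) = \<gamma> s)"

definition velocity :: "'m chart set \<Rightarrow> (real \<Rightarrow> 'm) \<Rightarrow> real \<Rightarrow> real^2" where
  "velocity \<A> \<gamma> s = (case chart_at \<A> (\<gamma> s) of (U, \<phi>) \<Rightarrow> vector_derivative (\<phi> \<circ> \<gamma>) (at s))"

section \<open>Immersed surfaces in Euclidean 3-space\<close>

definition immersion :: "'m chart set \<Rightarrow> ('m \<Rightarrow> real^3) \<Rightarrow> bool" where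
  "immersion \<A> x \<longleftrightarrow> smooth_map \<A> x \<and> (\<forall>p. inj (differential \<A> x p))"

definition induced_metric ::
  "'m chart set \<Rightarrow> ('m \<Rightarrow> real^3) \<Rightarrow> 'm \<Rightarrow> real^2 \<Rightarrow> real^2 \<Rightarrow> real" where
  "induced_metric \<A> x p v w = differential \<A> x p v \<bullet> differential \<A> x p w"

text \<open>\<open>M\<close> carries the metric induced by \<open>x\<close>.\<close>

definition isometric_immersion ::
  "'m chart set \<Rightarrow> ('m \<Rightarrow> real^3) \<Rightarrow> ('m \<Rightarrow> real^3) \<Rightarrow> bool" where
  "isometric_immersion \<A> x y \<longleftrightarrow>
     immersion \<A> y \<and> (\<forall>p. induced_metric \<A> y p = induced_metric \<A> x p)"

text \<open>Rotation by \<open>+\<pi>/2\<close>: \<open>J v\<close> is orthogonal to \<open>v\<close>, of the same length, and \<open>(v, J v)\<close> is positively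
  oriented. The weak inequality only serves to include \<open>v = 0\<close>.\<close>

definition complex_structure ::
  "'m chart set \<Rightarrow> ('m \<Rightarrow> real^3) \<Rightarrow> 'm \<Rightarrow> real^2 \<Rightarrow> real^2" where
  "complex_structure \<A> x p v =
     (THE w. induced_metric \<A> x p v w = 0 \<and>
             induced_metric \<A> x p w w = induced_metric \<A> x p v v \<and>
             v $ 1 * w $ 2 - v $ 2 * w $ 1 \<ge> 0)"

definition unit_normal :: "'m chart set \<Rightarrow> ('m \<Rightarrow> real^3) \<Rightarrow> 'm \<Rightarrow> real^3" where
  "unit_normal \<A> x p =
     sgn (cross3 (differential \<A> x p (axis 1 1)) (differential \<A> x p (axis 2 1)))"

definition shape_operator ::
  "'m chart set \<Rightarrow> ('m \<Rightarrow> real^3) \<Rightarrow> 'm \<Rightarrow> real^2 \<Rightarrow> real^2" where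
  "shape_operator \<A> x p v =
     (THE w. differential \<A> (unit_normal \<A> x) p v = - differential \<A> x p w)"

definition mean_curvature :: "'m chart set \<Rightarrow> ('m \<Rightarrow> real^3) \<Rightarrow> 'm \<Rightarrow> real" where
  "mean_curvature \<A> x p = trace (matrix (shape_operator \<A> x p)) / 2"

definition constant_mean_curvature :: "'m chart set \<Rightarrow> ('m \<Rightarrow> real^3) \<Rightarrow> real \<Rightarrow> bool" where
  "constant_mean_curvature \<A> x H \<longleftrightarrow> (\<forall>p. mean_curvature \<A> x p = H)"

definition unit_speed ::
  "'m chart set \<Rightarrow> ('m \<Rightarrow> real^3) \<Rightarrow> (real \<Rightarrow> 'm) \<Rightarrow> bool" where
  "unit_speed \<A> x \<gamma> \<longleftrightarrow>
     (\<forall>s. induced_metric \<A> x (\<gamma> s) (velocity \<A> \<gamma> s) (velocity \<A> \<gamma> s) = 1)"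

section \<open>Force\<close>

definition force_form ::
  "'m chart set \<Rightarrow> ('m \<Rightarrow> real^3) \<Rightarrow> 'm \<Rightarrow> real^2 \<Rightarrow> real^3" where
  "force_form \<A> x p v =
     cross3 (mean_curvature \<A> x p *\<^sub>R x p + unit_normal \<A> x p) (differential \<A> x p v)"

definition force ::
  "'m chart set \<Rightarrow> ('m \<Rightarrow> real^3) \<Rightarrow> real \<Rightarrow> (real \<Rightarrow> 'm) \<Rightarrow> real^3" where
  "force \<A> x L \<gamma> = integral {0..L} (\<lambda>s. force_form \<A> x (\<gamma> s) (velocity \<A> \<gamma> s))"

section \<open>Planes and transversality\<close>

definition plane :: "(real^3) set \<Rightarrow> bool" where
  "plane P \<longleftrightarrow> affine P \<and> aff_dim P = 2"

definition unit_normal_to_plane :: "(real^3) set \<Rightarrow> real^3 \<Rightarrow> bool" where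
  "unit_normal_to_plane P V \<longleftrightarrow> norm V = 1 \<and> (\<forall>a\<in>P. \<forall>b\<in>P. (a - b) \<bullet> V = 0)"

text \<open>The image of the tangent space and the direction space of the plane together span \<open>\<real>\<^sup>3\<close>.\<close>

definition transversal_at ::
  "'m chart set \<Rightarrow> ('m \<Rightarrow> real^3) \<Rightarrow> (real^3) set \<Rightarrow> 'm \<Rightarrow> bool" where
  "transversal_at \<A> x P p \<longleftrightarrow>
     {differential \<A> x p v + (a - b) | v a b. a \<in> P \<and> b \<in> P} = UNIV"

definition meets_plane_transversally_in ::
  "'m chart set \<Rightarrow> ('m \<Rightarrow> real^3) \<Rightarrow> (real^3) set \<Rightarrow> (real \<Rightarrow> 'm) \<Rightarrow> bool" where
  "meets_plane_transversally_in \<A> x P \<gamma> \<longleftrightarrow>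
     (\<forall>s. x (\<gamma> s) \<in> P \<and> transversal_at \<A> x P (\<gamma> s))"

section \<open>Congruence and isometric deformations\<close>

text \<open>An isometry \<open>\<Phi>\<close> of \<open>\<real>\<^sup>3\<close> is affine with linear part \<open>q \<mapsto> \<Phi> q - \<Phi> 0\<close>.\<close>

definition congruence :: "(real^3 \<Rightarrow> real^3) \<Rightarrow> bool" where
  "congruence \<Phi> \<longleftrightarrow>
     (\<forall>a b. dist (\<Phi> a) (\<Phi> b) = dist a b) \<and> det (matrix (\<lambda>q. \<Phi> q - \<Phi> 0)) > 0"

definition congruent_immersions :: "('m \<Rightarrow> real^3) \<Rightarrow> ('m \<Rightarrow> real^3) \<Rightarrow> bool" where
  "congruent_immersions y1 y2 \<longleftrightarrow> (\<exists>\<Phi>. congruence \<Phi> \<and> y2 = \<Phi> \<circ> y1)"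

definition isometric_cmc_deformation ::
  "'m chart set \<Rightarrow> ('m \<Rightarrow> real^3) \<Rightarrow> real \<Rightarrow> real \<Rightarrow> (real \<Rightarrow> 'm \<Rightarrow> real^3) \<Rightarrow> bool" where
  "isometric_cmc_deformation \<A> x H \<epsilon> X \<longleftrightarrow>
     \<epsilon> > 0 \<and> X 0 = x \<and>
     (\<forall>t\<in>{0..<\<epsilon>}. isometric_immersion \<A> x (X t) \<and> constant_mean_curvature \<A> (X t) H) \<and>
     (\<forall>(U, \<phi>)\<in>\<A>.
        smooth_extendable_on ({0..<\<epsilon>} \<times> \<phi> ` U) (\<lambda>(t, u). X t (inv_into U \<phi> u)))"

definition admits_nontrivial_isometric_cmc_deformation ::
  "'m chart set \<Rightarrow> ('m \<Rightarrow> real^3) \<Rightarrow> real \<Rightarrow> bool" where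
  "admits_nontrivial_isometric_cmc_deformation \<A> x H \<longleftrightarrow>
     (\<exists>\<epsilon> X. isometric_cmc_deformation \<A> x H \<epsilon> X \<and> (\<exists>t\<in>{0..<\<epsilon>}. \<not> congruent_immersions x (X t)))"

definition minimal_isometric_immersion ::
  "'m chart set \<Rightarrow> ('m \<Rightarrow> real^3) \<Rightarrow> ('m \<Rightarrow> real^3) \<Rightarrow> bool" where
  "minimal_isometric_immersion \<A> x y \<longleftrightarrow>
     isometric_immersion \<A> x y \<and> constant_mean_curvature \<A> y 0"

section \<open>The integral in the force formula\<close>

text \<open>Here \<open>a s\<close> is the inner product of \<open>x\<^sub>*(J \<gamma>')\<close> with \<open>V\<close>. The position vector is measured from an
  origin \<open>orig\<close>; for \<open>orig = 0\<close> it is \<open>x \<circ> \<gamma>\<close>. The integral represents the normal component of the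
  force only if the origin lies in the plane: for the unit sphere (\<open>H = -1\<close> with respect to the
  outward normal) the force of every cycle vanishes, whereas over a parallel at height \<open>h \<noteq> 0\<close> the
  integrand for \<open>orig = 0\<close> is \<open>- h\<^sup>2 / a\<close> with \<open>a\<close> a nonzero constant. The force
  itself does not change under translations of \<open>\<real>\<^sup>3\<close>, and for \<open>H = 0\<close> the origin is irrelevant.\<close>

definition plane_curve_integral ::
  "'m chart set \<Rightarrow> ('m \<Rightarrow> real^3) \<Rightarrow> real \<Rightarrow> real^3 \<Rightarrow> real^3 \<Rightarrow> real \<Rightarrow> (real \<Rightarrow> 'm) \<Rightarrow> real" where
  "plane_curve_integral \<A> x H V orig L \<gamma> =
     (let a = (\<lambda>s. differential \<A> x (\<gamma> s)
                     (complex_structure \<A> x (\<gamma> s) (velocity \<A> \<gamma> s)) \<bullet> V)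
      in integral {0..L} (\<lambda>s. 1 / a s *
           ((a s)\<^sup>2 + H * ((x (\<gamma> s) - orig) \<bullet> unit_normal \<A> x (\<gamma> s)))))"

end

theory Submission
  imports Defs
begin

text \<open>Pointwise along \<open>\<gamma>\<close>, the integrand is the \<open>V\<close>-component of \<open>\<omega>\<close> up to the exact form
  \<open>H orig \<times> dx\<close>.

  Let \<open>y\<close> be isometric to \<open>x\<close> with the same \<open>H\<close>, and let \<open>R\<close> be the rotation with \<open>dy = R dx\<close> and
  \<open>\<xi>\<^sub>y = R \<xi>\<close>. The trace-free parts of both shape operators are solutions of the same
  Cauchy-Riemann type equation and have the same norm, so they differ by a rotation with a phase
  \<open>c\<close> that is locally constant away from the umbilics. The difference of one solution and \<open>c\<close> times
  the other solves the same equation, and a unique continuation argument of three circles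
  type, which avoids isothermal coordinates, makes \<open>c\<close> constant on \<open>M\<close>.

  With \<open>\<zeta> = \<xi> + H x\<close> one has \<open>dR w = R (\<Omega> \<times> w)\<close> for \<open>\<Omega> = - Im c d\<zeta> - (1 - Re c) \<xi> \<times> d\<zeta>\<close>. Integrating
  \<open>dy = R dx\<close> over the closed curve \<open>\<gamma>\<close> gives \<open>|Im c| |W| \<le> C |c - 1|\<^sup>2\<close>, where \<open>C\<close> depends only on \<open>x\<close> and
  \<open>\<gamma>\<close>. If \<open>W \<noteq> 0\<close>, the value \<open>c = 1\<close> is therefore isolated among the possible phases, and by continuity
  the phase of a deformation remains \<open>1\<close>, which means congruence. For \<open>H = 0\<close> the rotation of \<open>R\<close> by
  the angle of \<open>c\<close> about \<open>\<xi>\<close> is constant, hence \<open>Im c W = 0\<close> and \<open>c = \<plusminus>1\<close>.\<close>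

section \<open>Calculus of smooth maps\<close>

text \<open>Equality of the norms is the Gauss equation: isometric surfaces share the curvature
  \<open>K\<close>, and for equal \<open>H\<close> the norm is determined by
  \<open>H\<^sup>2 - K\<close>. The obstacle is the umbilics, where the phase is undetermined and
  across which it could jump. The Codazzi equation, written in an arbitrary oriented chart, has
  coefficients depending on the metric alone; this is why both surfaces, and complex combinations of
  their solutions, obey one and the same equation.

  The bound on \<open>Im c\<close> comes from comparing orders in \<open>c - 1\<close>. Since
  \<open>|c| = 1\<close>, \<open>1 - Re c = |c - 1|\<^sup>2 / 2\<close>, so the only first order
  part of \<Omega> is \<open>- Im c d\<zeta>\<close>. Integrating
  \<open>d(R x - y) = R (\<Omega> \<times> x)\<close> around the curve gives 0. Both \<Omega> and
  the drift of \<open>R\<close> are of first order, so replacing \<open>R\<close> by its value at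
  the start costs an error of second order, and the first order part integrates by parts to
  \<open>Im c W\<close>.\<close>

definition dderiv :: "'a::euclidean_space \<Rightarrow> ('a \<Rightarrow> 'b::real_normed_vector) \<Rightarrow> 'a \<Rightarrow> 'b" where
  "dderiv v F p = frechet_derivative F (at p) v"

lemma dderivI: "(F has_derivative F') (at p) \<Longrightarrow> dderiv v F p = F' v"
  by (simp add: dderiv_def frechet_derivative_at[symmetric])

lemma has_derivative_dderiv:
  "F differentiable (at p) \<Longrightarrow> (F has_derivative (\<lambda>v. dderiv v F p)) (at p)"
  unfolding dderiv_def using frechet_derivative_works by fastforce

lemma dderiv_cong_open:
  assumes "open S" "p \<in> S" "\<And>q. q \<in> S \<Longrightarrow> F q = G q"
  shows "dderiv v F p = dderiv v G p"
proof -
  have "(F has_derivative F') (at p) \<longleftrightarrow> (G has_derivative F') (at p)" for F'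
    using assms has_derivative_transform_within_open[of F F' p UNIV S G]
      has_derivative_transform_within_open[of G F' p UNIV S F] by auto
  \<comment> \<open>\<open>frechet_derivative\<close> is a choice among the derivatives, so
    equivalence for every candidate gives equality also where neither map is differentiable.\<close>
  then show ?thesis by (simp add: dderiv_def frechet_derivative_def)
qed

lemma differentiable_cong_open:
  assumes "open S" "p \<in> S" "\<And>q. q \<in> S \<Longrightarrow> F q = G q" "F differentiable (at p)"
  shows "G differentiable (at p)"
  using assms unfolding differentiable_def
  by (meson has_derivative_transform_within_open)

lemma dderiv_const [simp]: "dderiv v (\<lambda>p. c) p = 0"
  by (simp add: dderiv_def)

lemma dderiv_add:
  "F differentiable (at p) \<Longrightarrow> G differentiable (at p) \<Longrightarrow>
    dderiv v (\<lambda>p. F p + G p) p = dderiv v F p + dderiv v G p"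
  by (rule dderivI[where F' = "\<lambda>v. dderiv v F p + dderiv v G p"])
     (intro has_derivative_add has_derivative_dderiv)

lemma dderiv_diff:
  "F differentiable (at p) \<Longrightarrow> G differentiable (at p) \<Longrightarrow>
    dderiv v (\<lambda>p. F p - G p) p = dderiv v F p - dderiv v G p"
  by (rule dderivI[where F' = "\<lambda>v. dderiv v F p - dderiv v G p"])
     (intro has_derivative_diff has_derivative_dderiv)

lemma dderiv_linear:
  "bounded_linear h \<Longrightarrow> F differentiable (at p) \<Longrightarrow> dderiv v (\<lambda>p. h (F p)) p = h (dderiv v F p)"
  by (rule dderivI[where F' = "\<lambda>v. h (dderiv v F p)"])
     (rule bounded_linear.has_derivative[OF _ has_derivative_dderiv])

lemma dderiv_bilinear:
  "bounded_bilinear h \<Longrightarrow> F differentiable (at p) \<Longrightarrow> G differentiable (at p) \<Longrightarrow>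
    dderiv v (\<lambda>p. h (F p) (G p)) p = h (F p) (dderiv v G p) + h (dderiv v F p) (G p)"
  by (rule dderivI[where F' = "\<lambda>v. h (F p) (dderiv v G p) + h (dderiv v F p) (G p)"])
     (rule bounded_bilinear.FDERIV[OF _ has_derivative_dderiv has_derivative_dderiv])

lemma linear_dderiv:
  "F differentiable (at p) \<Longrightarrow> linear (\<lambda>v. dderiv v F p)"
  unfolding dderiv_def using linear_frechet_derivative by blast

lemma
  assumes "F differentiable (at p)"
  shows dderiv_direction_diff: "dderiv (v - w) F p = dderiv v F p - dderiv w F p"
    and dderiv_direction_scaleR: "dderiv (c *\<^sub>R v) F p = c *\<^sub>R dderiv v F p"
  using linear_diff[OF linear_dderiv[OF assms]] linear_scale[OF linear_dderiv[OF assms]] by auto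

lemma dderiv_expand2:
  fixes F :: "real^2 \<Rightarrow> 'b::real_normed_vector"
  assumes "F differentiable (at p)"
  shows "dderiv v F p = v $ 1 *\<^sub>R dderiv (axis 1 1) F p + v $ 2 *\<^sub>R dderiv (axis 2 1) F p"
proof -
  note lin = linear_dderiv[OF assms]
  have "v = v $ 1 *\<^sub>R axis 1 1 + v $ 2 *\<^sub>R axis 2 1"
    by (simp add: vec_eq_iff forall_2 axis_def)
  then have "dderiv v F p = dderiv (v $ 1 *\<^sub>R axis 1 1 + v $ 2 *\<^sub>R axis 2 1) F p" by simp
  also have "\<dots> = v $ 1 *\<^sub>R dderiv (axis 1 1) F p + v $ 2 *\<^sub>R dderiv (axis 2 1) F p"
    by (simp only: linear_add[OF lin] linear_scale[OF lin])
  finally show ?thesis .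
qed

section \<open>Closure properties of smooth maps on open sets\<close>

lemma Ck_on_Suc_dderiv:
  "Ck_on (Suc k) S f \<longleftrightarrow> (\<forall>p\<in>S. f differentiable (at p)) \<and> (\<forall>v. Ck_on k S (dderiv v f))"
  by (simp add: dderiv_def[abs_def])

lemma Ck_on_SucI:
  "(\<And>p. p \<in> S \<Longrightarrow> f differentiable (at p)) \<Longrightarrow> (\<And>v. Ck_on k S (dderiv v f)) \<Longrightarrow> Ck_on (Suc k) S f"
  unfolding Ck_on_Suc_dderiv by blast

lemma Ck_on_SucD:
  assumes "Ck_on (Suc k) S f"
  shows "p \<in> S \<Longrightarrow> f differentiable (at p)" "Ck_on k S (dderiv v f)"
  using assms unfolding Ck_on_Suc_dderiv by blast+

lemma Ck_on_cong:
  "open S \<Longrightarrow> (\<And>p. p \<in> S \<Longrightarrow> f p = g p) \<Longrightarrow> Ck_on k S f \<Longrightarrow> Ck_on k S g"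
proof (induction k arbitrary: f g)
  case 0
  then show ?case using continuous_on_cong[of S S f g] by simp
next
  case (Suc k)
  show ?case
  proof (rule Ck_on_SucI)
    show "g differentiable (at p)" if "p \<in> S" for p
      by (rule differentiable_cong_open[OF Suc.prems(1) that Suc.prems(2) Ck_on_SucD(1)[OF Suc.prems(3) that]])
    show "Ck_on k S (dderiv v g)" for v
      by (rule Suc.IH[OF Suc.prems(1) dderiv_cong_open[OF Suc.prems(1) _ Suc.prems(2)] Ck_on_SucD(2)[OF Suc.prems(3)]])
  qed
qed

lemma Ck_on_mono: "Ck_on (Suc k) S f \<Longrightarrow> Ck_on k S f"
proof (induction k arbitrary: f)
  case 0
  then have "f differentiable_on S"
    using Ck_on_SucD(1)[OF 0] by (simp add: differentiable_on_def differentiable_at_withinI)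
  then show ?case by (simp add: differentiable_imp_continuous_on)
next
  case (Suc k)
  show ?case
  proof (rule Ck_on_SucI)
    show "f differentiable (at p)" if "p \<in> S" for p by (rule Ck_on_SucD(1)[OF Suc.prems that])
    show "Ck_on k S (dderiv v f)" for v by (rule Suc.IH[OF Ck_on_SucD(2)[OF Suc.prems]])
  qed
qed

lemma Ck_on_subset: "Ck_on k S f \<Longrightarrow> T \<subseteq> S \<Longrightarrow> Ck_on k T f"
proof (induction k arbitrary: f)
  case 0 then show ?case by (simp add: continuous_on_subset)
next
  case (Suc k)
  show ?case
  proof (rule Ck_on_SucI)
    show "f differentiable (at p)" if "p \<in> T" for p
      using that Suc.prems(2) by (intro Ck_on_SucD(1)[OF Suc.prems(1)]) blast
    show "Ck_on k T (dderiv v f)" for v by (rule Suc.IH[OF Ck_on_SucD(2)[OF Suc.prems(1)] Suc.prems(2)])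
  qed
qed

lemma Ck_on_const: "Ck_on k S (\<lambda>p. c)"
proof (induction k arbitrary: c)
  case (Suc k)
  have 0: "dderiv v (\<lambda>p. c) = (\<lambda>p. 0)" for v by (simp add: fun_eq_iff)
  show ?case by (rule Ck_on_SucI) (simp_all add: 0 Suc del: Ck_on.simps)
qed simp

lemma Ck_on_add: "open S \<Longrightarrow> Ck_on k S f \<Longrightarrow> Ck_on k S g \<Longrightarrow> Ck_on k S (\<lambda>p. f p + g p)"
proof (induction k arbitrary: f g)
  case 0 then show ?case by (simp add: continuous_on_add)
next
  case (Suc k)
  note f = Ck_on_SucD[OF Suc.prems(2)] and g = Ck_on_SucD[OF Suc.prems(3)]
  show ?case
  proof (rule Ck_on_SucI)
    show "(\<lambda>p. f p + g p) differentiable (at p)" if "p \<in> S" for p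
      by (intro differentiable_add f(1) g(1) that)
    show "Ck_on k S (dderiv v (\<lambda>p. f p + g p))" for v
      by (rule Ck_on_cong[OF Suc.prems(1) _ Suc.IH[OF Suc.prems(1) f(2)[of v] g(2)[of v]]])
         (simp add: dderiv_add f(1) g(1))
  qed
qed

lemma Ck_on_linear: "open S \<Longrightarrow> bounded_linear h \<Longrightarrow> Ck_on k S f \<Longrightarrow> Ck_on k S (\<lambda>p. h (f p))"
proof (induction k arbitrary: f)
  case 0 then show ?case by (simp add: bounded_linear.continuous_on)
next
  case (Suc k)
  note f = Ck_on_SucD[OF Suc.prems(3)]
  show ?case
  proof (rule Ck_on_SucI)
    show "(\<lambda>p. h (f p)) differentiable (at p)" if "p \<in> S" for p
      using bounded_linear.has_derivative[OF Suc.prems(2) has_derivative_dderiv[OF f(1)[OF that]]]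
      by (rule differentiableI)
    show "Ck_on k S (dderiv v (\<lambda>p. h (f p)))" for v
      by (rule Ck_on_cong[OF Suc.prems(1) _ Suc.IH[OF Suc.prems(1,2) f(2)[of v]]])
         (simp add: dderiv_linear Suc.prems f(1))
  qed
qed

text \<open>One product rule covers multiplication, scaling, inner and cross products. In each term
  of the derivative one factor has lost an order; \<open>Ck_on_mono\<close> lowers the other to
  match.\<close>

lemma Ck_on_bilinear:
  "open S \<Longrightarrow> bounded_bilinear h \<Longrightarrow> Ck_on k S f \<Longrightarrow> Ck_on k S g \<Longrightarrow> Ck_on k S (\<lambda>p. h (f p) (g p))"
proof (induction k arbitrary: f g)
  case 0 then show ?case by (simp add: bounded_bilinear.continuous_on)
next
  case (Suc k)
  note f = Ck_on_SucD[OF Suc.prems(3)] and g = Ck_on_SucD[OF Suc.prems(4)]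
  note IH = Suc.IH[OF Suc.prems(1,2)]
  show ?case
  proof (rule Ck_on_SucI)
    show "(\<lambda>p. h (f p) (g p)) differentiable (at p)" if "p \<in> S" for p
      using bounded_bilinear.FDERIV[OF Suc.prems(2) has_derivative_dderiv[OF f(1)[OF that]]
          has_derivative_dderiv[OF g(1)[OF that]]]
      by (rule differentiableI)
    show "Ck_on k S (dderiv v (\<lambda>p. h (f p) (g p)))" for v
      by (rule Ck_on_cong[OF Suc.prems(1) _ Ck_on_add[OF Suc.prems(1)
            IH[OF Ck_on_mono[OF Suc.prems(3)] g(2)[of v]] IH[OF f(2)[of v] Ck_on_mono[OF Suc.prems(4)]]]])
         (simp add: dderiv_bilinear Suc.prems(2) f(1) g(1))
  qed
qed

text \<open>The induction keeps \<open>f\<close> fixed: the derivative contains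
  \<open>inverse (f p)\<close> itself, but only at the lower order.\<close>

lemma Ck_on_inverse:
  fixes f :: "'a::euclidean_space \<Rightarrow> 'b::real_normed_field"
  shows "open S \<Longrightarrow> (\<And>p. p \<in> S \<Longrightarrow> f p \<noteq> 0) \<Longrightarrow> Ck_on k S f \<Longrightarrow> Ck_on k S (\<lambda>p. inverse (f p))"
proof (induction k)
  case 0 then show ?case by (auto intro: continuous_on_inverse)
next
  case (Suc k)
  note f = Ck_on_SucD[OF Suc.prems(3)]
  have d: "((\<lambda>p. inverse (f p)) has_derivative (\<lambda>v. - (inverse (f p) * dderiv v f p * inverse (f p)))) (at p)"
    if "p \<in> S" for p
    by (rule Deriv.has_derivative_inverse[OF Suc.prems(2)[OF that] has_derivative_dderiv[OF f(1)[OF that]]])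
  have i: "Ck_on k S (\<lambda>p. inverse (f p))"
    by (rule Suc.IH[OF Suc.prems(1,2) Ck_on_mono[OF Suc.prems(3)]])
  show ?case
  proof (rule Ck_on_SucI)
    show "(\<lambda>p. inverse (f p)) differentiable (at p)" if "p \<in> S" for p
      using d[OF that] by (rule differentiableI)
    have "Ck_on k S (\<lambda>p. - (inverse (f p) * dderiv v f p * inverse (f p)))" for v
      by (intro Ck_on_linear[OF Suc.prems(1) bounded_linear_minus[OF bounded_linear_ident]]
          Ck_on_bilinear[OF Suc.prems(1) bounded_bilinear_mult] i f(2))
    then show "Ck_on k S (dderiv v (\<lambda>p. inverse (f p)))" for v
      by (rule Ck_on_cong[OF Suc.prems(1), rotated]) (rule dderivI[OF d, symmetric])
  qed
qed

lemma Ck_on_sqrt: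
  fixes f :: "'a::euclidean_space \<Rightarrow> real"
  shows "open S \<Longrightarrow> (\<And>p. p \<in> S \<Longrightarrow> f p > 0) \<Longrightarrow> Ck_on k S f \<Longrightarrow> Ck_on k S (\<lambda>p. sqrt (f p))"
proof (induction k)
  case 0 then show ?case by (auto intro: continuous_on_real_sqrt)
next
  case (Suc k)
  note f = Ck_on_SucD[OF Suc.prems(3)]
  have d: "((\<lambda>p. sqrt (f p)) has_derivative (\<lambda>v. dderiv v f p * (inverse (sqrt (f p)) / 2))) (at p)"
    if "p \<in> S" for p
    by (rule has_derivative_real_sqrt[OF Suc.prems(2)[OF that] has_derivative_dderiv[OF f(1)[OF that]]])
  have "Ck_on k S (\<lambda>p. sqrt (f p))"
    by (rule Suc.IH[OF Suc.prems(1,2) Ck_on_mono[OF Suc.prems(3)]])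
  then have i: "Ck_on k S (\<lambda>p. inverse (sqrt (f p)))"
    using Suc.prems(1) by (rule_tac Ck_on_inverse) (auto dest: Suc.prems(2))
  show ?case
  proof (rule Ck_on_SucI)
    show "(\<lambda>p. sqrt (f p)) differentiable (at p)" if "p \<in> S" for p
      using d[OF that] by (rule differentiableI)
    have "Ck_on k S (\<lambda>p. dderiv v f p * (inverse (sqrt (f p)) / 2))" for v
      by (intro Ck_on_linear[OF Suc.prems(1) bounded_linear_divide]
          Ck_on_bilinear[OF Suc.prems(1) bounded_bilinear_mult] i f(2))
    then show "Ck_on k S (dderiv v (\<lambda>p. sqrt (f p)))" for v
      by (rule Ck_on_cong[OF Suc.prems(1), rotated]) (rule dderivI[OF d, symmetric])
  qed
qed

lemma smooth_open_differentiable: "smooth_open S f \<Longrightarrow> p \<in> S \<Longrightarrow> f differentiable (at p)"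
  unfolding smooth_open_def by (metis Ck_on.simps(2))

lemma smooth_open_has_derivative:
  "smooth_open S f \<Longrightarrow> p \<in> S \<Longrightarrow> (f has_derivative (\<lambda>v. dderiv v f p)) (at p)"
  by (intro has_derivative_dderiv smooth_open_differentiable)

lemma smooth_open_dderiv: "smooth_open S f \<Longrightarrow> smooth_open S (dderiv v f)"
  unfolding smooth_open_def by (metis Ck_on_Suc_dderiv)

lemma smooth_open_continuous_on: "smooth_open S f \<Longrightarrow> continuous_on S f"
  unfolding smooth_open_def by (metis Ck_on.simps(1))

lemma smooth_open_cong:
  "open S \<Longrightarrow> smooth_open S f \<Longrightarrow> (\<And>p. p \<in> S \<Longrightarrow> f p = g p) \<Longrightarrow> smooth_open S g"
  unfolding smooth_open_def using Ck_on_cong by blast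

lemma smooth_open_subset: "smooth_open S f \<Longrightarrow> T \<subseteq> S \<Longrightarrow> smooth_open T f"
  unfolding smooth_open_def using Ck_on_subset by blast

lemma smooth_open_const: "smooth_open S (\<lambda>p. c)"
  unfolding smooth_open_def using Ck_on_const by blast

lemma smooth_open_add: "open S \<Longrightarrow> smooth_open S f \<Longrightarrow> smooth_open S g \<Longrightarrow> smooth_open S (\<lambda>p. f p + g p)"
  unfolding smooth_open_def using Ck_on_add by blast

lemma smooth_open_linear:
  "open S \<Longrightarrow> bounded_linear h \<Longrightarrow> smooth_open S f \<Longrightarrow> smooth_open S (\<lambda>p. h (f p))"
  unfolding smooth_open_def using Ck_on_linear by blast

lemma smooth_open_bilinear:
  "open S \<Longrightarrow> bounded_bilinear h \<Longrightarrow> smooth_open S f \<Longrightarrow> smooth_open S g \<Longrightarrow>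
    smooth_open S (\<lambda>p. h (f p) (g p))"
  unfolding smooth_open_def using Ck_on_bilinear by blast

lemma smooth_open_minus: "open S \<Longrightarrow> smooth_open S f \<Longrightarrow> smooth_open S (\<lambda>p. - f p)"
  by (rule smooth_open_linear[OF _ bounded_linear_minus[OF bounded_linear_ident]])

lemma smooth_open_diff: "open S \<Longrightarrow> smooth_open S f \<Longrightarrow> smooth_open S g \<Longrightarrow> smooth_open S (\<lambda>p. f p - g p)"
  using smooth_open_add[of S f "\<lambda>p. - g p"] smooth_open_minus[of S g] by simp

lemma smooth_open_inverse:
  fixes f :: "'a::euclidean_space \<Rightarrow> 'b::real_normed_field"
  shows "open S \<Longrightarrow> smooth_open S f \<Longrightarrow> (\<And>p. p \<in> S \<Longrightarrow> f p \<noteq> 0) \<Longrightarrow> smooth_open S (\<lambda>p. inverse (f p))"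
  unfolding smooth_open_def using Ck_on_inverse by blast

lemma smooth_open_sqrt:
  fixes f :: "'a::euclidean_space \<Rightarrow> real"
  shows "open S \<Longrightarrow> smooth_open S f \<Longrightarrow> (\<And>p. p \<in> S \<Longrightarrow> f p > 0) \<Longrightarrow> smooth_open S (\<lambda>p. sqrt (f p))"
  unfolding smooth_open_def using Ck_on_sqrt by blast

lemma bounded_bilinear_cross3: "bounded_bilinear cross3"
  using bilinear_cross bilinear_conv_bounded_bilinear by blast

lemmas smooth_open_mult = smooth_open_bilinear[OF _ bounded_bilinear_mult]
lemmas smooth_open_inner = smooth_open_bilinear[OF _ bounded_bilinear_inner]
lemmas smooth_open_scaleR = smooth_open_bilinear[OF _ bounded_bilinear_scaleR]
lemmas smooth_open_cross3 = smooth_open_bilinear[OF _ bounded_bilinear_cross3]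

lemmas dderiv_mult = dderiv_bilinear[OF bounded_bilinear_mult]
lemmas dderiv_inner = dderiv_bilinear[OF bounded_bilinear_inner]
lemmas dderiv_scaleR = dderiv_bilinear[OF bounded_bilinear_scaleR]

lemma smooth_open_divide:
  fixes f g :: "'a::euclidean_space \<Rightarrow> 'b::real_normed_field"
  shows "open S \<Longrightarrow> smooth_open S f \<Longrightarrow> smooth_open S g \<Longrightarrow> (\<And>p. p \<in> S \<Longrightarrow> g p \<noteq> 0) \<Longrightarrow>
    smooth_open S (\<lambda>p. f p / g p)"
  unfolding divide_inverse by (intro smooth_open_mult smooth_open_inverse)

lemma smooth_open_norm:
  fixes f :: "'a::euclidean_space \<Rightarrow> 'b::real_inner"
  shows "open S \<Longrightarrow> smooth_open S f \<Longrightarrow> (\<And>p. p \<in> S \<Longrightarrow> f p \<noteq> 0) \<Longrightarrow> smooth_open S (\<lambda>p. norm (f p))"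
  unfolding norm_eq_sqrt_inner by (intro smooth_open_sqrt smooth_open_inner) auto

lemma smooth_open_sgn:
  fixes f :: "'a::euclidean_space \<Rightarrow> 'b::real_inner"
  shows "open S \<Longrightarrow> smooth_open S f \<Longrightarrow> (\<And>p. p \<in> S \<Longrightarrow> f p \<noteq> 0) \<Longrightarrow> smooth_open S (\<lambda>p. sgn (f p))"
  unfolding sgn_div_norm by (intro smooth_open_scaleR smooth_open_inverse smooth_open_norm) auto

lemma smooth_open_Complex:
  assumes "open S" "smooth_open S f" "smooth_open S g"
  shows "smooth_open S (\<lambda>p. Complex (f p) (g p))"
proof -
  have "smooth_open S (\<lambda>p. of_real (f p) + \<i> * of_real (g p))"
    by (intro smooth_open_add smooth_open_mult smooth_open_const
        smooth_open_linear[OF _ bounded_linear_of_real] assms)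
  then show ?thesis by (simp add: Complex_eq)
qed

lemma smooth_open_cnj: "open S \<Longrightarrow> smooth_open S f \<Longrightarrow> smooth_open S (\<lambda>p. cnj (f p))"
  by (rule smooth_open_linear[OF _ bounded_linear_cnj])

lemma dderiv_Complex:
  assumes "f differentiable (at p)" "g differentiable (at p)"
  shows "dderiv v (\<lambda>p. Complex (f p) (g p)) p = Complex (dderiv v f p) (dderiv v g p)"
proof (rule dderivI)
  have "((\<lambda>p. of_real (f p) + \<i> * of_real (g p)) has_derivative
     (\<lambda>v. of_real (dderiv v f p) + \<i> * of_real (dderiv v g p))) (at p)"
    using assms by (auto intro!: derivative_eq_intros has_derivative_dderiv)
  then show "((\<lambda>p. Complex (f p) (g p)) has_derivative (\<lambda>v. Complex (dderiv v f p) (dderiv v g p))) (at p)"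
    by (simp add: Complex_eq)
qed

lemma has_vector_derivative_line:
  assumes "F differentiable (at (p + t *\<^sub>R v))"
  shows "((\<lambda>t. F (p + t *\<^sub>R v)) has_vector_derivative dderiv v F (p + t *\<^sub>R v)) (at t)"
proof -
  have "((\<lambda>t. p + t *\<^sub>R v) has_derivative (\<lambda>h. h *\<^sub>R v)) (at t)"
    by (auto intro!: derivative_eq_intros)
  from has_derivative_compose[OF this has_derivative_dderiv[OF assms]]
  show ?thesis
    unfolding has_vector_derivative_def
    using linear_scale[OF linear_dderiv[OF assms]] by simp
qed

text \<open>A second difference is a mixed derivative at an intermediate point, by the mean value theorem
  applied twice. It is symmetric in the two directions.\<close>

lemma second_difference_mvt:
  fixes F :: "'a::euclidean_space \<Rightarrow> real"
  assumes F: "smooth_open S F" and "s > 0"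
    and S: "\<And>a b. 0 \<le> a \<Longrightarrow> a \<le> s \<Longrightarrow> 0 \<le> b \<Longrightarrow> b \<le> s \<Longrightarrow> p + a *\<^sub>R v + b *\<^sub>R w \<in> S"
  obtains a b where "0 < a" "a < s" "0 < b" "b < s"
    "F (p + s *\<^sub>R v + s *\<^sub>R w) - F (p + s *\<^sub>R v) - F (p + s *\<^sub>R w) + F p
      = s * s * dderiv w (dderiv v F) (p + a *\<^sub>R v + b *\<^sub>R w)"
proof -
  have d: "((\<lambda>t. G (q + t *\<^sub>R u)) has_real_derivative dderiv u G (q + t *\<^sub>R u)) (at t)"
    if "G differentiable (at (q + t *\<^sub>R u))" for q t u and G :: "'a \<Rightarrow> real"
    using has_vector_derivative_line[OF that] by (simp add: has_real_derivative_iff_has_vector_derivative)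
  define h where "h t = F ((p + s *\<^sub>R w) + t *\<^sub>R v) - F (p + t *\<^sub>R v)" for t
  have S': "p + s *\<^sub>R w + t *\<^sub>R v \<in> S" "p + t *\<^sub>R v \<in> S" if "0 \<le> t" "t \<le> s" for t
    using S[of t s] S[of t 0] that \<open>s > 0\<close> by (auto simp: algebra_simps)
  have "(h has_real_derivative dderiv v F ((p + s *\<^sub>R w) + t *\<^sub>R v) - dderiv v F (p + t *\<^sub>R v)) (at t)"
    if "0 \<le> t" "t \<le> s" for t
    unfolding h_def[abs_def] using S'[OF that] F
    by (intro DERIV_diff d smooth_open_differentiable)
  then obtain a where a: "0 < a" "a < s"
    "h s - h 0 = (s - 0) * (dderiv v F ((p + s *\<^sub>R w) + a *\<^sub>R v) - dderiv v F (p + a *\<^sub>R v))"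
    using MVT2[of 0 s h "\<lambda>t. dderiv v F ((p + s *\<^sub>R w) + t *\<^sub>R v) - dderiv v F (p + t *\<^sub>R v)"] \<open>s > 0\<close>
    by blast
  have "((\<lambda>t. dderiv v F ((p + a *\<^sub>R v) + t *\<^sub>R w)) has_real_derivative
        dderiv w (dderiv v F) ((p + a *\<^sub>R v) + t *\<^sub>R w)) (at t)" if "0 \<le> t" "t \<le> s" for t
    using that a S[of a t] F by (intro d smooth_open_differentiable smooth_open_dderiv) auto
  then obtain b where b: "0 < b" "b < s"
    "dderiv v F ((p + a *\<^sub>R v) + s *\<^sub>R w) - dderiv v F ((p + a *\<^sub>R v) + 0 *\<^sub>R w)
      = (s - 0) * dderiv w (dderiv v F) ((p + a *\<^sub>R v) + b *\<^sub>R w)"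
    using MVT2[of 0 s "\<lambda>t. dderiv v F ((p + a *\<^sub>R v) + t *\<^sub>R w)"
        "\<lambda>t. dderiv w (dderiv v F) ((p + a *\<^sub>R v) + t *\<^sub>R w)"] \<open>s > 0\<close>
    by blast
  have "p + s *\<^sub>R w + a *\<^sub>R v = p + a *\<^sub>R v + s *\<^sub>R w" "p + s *\<^sub>R w + s *\<^sub>R v = p + s *\<^sub>R v + s *\<^sub>R w"
    by (simp_all add: algebra_simps)
  with a b have "F (p + s *\<^sub>R v + s *\<^sub>R w) - F (p + s *\<^sub>R v) - F (p + s *\<^sub>R w) + F p
      = s * s * dderiv w (dderiv v F) (p + a *\<^sub>R v + b *\<^sub>R w)"
    by (simp add: h_def)
  with a b that show ?thesis by blast
qed

lemma dderiv_commute_real: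
  fixes F :: "'a::euclidean_space \<Rightarrow> real"
  assumes "open S" "smooth_open S F" "p \<in> S"
  shows "dderiv w (dderiv v F) p = dderiv v (dderiv w F) p"
proof (rule ccontr)
  assume ne: "dderiv w (dderiv v F) p \<noteq> dderiv v (dderiv w F) p"
  define e where "e = \<bar>dderiv w (dderiv v F) p - dderiv v (dderiv w F) p\<bar> / 2"
  have "e > 0" using ne by (simp add: e_def)
  have c: "isCont (dderiv a (dderiv b F)) p" for a b
    using smooth_open_continuous_on[OF smooth_open_dderiv[OF smooth_open_dderiv[OF assms(2)]]] assms
    by (simp add: continuous_on_eq_continuous_at)
  obtain d1 where d1: "d1 > 0" "\<And>q. dist q p < d1 \<Longrightarrow> dist (dderiv w (dderiv v F) q) (dderiv w (dderiv v F) p) < e"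
    using c[of w v] \<open>e > 0\<close> unfolding continuous_at_eps_delta by meson
  obtain d2 where d2: "d2 > 0" "\<And>q. dist q p < d2 \<Longrightarrow> dist (dderiv v (dderiv w F) q) (dderiv v (dderiv w F) p) < e"
    using c[of v w] \<open>e > 0\<close> unfolding continuous_at_eps_delta by meson
  obtain d3 where d3: "d3 > 0" "ball p d3 \<subseteq> S" using assms openE by blast
  define d where "d = min d1 (min d2 d3)"
  \<comment> \<open>Makes the parallelogram with edges \<open>s v\<close> and \<open>s w\<close>
    stay within \<open>d\<close> of \<open>p\<close>; the summand 1 covers
    \<open>v = w = 0\<close>.\<close>
  define s where "s = d / (2 * (norm v + norm w + 1))"
  have "d > 0" using d1 d2 d3 by (simp add: d_def)
  have pos: "norm v + norm w + 1 > 0" by (simp add: add_nonneg_pos)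
  have "s > 0" using \<open>d > 0\<close> pos by (simp add: s_def)
  have "s * (norm v + norm w + 1) = d / 2" using pos by (simp add: s_def field_simps)
  then have sd: "s * norm v + s * norm w < d" using \<open>d > 0\<close> \<open>s > 0\<close> by (simp add: algebra_simps)
  have nb: "dist (p + a *\<^sub>R v + b *\<^sub>R w) p < d" if "0 \<le> a" "a \<le> s" "0 \<le> b" "b \<le> s" for a b
  proof -
    have "dist (p + a *\<^sub>R v + b *\<^sub>R w) p \<le> a * norm v + b * norm w"
      using that norm_triangle_ineq[of "a *\<^sub>R v" "b *\<^sub>R w"] by (simp add: dist_norm add.assoc)
    also have "\<dots> \<le> s * norm v + s * norm w"
      using that by (intro add_mono mult_right_mono) auto
    finally show ?thesis using sd by simp
  qed
  have inS: "p + a *\<^sub>R v + b *\<^sub>R w \<in> S" "p + b *\<^sub>R w + a *\<^sub>R v \<in> S"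
    if "0 \<le> a" "a \<le> s" "0 \<le> b" "b \<le> s" for a b
  proof -
    have *: "p + b *\<^sub>R w + a *\<^sub>R v = p + a *\<^sub>R v + b *\<^sub>R w" by simp
    show "p + a *\<^sub>R v + b *\<^sub>R w \<in> S" "p + b *\<^sub>R w + a *\<^sub>R v \<in> S"
      unfolding * using nb[OF that] d3(2) by (auto simp: d_def dist_commute)
  qed
  obtain a b where 1: "0 < a" "a < s" "0 < b" "b < s"
    "F (p + s *\<^sub>R v + s *\<^sub>R w) - F (p + s *\<^sub>R v) - F (p + s *\<^sub>R w) + F p
      = s * s * dderiv w (dderiv v F) (p + a *\<^sub>R v + b *\<^sub>R w)"
    using second_difference_mvt[OF assms(2) \<open>s > 0\<close>] inS by metis
  obtain b' a' where 2: "0 < b'" "b' < s" "0 < a'" "a' < s"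
    "F (p + s *\<^sub>R w + s *\<^sub>R v) - F (p + s *\<^sub>R w) - F (p + s *\<^sub>R v) + F p
      = s * s * dderiv v (dderiv w F) (p + b' *\<^sub>R w + a' *\<^sub>R v)"
    using second_difference_mvt[OF assms(2) \<open>s > 0\<close>, of p w v] inS by metis
  have sw: "p + b' *\<^sub>R w + a' *\<^sub>R v = p + a' *\<^sub>R v + b' *\<^sub>R w" "p + s *\<^sub>R w + s *\<^sub>R v = p + s *\<^sub>R v + s *\<^sub>R w"
    by simp_all
  \<comment> \<open>Both mixed derivatives, at different intermediate points, compute the same
    second difference.\<close>
  have "s * s * dderiv w (dderiv v F) (p + a *\<^sub>R v + b *\<^sub>R w) = s * s * dderiv v (dderiv w F) (p + a' *\<^sub>R v + b' *\<^sub>R w)"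
    using 1(5) 2(5) unfolding sw by linarith
  then have "dderiv w (dderiv v F) (p + a *\<^sub>R v + b *\<^sub>R w) = dderiv v (dderiv w F) (p + a' *\<^sub>R v + b' *\<^sub>R w)"
    using \<open>s > 0\<close> by simp
  moreover have "dist (dderiv w (dderiv v F) (p + a *\<^sub>R v + b *\<^sub>R w)) (dderiv w (dderiv v F) p) < e"
    using 1 nb[of a b] by (intro d1) (auto simp: d_def)
  moreover have "dist (dderiv v (dderiv w F) (p + a' *\<^sub>R v + b' *\<^sub>R w)) (dderiv v (dderiv w F) p) < e"
    using 2 nb[of a' b'] by (intro d2) (auto simp: d_def)
  moreover have "dist A B \<ge> 2 * e \<Longrightarrow> X = Y \<Longrightarrow> dist X A < e \<Longrightarrow> dist Y B < e \<Longrightarrow> False"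
    for A B X Y :: real
    using dist_triangle2[of A B X] by (simp add: dist_commute)
  ultimately show False by (metis dist_real_def e_def field_sum_of_halves mult_2 order_refl)
qed

text \<open>Pairing with every fixed vector reduces the vector valued case to the real one.\<close>

lemma dderiv_commute:
  fixes F :: "'a::euclidean_space \<Rightarrow> 'b::real_inner"
  assumes "open S" "smooth_open S F" "p \<in> S"
  shows "dderiv w (dderiv v F) p = dderiv v (dderiv w F) p"
proof -
  have i: "dderiv a (dderiv b (\<lambda>q. F q \<bullet> z)) p = dderiv a (dderiv b F) p \<bullet> z" for a b z
  proof -
    have "dderiv b (\<lambda>q. F q \<bullet> z) q = dderiv b F q \<bullet> z" if "q \<in> S" for q
      using dderiv_linear[OF bounded_linear_inner_left smooth_open_differentiable[OF assms(2) that]] .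
    then have "dderiv a (dderiv b (\<lambda>q. F q \<bullet> z)) p = dderiv a (\<lambda>q. dderiv b F q \<bullet> z) p"
      using assms by (intro dderiv_cong_open)
    then show ?thesis
      using dderiv_linear[OF bounded_linear_inner_left
          smooth_open_differentiable[OF smooth_open_dderiv[OF assms(2)] assms(3)]] by simp
  qed
  have "smooth_open S (\<lambda>q. F q \<bullet> z)" for z
    by (intro smooth_open_inner smooth_open_const assms)
  from dderiv_commute_real[OF assms(1) this assms(3)]
  have "dderiv w (dderiv v F) p \<bullet> z = dderiv v (dderiv w F) p \<bullet> z" for z
    unfolding i .
  then show ?thesis using vector_eq_rdot by blast
qed

section \<open>Unique continuation for Cauchy-Riemann type equations\<close>

abbreviation e1 :: "real^2" where "e1 \<equiv> axis 1 1"
abbreviation e2 :: "real^2" where "e2 \<equiv> axis 2 1"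

lemma local_max_second_derivative:
  fixes f :: "real \<Rightarrow> real"
  assumes "d > 0" and f': "\<And>t. \<bar>t\<bar> < d \<Longrightarrow> (f has_real_derivative f' t) (at t)"
    and f'': "(f' has_real_derivative D) (at 0)" and max: "\<And>t. \<bar>t\<bar> < d \<Longrightarrow> f t \<le> f 0"
  shows "f' 0 = 0" "D \<le> 0"
proof -
  show 0: "f' 0 = 0"
    using DERIV_local_max[OF f'[of 0] \<open>d > 0\<close>] max \<open>d > 0\<close> by simp
  show "D \<le> 0"
  proof (rule ccontr)
    assume "\<not> D \<le> 0"
    then obtain r where r: "r > 0" "\<And>h. 0 < h \<Longrightarrow> h < r \<Longrightarrow> f' 0 < f' (0 + h)"
      using DERIV_pos_inc_right[OF f''] by auto
    define h where "h = min r d / 2"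
    have h: "0 < h" "h < r" "h < d" using r \<open>d > 0\<close> by (auto simp: h_def)
    obtain t where t: "0 < t" "t < h" "f h - f 0 = (h - 0) * f' t"
      using MVT2[of 0 h f f'] h f' by auto
    have "f' t > 0" using r(2)[of t] t h 0 by simp
    then have "f h > f 0" using t h by (simp add: algebra_simps)
    then show False using max[of h] h by simp
  qed
qed

text \<open>\<open>log |U|\<close> is the real part of a local branch of \<open>log U\<close>;
  differentiating it directly requires no branch.\<close>

lemma ln_cmod_has_derivative:
  assumes U: "(U has_vector_derivative U') (at t)" and nz: "U t \<noteq> (0::complex)"
  shows "((\<lambda>t. ln (cmod (U t))) has_real_derivative Re (U' / U t)) (at t)"
proof -
  have "((\<lambda>t. norm (U t)) has_derivative (\<lambda>h. (h *\<^sub>R U') \<bullet> sgn (U t))) (at t)"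
    using has_derivative_compose[OF U[unfolded has_vector_derivative_def] has_derivative_norm[OF nz]] .
  then have "((\<lambda>t. norm (U t)) has_real_derivative (U' \<bullet> sgn (U t))) (at t)"
    by (simp add: has_field_derivative_def mult_commute_abs)
  from DERIV_ln[THEN DERIV_chain2, OF _ this]
  have "((\<lambda>t. ln (cmod (U t))) has_real_derivative (inverse (cmod (U t)) * (U' \<bullet> sgn (U t)))) (at t)"
    using nz by simp
  moreover have "inverse (cmod (U t)) * (U' \<bullet> sgn (U t)) = Re (U' / U t)"
    using nz cmod_power2[of "U t"]
    by (simp add: sgn_div_norm inner_complex_def Re_divide field_simps power2_eq_square)
  ultimately show ?thesis by simp
qed

lemma quotient_has_vector_derivative:
  fixes U V :: "real \<Rightarrow> complex"
  assumes "(U has_vector_derivative U') (at t)" "(V has_vector_derivative V') (at t)" "U t \<noteq> 0"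
  shows "((\<lambda>t. Re (V t / U t)) has_real_derivative Re ((V' * U t - V t * U') / (U t)\<^sup>2)) (at t)"
proof -
  have "((\<lambda>t. V t / U t) has_derivative
     (\<lambda>h. - V t * (inverse (U t) * (h *\<^sub>R U') * inverse (U t)) + (h *\<^sub>R V') / U t)) (at t)"
    using has_derivative_divide[of V "\<lambda>h. h *\<^sub>R V'" t UNIV U "\<lambda>h. h *\<^sub>R U'"] assms
    by (simp add: has_vector_derivative_def)
  moreover have "- V t * (inverse (U t) * (h *\<^sub>R U') * inverse (U t)) + (h *\<^sub>R V') / U t
      = h *\<^sub>R ((V' * U t - V t * U') / (U t)\<^sup>2)" for h
    using assms(3) by (simp add: field_simps power2_eq_square scaleR_conv_of_real)
  ultimately have "((\<lambda>t. V t / U t) has_vector_derivative ((V' * U t - V t * U') / (U t)\<^sup>2)) (at t)"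
    by (simp add: has_vector_derivative_def)
  from bounded_linear.has_vector_derivative[OF bounded_linear_Re this] show ?thesis
    by (simp add: has_real_derivative_iff_has_vector_derivative)
qed

text \<open>The first and second order conditions at a local maximum of
  \<open>log |u| + N exp (- \<alpha> |q - z|\<^sup>2)\<close>, along a line through
  \<open>p\<close>. The maximum is assumed in exponentiated form, which makes sense also at zeros of
  \<open>u\<close>; the logarithm is taken only near \<open>p\<close>.\<close>

lemma log_max_along_line:
  fixes u :: "real^2 \<Rightarrow> complex"
  assumes S: "open S" "p \<in> S" and u: "smooth_open S u" and nz: "u p \<noteq> 0"
    and d: "d > 0" and max: "\<And>q. dist q p < d \<Longrightarrow>
      cmod (u q) * exp (N * exp (- \<alpha> * ((q - z) \<bullet> (q - z)))) \<le>
      cmod (u p) * exp (N * exp (- \<alpha> * ((p - z) \<bullet> (p - z))))"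
  defines "E \<equiv> N * exp (- \<alpha> * ((p - z) \<bullet> (p - z)))"
  shows "Re (dderiv v u p / u p) = 2 * \<alpha> * E * (v \<bullet> (p - z))"
    and "Re ((dderiv v (dderiv v u) p * u p - dderiv v u p * dderiv v u p) / (u p)\<^sup>2)
      \<le> E * (2 * \<alpha> * (v \<bullet> v) - 4 * \<alpha>\<^sup>2 * (v \<bullet> (p - z))\<^sup>2)"
proof -
  have "continuous (at p) u"
    using smooth_open_continuous_on[OF u] S by (simp add: continuous_on_eq_continuous_at)
  then obtain d1 where d1: "d1 > 0" "\<And>q. dist q p < d1 \<Longrightarrow> u q \<noteq> 0"
    using nz continuous_at_avoid[of p u 0] by (metis dist_commute)
  obtain d2 where d2: "d2 > 0" "ball p d2 \<subseteq> S" using S openE by blast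
  \<comment> \<open>Parameters below this bound keep the line in \<open>S\<close>, inside the ball
    of comparison and away from zeros of \<open>u\<close>; the \<open>+ 1\<close> admits
    \<open>v = 0\<close>.\<close>
  define \<delta> where "\<delta> = min d (min d1 d2) / (norm v + 1)"
  have np: "norm v + 1 > 0" by (simp add: add_nonneg_pos)
  have \<delta>: "\<delta> > 0" using d d1 d2 np by (simp add: \<delta>_def)
  have near: "dist (p + t *\<^sub>R v) p < min d (min d1 d2)" if "\<bar>t\<bar> < \<delta>" for t
  proof -
    have "\<bar>t\<bar> * norm v \<le> \<bar>t\<bar> * (norm v + 1)" by (intro mult_left_mono) auto
    also have "\<dots> < min d (min d1 d2)" using that np by (simp add: \<delta>_def pos_less_divide_eq)
    finally show ?thesis by (simp add: dist_norm)
  qed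
  have inS: "p + t *\<^sub>R v \<in> S" if "\<bar>t\<bar> < \<delta>" for t
    using near[OF that] d2(2) by (auto simp: dist_commute)
  have unz: "u (p + t *\<^sub>R v) \<noteq> 0" if "\<bar>t\<bar> < \<delta>" for t
    using near[OF that] d1(2) by simp
  define s where "s t = (p + t *\<^sub>R v - z) \<bullet> (p + t *\<^sub>R v - z)" for t :: real
  define f where "f t = ln (cmod (u (p + t *\<^sub>R v))) + N * exp (- \<alpha> * s t)" for t
  define f' where "f' t = Re (dderiv v u (p + t *\<^sub>R v) / u (p + t *\<^sub>R v))
     + N * (exp (- \<alpha> * s t) * (- \<alpha> * (2 * (v \<bullet> (p + t *\<^sub>R v - z)))))" for t
  have ds: "(s has_real_derivative 2 * (v \<bullet> (p + t *\<^sub>R v - z))) (at t)" for t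
    unfolding s_def[abs_def] has_field_derivative_def
    by (auto intro!: derivative_eq_intros simp: inner_commute algebra_simps)
  have dw: "((\<lambda>t. v \<bullet> (p + t *\<^sub>R v - z)) has_real_derivative v \<bullet> v) (at t)" for t
    unfolding has_field_derivative_def
    by (auto intro!: derivative_eq_intros simp: algebra_simps)
  have de: "((\<lambda>t. exp (- \<alpha> * s t)) has_real_derivative exp (- \<alpha> * s t) * (- \<alpha> * (2 * (v \<bullet> (p + t *\<^sub>R v - z))))) (at t)" for t
    by (intro DERIV_fun_exp DERIV_cmult ds)
  have du: "((\<lambda>t. u (p + t *\<^sub>R v)) has_vector_derivative dderiv v u (p + t *\<^sub>R v)) (at t)"
    "((\<lambda>t. dderiv v u (p + t *\<^sub>R v)) has_vector_derivative dderiv v (dderiv v u) (p + t *\<^sub>R v)) (at t)"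
    if "\<bar>t\<bar> < \<delta>" for t
    using inS[OF that] u by (intro has_vector_derivative_line smooth_open_differentiable smooth_open_dderiv; blast)+
  have 1: "(f has_real_derivative f' t) (at t)" if "\<bar>t\<bar> < \<delta>" for t
    unfolding f_def[abs_def] f'_def
    by (intro DERIV_add DERIV_cmult ln_cmod_has_derivative du[OF that] unz[OF that] de)
  define D where "D = Re ((dderiv v (dderiv v u) (p + 0 *\<^sub>R v) * u (p + 0 *\<^sub>R v)
      - dderiv v u (p + 0 *\<^sub>R v) * dderiv v u (p + 0 *\<^sub>R v)) / (u (p + 0 *\<^sub>R v))\<^sup>2)
    + N * (exp (- \<alpha> * s 0) * (- \<alpha> * (2 * (v \<bullet> (p + 0 *\<^sub>R v - z)))) * (- \<alpha> * (2 * (v \<bullet> (p + 0 *\<^sub>R v - z))))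
       + - \<alpha> * (2 * (v \<bullet> v)) * exp (- \<alpha> * s 0))"
  have 2: "(f' has_real_derivative D) (at 0)"
    unfolding f'_def[abs_def] D_def
    using \<delta> by (intro DERIV_add DERIV_cmult DERIV_mult quotient_has_vector_derivative du unz de dw) auto
  have 3: "f t \<le> f 0" if "\<bar>t\<bar> < \<delta>" for t
  proof -
    have a: "ln (cmod (u q) * exp (N * c)) = ln (cmod (u q)) + N * c" if "u q \<noteq> 0" for q c
      using that by (simp add: ln_mult)
    have "cmod (u (p + t *\<^sub>R v)) * exp (N * exp (- \<alpha> * s t)) \<le> cmod (u p) * exp (N * exp (- \<alpha> * s 0))"
      using max[of "p + t *\<^sub>R v"] near[OF that] by (simp add: s_def)
    then have "ln (cmod (u (p + t *\<^sub>R v)) * exp (N * exp (- \<alpha> * s t))) \<le> ln (cmod (u p) * exp (N * exp (- \<alpha> * s 0)))"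
      using unz[OF that] nz by (simp add: ln_mono)
    then show ?thesis using unz[OF that] nz by (simp add: a f_def)
  qed
  have f0: "f' 0 = 0" and D0: "D \<le> 0"
    using local_max_second_derivative[OF \<delta> 1 2 3] by auto
  have E: "N * exp (- \<alpha> * s 0) = E" by (simp add: E_def s_def)
  show "Re (dderiv v u p / u p) = 2 * \<alpha> * E * (v \<bullet> (p - z))"
    using f0 by (simp add: f'_def E[symmetric])
  have "D = Re ((dderiv v (dderiv v u) p * u p - dderiv v u p * dderiv v u p) / (u p)\<^sup>2)
      - E * (2 * \<alpha> * (v \<bullet> v) - 4 * \<alpha>\<^sup>2 * (v \<bullet> (p - z))\<^sup>2)"
    unfolding D_def E[symmetric] by (simp add: algebra_simps power2_eq_square)
  then show "Re ((dderiv v (dderiv v u) p * u p - dderiv v u p * dderiv v u p) / (u p)\<^sup>2)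
      \<le> E * (2 * \<alpha> * (v \<bullet> v) - 4 * \<alpha>\<^sup>2 * (v \<bullet> (p - z))\<^sup>2)"
    using D0 by simp
qed

text \<open>A Cauchy-Riemann equation in arbitrary coordinates; \<open>Im m \<noteq> 0\<close> is
  ellipticity. The equation is linear over the complex numbers, so complex combinations of solutions
  are solutions.\<close>

locale elliptic_solution =
  fixes S :: "(real^2) set" and m n u :: "real^2 \<Rightarrow> complex"
  assumes S: "open S" and m: "smooth_open S m" and n: "smooth_open S n" and u: "smooth_open S u"
    and ell: "\<And>p. p \<in> S \<Longrightarrow> Im (m p) \<noteq> 0"
    and eq: "\<And>p. p \<in> S \<Longrightarrow> dderiv e2 u p = m p * dderiv e1 u p + n p * u p"
begin

text \<open>The equation says that \<open>u\<close> is annihilated by a Cauchy-Riemann operator. Applying the conjugate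
  operator yields a second order equation for \<open>log u\<close> without terms quadratic in the gradient.\<close>

lemma log_second_order:
  fixes h :: "real^2 \<Rightarrow> real^2 \<Rightarrow> complex"
  assumes p: "p \<in> S" and nz: "u p \<noteq> 0"
  defines "h \<equiv> \<lambda>v w. (dderiv v (dderiv w u) p * u p - dderiv v u p * dderiv w u p) / (u p)\<^sup>2"
  shows "h e2 e2 - 2 * Re (m p) * h e1 e2 + (m p * cnj (m p)) * h e1 e1
    = (dderiv e2 m p - cnj (m p) * dderiv e1 m p) * (dderiv e1 u p / u p)
      + (dderiv e2 n p - cnj (m p) * dderiv e1 n p)"
proof -
  have d: "dderiv v (dderiv e2 u) p = m p * dderiv v (dderiv e1 u) p + dderiv v m p * dderiv e1 u p
      + (n p * dderiv v u p + dderiv v n p * u p)" for v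
  proof -
    have "dderiv v (dderiv e2 u) p = dderiv v (\<lambda>p. m p * dderiv e1 u p + n p * u p) p"
      by (rule dderiv_cong_open[OF S p eq])
    also have "\<dots> = dderiv v (\<lambda>p. m p * dderiv e1 u p) p + dderiv v (\<lambda>p. n p * u p) p"
      by (intro dderiv_add smooth_open_differentiable[OF _ p] smooth_open_mult S m n u smooth_open_dderiv)
    also have "dderiv v (\<lambda>p. m p * dderiv e1 u p) p = m p * dderiv v (dderiv e1 u) p + dderiv v m p * dderiv e1 u p"
      by (intro dderiv_mult smooth_open_differentiable[OF _ p] smooth_open_mult S m n u smooth_open_dderiv)
    also have "dderiv v (\<lambda>p. n p * u p) p = n p * dderiv v u p + dderiv v n p * u p"
      by (intro dderiv_mult smooth_open_differentiable[OF _ p] smooth_open_mult S m n u smooth_open_dderiv)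
    finally show ?thesis .
  qed
  define U where "U = u p"
  define u1 where "u1 = dderiv e1 u p"
  define u11 where "u11 = dderiv e1 (dderiv e1 u) p"
  define u2 where "u2 = dderiv e2 u p"
  define u12 where "u12 = dderiv e1 (dderiv e2 u) p"
  define u22 where "u22 = dderiv e2 (dderiv e2 u) p"
  define M where "M = m p"
  define m1 where "m1 = dderiv e1 m p"
  define m2 where "m2 = dderiv e2 m p"
  define n1 where "n1 = dderiv e1 n p"
  define n2 where "n2 = dderiv e2 n p"
  define n0 where "n0 = n p"
  have u2: "u2 = M * u1 + n0 * U"
    using eq[OF p] by (simp add: u2_def M_def u1_def n0_def U_def)
  have u12: "u12 = M * u11 + m1 * u1 + (n0 * u1 + n1 * U)"
    using d[of e1] by (simp add: u12_def u11_def M_def m1_def u1_def n0_def n1_def U_def)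
  have u22: "u22 = M * u12 + m2 * u1 + (n0 * u2 + n2 * U)"
    using d[of e2] dderiv_commute[OF S u p, of e2 e1]
    by (simp add: u12_def u22_def u2_def M_def m2_def u1_def n0_def n2_def U_def)
  have R: "complex_of_real (2 * Re M) = M + cnj M" by (simp add: complex_add_cnj)
  have U: "U \<noteq> 0" using nz by (simp add: U_def)
  define N where "N = cnj M"
  \<comment> \<open>For the logarithmic derivatives the equation reads
    \<open>l2 = M l1 + n0\<close>. The derivative in direction \<open>e2\<close> minus
    \<open>N\<close> times the one in direction \<open>e1\<close> turns it into this identity, here
    multiplied by \<open>U\<^sup>2\<close>.\<close>
  have "(u22 * U - u2 * u2) - (M + N) * (u12 * U - u1 * u2) + M * N * (u11 * U - u1 * u1)
    = (m2 - N * m1) * (u1 * U) + (n2 - N * n1) * U\<^sup>2"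
    unfolding u22 u12 u2 by (simp add: algebra_simps power2_eq_square)
  then have "((u22 * U - u2 * u2) - (M + N) * (u12 * U - u1 * u2) + M * N * (u11 * U - u1 * u1)) / U\<^sup>2
    = ((m2 - N * m1) * (u1 * U) + (n2 - N * n1) * U\<^sup>2) / U\<^sup>2" by simp
  also have "\<dots> = (m2 - N * m1) * (u1 / U) + (n2 - N * n1)"
    using U by (simp add: add_divide_distrib power2_eq_square)
  finally have "((u22 * U - u2 * u2) - (M + N) * (u12 * U - u1 * u2) + M * N * (u11 * U - u1 * u1)) / U\<^sup>2
    = (m2 - N * m1) * (u1 / U) + (n2 - N * n1)" .
  moreover have "h e2 e2 - 2 * Re (m p) * h e1 e2 + (m p * cnj (m p)) * h e1 e1
    = ((u22 * U - u2 * u2) - (M + N) * (u12 * U - u1 * u2) + M * N * (u11 * U - u1 * u1)) / U\<^sup>2"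
    unfolding h_def u22_def[symmetric] u12_def[symmetric] u11_def[symmetric] u2_def[symmetric]
      u1_def[symmetric] U_def[symmetric] M_def[symmetric] N_def[symmetric] R
    by (simp only: N_def times_divide_eq_right) (simp only: diff_divide_distrib add_divide_distrib)
  ultimately show ?thesis
    by (simp add: m1_def m2_def n1_def n2_def N_def M_def u1_def U_def)
qed

text \<open>At the maximum the principal part of the second order identity is bounded above through
  the Hessian of the weight, while the identity itself bounds it below by first order terms. The
  gradient of \<open>log |u|\<close> is known at the critical point, and the equation recovers the
  gradient of the argument from it.\<close>

lemma log_max_estimate:
  assumes p: "p \<in> S" and nz: "u p \<noteq> 0" and N: "N > 0" and \<alpha>: "\<alpha> > 0"
    and d: "d > 0" and max: "\<And>q. dist q p < d \<Longrightarrow>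
      cmod (u q) * exp (N * exp (- \<alpha> * ((q - z) \<bullet> (q - z)))) \<le>
      cmod (u p) * exp (N * exp (- \<alpha> * ((p - z) \<bullet> (p - z))))"
    and C: "cmod (m p) \<le> C" "cmod (n p) \<le> C" "cmod (dderiv e2 m p - cnj (m p) * dderiv e1 m p) \<le> C"
      "cmod (dderiv e2 n p - cnj (m p) * dderiv e1 n p) \<le> C" "\<mu> \<le> \<bar>Im (m p)\<bar>" "\<mu> > 0" "C \<ge> 0"
  defines "E \<equiv> N * exp (- \<alpha> * ((p - z) \<bullet> (p - z)))"
  shows "E * (4 * \<alpha>\<^sup>2 * (\<mu>\<^sup>2 / (1 + C\<^sup>2)) * (norm (p - z))\<^sup>2 - 2 * \<alpha> * (1 + C\<^sup>2)
      - 2 * \<alpha> * C * norm (p - z) * (1 + (C + 1) / \<mu>)) \<le> C * C / \<mu> + C"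
proof -
  define y where "y = p - z"
  define M where "M = m p"
  define a where "a = Re M"
  define b where "b = Im M"
  define l1 where "l1 = dderiv e1 u p / u p"
  define l2 where "l2 = dderiv e2 u p / u p"
  define h where "h v w = (dderiv v (dderiv w u) p * u p - dderiv v u p * dderiv w u p) / (u p)\<^sup>2" for v w
  have E: "E > 0" using N by (simp add: E_def)
  note L = log_max_along_line[OF S p u nz d max, folded E_def y_def]
  have yi: "e1 \<bullet> y = y $ 1" "e2 \<bullet> y = y $ 2" by (simp_all add: inner_axis inner_commute)
  have r1: "Re l1 = 2 * \<alpha> * E * y $ 1" and r2: "Re l2 = 2 * \<alpha> * E * y $ 2"
    using L(1)[of e1] L(1)[of e2] by (simp_all add: l1_def l2_def yi)
  have h11: "Re (h e1 e1) \<le> E * (2 * \<alpha> - 4 * \<alpha>\<^sup>2 * (y $ 1)\<^sup>2)"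
    using L(2)[of e1] by (simp add: h_def yi inner_axis_axis)
  \<comment> \<open>Completing the square, the principal part is the second derivative along
    \<open>e2 - a e1\<close> plus \<open>b\<^sup>2\<close> times the one along \<open>e1\<close>.
    The number \<open>a\<close> is frozen at \<open>p\<close>, so \<open>v\<close> is a constant
    direction.\<close>
  define v where "v = e2 - a *\<^sub>R e1"
  have du_at: "dderiv v F p = dderiv e2 F p - a *\<^sub>R dderiv e1 F p" if "F differentiable (at p)"
    for F :: "real^2 \<Rightarrow> complex" and p
    using that by (simp add: v_def dderiv_direction_diff dderiv_direction_scaleR)
  have dvu: "dderiv v u p = dderiv e2 u p - a *\<^sub>R dderiv e1 u p" if "p \<in> S" for p
    by (rule du_at[OF smooth_open_differentiable[OF u that]])
  have dv: "dderiv w (dderiv v u) p = dderiv w (dderiv e2 u) p - a *\<^sub>R dderiv w (dderiv e1 u) p" for w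
  proof -
    have "dderiv w (dderiv v u) p = dderiv w (\<lambda>q. dderiv e2 u q - a *\<^sub>R dderiv e1 u q) p"
      by (rule dderiv_cong_open[OF S p dvu])
    also have "\<dots> = dderiv w (dderiv e2 u) p - dderiv w (\<lambda>q. a *\<^sub>R dderiv e1 u q) p"
      by (intro dderiv_diff smooth_open_differentiable[OF _ p] smooth_open_dderiv u
          smooth_open_scaleR smooth_open_const S)
    also have "dderiv w (\<lambda>q. a *\<^sub>R dderiv e1 u q) p = a *\<^sub>R dderiv w (dderiv e1 u) p"
      by (rule dderiv_linear[OF bounded_linear_scaleR_right smooth_open_differentiable[OF smooth_open_dderiv[OF u] p]])
    finally show ?thesis .
  qed
  have vv: "dderiv v (dderiv v u) p = dderiv e2 (dderiv e2 u) p - (2 * a) *\<^sub>R dderiv e1 (dderiv e2 u) p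
     + (a\<^sup>2) *\<^sub>R dderiv e1 (dderiv e1 u) p"
    unfolding dv du_at[OF smooth_open_differentiable[OF smooth_open_dderiv[OF u] p]]
    using dderiv_commute[OF S u p, of e2 e1]
    by (simp add: algebra_simps scaleR_conv_of_real power2_eq_square)
  have "h e2 e2 - (2 * a) *\<^sub>R h e1 e2 + a\<^sup>2 *\<^sub>R h e1 e1
    = (dderiv v (dderiv v u) p * u p - dderiv v u p * dderiv v u p) / (u p)\<^sup>2"
    unfolding vv dvu[OF p] h_def using nz
    by (simp add: scaleR_conv_of_real field_simps power2_eq_square)
  moreover have "v \<bullet> v = 1 + a\<^sup>2" "v \<bullet> y = y $ 2 - a * y $ 1"
    by (simp_all add: v_def inner_diff_left inner_diff_right inner_axis_axis yi power2_eq_square)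
  ultimately have hv: "Re (h e2 e2 - (2 * a) *\<^sub>R h e1 e2 + a\<^sup>2 *\<^sub>R h e1 e1)
      \<le> E * (2 * \<alpha> * (1 + a\<^sup>2) - 4 * \<alpha>\<^sup>2 * (y $ 2 - a * y $ 1)\<^sup>2)"
    using L(2)[of v] by simp
  define T where "T = 1 + (a\<^sup>2 + b\<^sup>2)"
  define Q where "Q = (y $ 2 - a * y $ 1)\<^sup>2 + b\<^sup>2 * (y $ 1)\<^sup>2"
  have cm: "M * cnj M = of_real (a\<^sup>2 + b\<^sup>2)" by (simp add: complex_eq_iff a_def b_def power2_eq_square)
  have lhs: "Re (h e2 e2 - 2 * Re M * h e1 e2 + (M * cnj M) * h e1 e1) =
     Re (h e2 e2 - (2 * a) *\<^sub>R h e1 e2 + a\<^sup>2 *\<^sub>R h e1 e1) + b\<^sup>2 * Re (h e1 e1)"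
    unfolding cm by (simp add: a_def algebra_simps)
  have "b\<^sup>2 * Re (h e1 e1) \<le> b\<^sup>2 * (E * (2 * \<alpha> - 4 * \<alpha>\<^sup>2 * (y $ 1)\<^sup>2))"
    using h11 by (rule mult_left_mono) simp
  with hv have up: "Re (h e2 e2 - 2 * Re M * h e1 e2 + (M * cnj M) * h e1 e1) \<le> E * (2 * \<alpha> * T - 4 * \<alpha>\<^sup>2 * Q)"
    unfolding lhs T_def Q_def by (simp add: algebra_simps)
  define K where "K = dderiv e2 m p - cnj M * dderiv e1 m p"
  define Lc where "Lc = dderiv e2 n p - cnj M * dderiv e1 n p"
  have id: "h e2 e2 - 2 * Re M * h e1 e2 + (M * cnj M) * h e1 e1 = K * l1 + Lc"
    using log_second_order[OF p nz] unfolding h_def K_def Lc_def M_def l1_def by simp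
  have low: "Re (K * l1 + Lc) \<ge> - (C * cmod l1 + C)"
  proof -
    have "\<bar>Re (K * l1 + Lc)\<bar> \<le> cmod (K * l1 + Lc)" by (rule abs_Re_le_cmod)
    also have "\<dots> \<le> cmod K * cmod l1 + cmod Lc" using norm_triangle_ineq[of "K * l1" Lc] by (simp add: norm_mult)
    also have "\<dots> \<le> C * cmod l1 + C" using C by (intro add_mono mult_right_mono) (auto simp: K_def Lc_def M_def)
    finally show ?thesis by linarith
  qed
  have ny: "\<bar>y $ 1\<bar> \<le> norm y" "\<bar>y $ 2\<bar> \<le> norm y" using component_le_norm_cart by blast+
  define W where "W = 2 * \<alpha> * E * norm y"
  have W1: "\<bar>Re l1\<bar> \<le> W" "\<bar>Re l2\<bar> \<le> W"
    unfolding r1 r2 W_def using ny E \<alpha> by (simp_all add: abs_mult)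
  \<comment> \<open>\<open>W\<close> bounds the real parts. The remaining unknown
    \<open>Im l1\<close> is found from the real part of this equation, where its coefficient
    \<open>b\<close> is at least \<mu> in absolute value.\<close>
  have "l2 = M * l1 + n p"
    using eq[OF p] nz by (simp add: l1_def l2_def M_def field_simps)
  then have "Re l2 = a * Re l1 - b * Im l1 + Re (n p)" by (simp add: a_def b_def)
  then have "\<bar>b\<bar> * \<bar>Im l1\<bar> = \<bar>a * Re l1 - Re l2 + Re (n p)\<bar>" by (simp add: abs_mult[symmetric])
  also have "\<dots> \<le> \<bar>a\<bar> * \<bar>Re l1\<bar> + \<bar>Re l2\<bar> + \<bar>Re (n p)\<bar>" unfolding abs_mult[symmetric] by linarith
  also have "\<dots> \<le> C * W + W + C"
  proof (intro add_mono mult_mono W1)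
    show "\<bar>a\<bar> \<le> C" using abs_Re_le_cmod[of M] C(1) by (simp add: a_def M_def)
    show "\<bar>Re (n p)\<bar> \<le> C" using abs_Re_le_cmod[of "n p"] C(2) by simp
  qed (use C in auto)
  finally have bi: "\<bar>b\<bar> * \<bar>Im l1\<bar> \<le> C * W + W + C" .
  have "\<mu> * \<bar>Im l1\<bar> \<le> \<bar>b\<bar> * \<bar>Im l1\<bar>" using C(5) by (intro mult_right_mono) (auto simp: b_def M_def)
  with bi have "\<bar>Im l1\<bar> \<le> (C * W + W + C) / \<mu>"
    using C(6) by (simp add: pos_le_divide_eq mult.commute)
  then have l1: "cmod l1 \<le> W + (C * W + W + C) / \<mu>"
    using cmod_le[of l1] W1(1) by linarith
  have "E * (4 * \<alpha>\<^sup>2 * Q - 2 * \<alpha> * T) \<le> C * cmod l1 + C"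
    using up low unfolding id by (simp add: algebra_simps)
  also have "\<dots> \<le> C * (W + (C * W + W + C) / \<mu>) + C" using l1 C(7) by (simp add: mult_left_mono)
  also have "\<dots> = E * (2 * \<alpha> * C * norm y * (1 + (C + 1) / \<mu>)) + (C * C / \<mu> + C)"
    using C(6) by (simp add: W_def field_simps)
  finally have main: "E * (4 * \<alpha>\<^sup>2 * Q - 2 * \<alpha> * T - 2 * \<alpha> * C * norm y * (1 + (C + 1) / \<mu>)) \<le> C * C / \<mu> + C"
    by (simp add: algebra_simps)
  have T: "0 < T" "T \<le> 1 + C\<^sup>2"
  proof -
    have "a\<^sup>2 + b\<^sup>2 = (cmod M)\<^sup>2" by (simp add: a_def b_def cmod_power2)
    also have "\<dots> \<le> C\<^sup>2" using C(1) by (simp add: M_def power_mono)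
    finally show "T \<le> 1 + C\<^sup>2" by (simp add: T_def)
    show "0 < T" unfolding T_def by (simp add: add_pos_nonneg)
  qed
  have nn: "(norm y)\<^sup>2 = (y $ 1)\<^sup>2 + (y $ 2)\<^sup>2"
    unfolding power2_norm_eq_inner inner_vec_def sum_2 by (simp add: power2_eq_square)
  \<comment> \<open>\<open>Q\<close> is a quadratic form in \<open>y\<close> with trace
    \<open>T\<close> and determinant \<open>b\<^sup>2\<close>. By Cayley-Hamilton the difference is
    the squared length of its matrix applied to \<open>y\<close>; hence the least eigenvalue is at
    least determinant over trace.\<close>
  have "T * Q - b\<^sup>2 * (norm y)\<^sup>2 = (a * y $ 1 - y $ 2)\<^sup>2 + ((a\<^sup>2 + b\<^sup>2) * y $ 1 - a * y $ 2)\<^sup>2"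
    unfolding nn T_def Q_def by (simp add: power2_eq_square algebra_simps)
  then have "b\<^sup>2 * (norm y)\<^sup>2 \<le> T * Q" by (smt (verit) zero_le_power2)
  moreover have "\<mu>\<^sup>2 * (norm y)\<^sup>2 \<le> b\<^sup>2 * (norm y)\<^sup>2"
    using C(5,6) by (intro mult_right_mono) (auto simp: b_def M_def abs_le_square_iff[symmetric])
  moreover have "Q \<ge> 0" by (simp add: Q_def)
  ultimately have "\<mu>\<^sup>2 * (norm y)\<^sup>2 \<le> (1 + C\<^sup>2) * Q"
    using T by (smt (verit) mult_right_mono)
  then have Q: "\<mu>\<^sup>2 / (1 + C\<^sup>2) * (norm y)\<^sup>2 \<le> Q"
    using T by (simp add: pos_divide_le_eq mult.commute)
  have "4 * \<alpha>\<^sup>2 * (\<mu>\<^sup>2 / (1 + C\<^sup>2)) * (norm y)\<^sup>2 \<le> 4 * \<alpha>\<^sup>2 * Q"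
    using mult_left_mono[OF Q, of "4 * \<alpha>\<^sup>2"] by (simp add: algebra_simps)
  moreover have "2 * \<alpha> * T \<le> 2 * \<alpha> * (1 + C\<^sup>2)" using T \<alpha> by simp
  ultimately have "E * (4 * \<alpha>\<^sup>2 * (\<mu>\<^sup>2 / (1 + C\<^sup>2)) * (norm y)\<^sup>2 - 2 * \<alpha> * (1 + C\<^sup>2)
      - 2 * \<alpha> * C * norm y * (1 + (C + 1) / \<mu>))
    \<le> E * (4 * \<alpha>\<^sup>2 * Q - 2 * \<alpha> * T - 2 * \<alpha> * C * norm y * (1 + (C + 1) / \<mu>))"
    using E by (intro mult_left_mono) auto
  with main show ?thesis unfolding y_def[symmetric] by linarith
qed

text \<open>Weak unique continuation as in Hadamard's three circles theorem: otherwise the function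
  \<open>log |u| + N exp (- \<alpha> |q - z|\<^sup>2)\<close> has, for large \<open>\<alpha>\<close> and \<open>N\<close>, an interior maximum in the annulus.\<close>

lemma vanish_on_ball:
  assumes R: "cball z R \<subseteq> S" and r: "0 < r" and van: "\<And>q. dist q z \<le> r \<Longrightarrow> u q = 0"
    and q0: "dist q0 z < R"
  shows "u q0 = 0"
proof (rule ccontr)
  assume nz0: "u q0 \<noteq> 0"
  have "r < dist q0 z" using van nz0 by force
  then have rR: "r < R" "0 < R" using q0 r by auto
  define K where "K = cball z R"
  have K: "compact K" "K \<noteq> {}" "K \<subseteq> S" using R rR by (auto simp: K_def)
  note cont = continuous_on_subset[OF smooth_open_continuous_on K(3)]
  have bound: "\<exists>B. \<forall>q\<in>K. f q \<le> B" if "continuous_on K f" for f :: "real^2 \<Rightarrow> real"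
    using continuous_attains_sup[OF K(1,2) that] by blast
  define k where "k q = dderiv e2 m q - cnj (m q) * dderiv e1 m q" for q
  define l where "l q = dderiv e2 n q - cnj (m q) * dderiv e1 n q" for q
  have kl: "smooth_open S k" "smooth_open S l"
    unfolding k_def[abs_def] l_def[abs_def]
    by (intro smooth_open_diff smooth_open_mult smooth_open_cnj smooth_open_dderiv S m n)+
  have "continuous_on K (\<lambda>q. cmod (m q) + cmod (n q) + cmod (k q) + cmod (l q))"
    by (intro continuous_on_add continuous_on_norm cont m n kl)
  from bound[OF this] obtain C where C: "\<And>q. q \<in> K \<Longrightarrow> cmod (m q) + cmod (n q) + cmod (k q) + cmod (l q) \<le> C"
    by blast
  have Cs: "cmod (m q) \<le> C" "cmod (n q) \<le> C" "cmod (k q) \<le> C" "cmod (l q) \<le> C" if "q \<in> K" for q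
    using C[OF that] norm_ge_zero[of "m q"] norm_ge_zero[of "n q"] norm_ge_zero[of "k q"] norm_ge_zero[of "l q"]
    by linarith+
  have "z \<in> K" using rR by (simp add: K_def)
  with Cs(1)[of z] have C0: "C \<ge> 0" using norm_ge_zero[of "m z"] by linarith
  have "continuous_on K (\<lambda>q. \<bar>Im (m q)\<bar>)"
    by (intro continuous_on_rabs continuous_on_Im cont m)
  from continuous_attains_inf[OF K(1,2) this] obtain q1 where
    q1: "q1 \<in> K" "\<And>q. q \<in> K \<Longrightarrow> \<bar>Im (m q1)\<bar> \<le> \<bar>Im (m q)\<bar>" by blast
  define \<mu> where "\<mu> = \<bar>Im (m q1)\<bar>"
  have \<mu>: "\<mu> > 0" using ell q1 K(3) by (auto simp: \<mu>_def)
  have "continuous_on K (\<lambda>q. cmod (u q))" by (intro continuous_on_norm cont u)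
  from bound[OF this] obtain M0 where M0: "\<And>q. q \<in> K \<Longrightarrow> cmod (u q) \<le> M0" by blast
  have q0K: "q0 \<in> K" using q0 by (simp add: K_def dist_commute)
  have M0p: "M0 \<ge> 0" using M0[OF q0K] norm_ge_zero[of "u q0"] by linarith
  define la where "la = \<mu>\<^sup>2 / (1 + C\<^sup>2)"
  have la: "la > 0" using \<mu> by (simp add: la_def add_pos_nonneg)
  \<comment> \<open>Collects the error terms of \<open>log_max_estimate\<close> on the large ball,
    divided by \<alpha>. The choice of \<alpha> then makes the bracket in that estimate at least
    \<open>\<alpha> (4 la r\<^sup>2 \<alpha> - A) \<ge> 1\<close> outside the small ball.\<close>
  define A where "A = 2 * (1 + C\<^sup>2) + 2 * C * R * (1 + (C + 1) / \<mu>)"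
  have A0: "A \<ge> 0" using C0 \<mu> rR by (simp add: A_def)
  define \<alpha> where "\<alpha> = (A + 1) / (4 * la * r\<^sup>2) + 1"
  have \<alpha>1: "\<alpha> \<ge> 1" using A0 la by (simp add: \<alpha>_def)
  have "4 * la * r\<^sup>2 * \<alpha> = A + 1 + 4 * la * r\<^sup>2" using la r by (simp add: \<alpha>_def field_simps)
  then have \<alpha>2: "4 * la * r\<^sup>2 * \<alpha> \<ge> A + 1" using la by simp
  define C2 where "C2 = C * C / \<mu> + C"
  have C2: "C2 \<ge> 0" using C0 \<mu> by (simp add: C2_def)
  define w where "w q = exp (- \<alpha> * ((q - z) \<bullet> (q - z)))" for q
  define wR where "wR = exp (- \<alpha> * R\<^sup>2)"
  have w: "w q = exp (- \<alpha> * (dist q z)\<^sup>2)" for q by (simp add: w_def dist_norm power2_norm_eq_inner)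
  have wle: "wR \<le> w q" if "dist q z \<le> R" for q
    using that \<alpha>1 by (simp add: w wR_def power_mono)
  have "(dist q0 z)\<^sup>2 < R\<^sup>2" using q0 by (simp add: power_strict_mono)
  then have w0: "wR < w q0" using \<alpha>1 by (simp add: w wR_def)
  define \<beta> where "\<beta> = w q0 - wR"
  have \<beta>: "\<beta> > 0" using w0 by (simp add: \<beta>_def)
  \<comment> \<open>The first summand makes \<open>N w\<close> exceed \<open>C2\<close> on the large
    ball, which contradicts the estimate at an interior maximum. The second lifts the value at
    \<open>q0\<close> above all boundary values, so the maximum is interior.\<close>
  define N where "N = (C2 + 1) / wR + M0 / (cmod (u q0) * \<beta>)"
  have wRp: "wR > 0" by (simp add: wR_def)
  have N1: "N * wR \<ge> C2 + 1"
  proof -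
    have "N * wR = C2 + 1 + M0 / (cmod (u q0) * \<beta>) * wR" using wRp by (simp add: N_def field_simps)
    moreover have "0 \<le> M0 / (cmod (u q0) * \<beta>) * wR" using wRp \<beta> M0p by simp
    ultimately show ?thesis by linarith
  qed
  have Np: "N > 0" using N1 C2 wRp by (smt (verit) mult_nonpos_nonneg)
  have "N \<ge> M0 / (cmod (u q0) * \<beta>)" using C2 wRp by (simp add: N_def)
  then have N2: "cmod (u q0) * (N * \<beta>) \<ge> M0"
    using nz0 \<beta> by (simp add: pos_divide_le_eq algebra_simps)
  define G where "G q = cmod (u q) * exp (N * w q)" for q
  have "N * \<beta> < exp (N * \<beta>)" using exp_ge_add_one_self[of "N * \<beta>"] by linarith
  then have "M0 < cmod (u q0) * exp (N * \<beta>)"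
    using N2 nz0 by (smt (verit) mult_strict_left_mono zero_less_norm_iff)
  then have "M0 * exp (N * wR) < cmod (u q0) * exp (N * \<beta>) * exp (N * wR)" by simp
  also have "\<dots> = G q0" by (simp add: G_def \<beta>_def mult.assoc exp_add[symmetric] algebra_simps)
  finally have G0: "M0 * exp (N * wR) < G q0" .
  have "continuous_on K G"
    unfolding G_def[abs_def] w_def by (intro continuous_intros cont u)
  from continuous_attains_sup[OF K(1,2) this] obtain p where
    p: "p \<in> K" "\<And>q. q \<in> K \<Longrightarrow> G q \<le> G p" by blast
  have Gp: "M0 * exp (N * wR) < G p" using G0 p(2)[OF q0K] by simp
  have "0 \<le> M0 * exp (N * wR)" using M0p by simp
  with Gp have "0 < G p" by linarith
  then have up: "u p \<noteq> 0" by (auto simp: G_def)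
  have pr: "dist p z > r" using van up by force
  have pR: "dist p z < R"
  proof (rule ccontr)
    assume "\<not> dist p z < R"
    then have "dist p z = R" using p(1) by (simp add: K_def dist_commute)
    then have "w p = wR" by (simp add: w wR_def)
    then show False using Gp M0[OF p(1)] by (simp add: G_def)
  qed
  have pS: "p \<in> S" using p K by blast
  have mx: "cmod (u q) * exp (N * exp (- \<alpha> * ((q - z) \<bullet> (q - z)))) \<le> cmod (u p) * exp (N * exp (- \<alpha> * ((p - z) \<bullet> (p - z))))"
    if "dist q p < R - dist p z" for q
    using p(2)[of q] that dist_triangle[of q z p] by (simp add: G_def w_def K_def dist_commute)
  have "N * w p * (4 * \<alpha>\<^sup>2 * la * (dist p z)\<^sup>2 - 2 * \<alpha> * (1 + C\<^sup>2) - 2 * \<alpha> * C * dist p z * (1 + (C + 1) / \<mu>)) \<le> C2"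
    using log_max_estimate[where d = "R - dist p z", OF pS up Np _ _ mx Cs(1,2)[OF p(1)] Cs(3)[OF p(1), unfolded k_def]
        Cs(4)[OF p(1), unfolded l_def] q1(2)[OF p(1), folded \<mu>_def] \<mu> C0] \<alpha>1 pR
    unfolding w_def C2_def la_def dist_norm[symmetric, of p z] by simp
  moreover have "4 * \<alpha>\<^sup>2 * la * (dist p z)\<^sup>2 - 2 * \<alpha> * (1 + C\<^sup>2) - 2 * \<alpha> * C * dist p z * (1 + (C + 1) / \<mu>) \<ge> 1"
  proof -
    have "r\<^sup>2 \<le> (dist p z)\<^sup>2" using pr r by (simp add: power_mono)
    then have "4 * \<alpha>\<^sup>2 * la * r\<^sup>2 \<le> 4 * \<alpha>\<^sup>2 * la * (dist p z)\<^sup>2" using la by (intro mult_left_mono) auto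
    moreover have "2 * \<alpha> * C * dist p z * (1 + (C + 1) / \<mu>) \<le> 2 * \<alpha> * C * R * (1 + (C + 1) / \<mu>)"
      using pR C0 \<mu> \<alpha>1 by (intro mult_right_mono mult_left_mono) auto
    moreover have "4 * \<alpha>\<^sup>2 * la * r\<^sup>2 - 2 * \<alpha> * (1 + C\<^sup>2) - 2 * \<alpha> * C * R * (1 + (C + 1) / \<mu>) = \<alpha> * (4 * la * r\<^sup>2 * \<alpha> - A)"
      by (simp add: A_def power2_eq_square algebra_simps)
    moreover have "\<alpha> * (4 * la * r\<^sup>2 * \<alpha> - A) \<ge> 1 * 1" using \<alpha>1 \<alpha>2 by (intro mult_mono) auto
    ultimately show ?thesis by linarith
  qed
  moreover have w1: "N * w p > C2"
  proof -
    have "N * wR \<le> N * w p" using pR Np by (intro mult_left_mono wle) auto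
    then show ?thesis using N1 by linarith
  qed
  moreover have "N * w p * 1 \<le> N * w p * X" if "1 \<le> X" for X
    using that w1 C2 by (intro mult_left_mono) auto
  ultimately show False by fastforce
qed

lemma vanish_local:
  assumes R: "cball z R \<subseteq> S" and T: "open T" "z \<in> T" "\<And>q. q \<in> T \<Longrightarrow> u q = 0" and q: "dist q z < R"
  shows "u q = 0"
proof -
  obtain r where r: "r > 0" "cball z r \<subseteq> T" using T(1,2) open_contains_cball by blast
  have "u q' = 0" if "dist q' z \<le> r" for q'
    using T(3) r(2) that by (auto simp: dist_commute subset_iff)
  then show ?thesis by (rule vanish_on_ball[OF R r(1) _ q])
qed

text \<open>The quotient has modulus 1 and solves the equation without its zeroth order term. Its
  logarithmic derivatives are therefore imaginary, and \<open>m\<close>, which is not real, maps one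
  imaginary number to another only if both vanish.\<close>

lemma ratio_constant:
  assumes v: "smooth_open S v" "\<And>p. p \<in> S \<Longrightarrow> dderiv e2 v p = m p * dderiv e1 v p + n p * v p"
    and norm: "\<And>p. p \<in> S \<Longrightarrow> cmod (v p) = cmod (u p)"
    and B: "ball z r \<subseteq> S" "\<And>p. p \<in> ball z r \<Longrightarrow> u p \<noteq> 0" "r > 0"
  obtains c where "cmod c = 1" "\<And>p. p \<in> ball z r \<Longrightarrow> v p = c * u p"
proof -
  define \<rho> where "\<rho> p = v p / u p" for p
  have sv: "smooth_open (ball z r) v" "smooth_open (ball z r) u"
    using smooth_open_subset[OF _ B(1)] v(1) u by blast+
  have s\<rho>: "smooth_open (ball z r) \<rho>"
    unfolding \<rho>_def[abs_def] by (intro smooth_open_divide sv B(2)) auto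
  note diff = smooth_open_differentiable
  have 0: "dderiv e1 \<rho> p = 0 \<and> dderiv e2 \<rho> p = 0" if p: "p \<in> ball z r" for p
  proof -
    have pS: "p \<in> S" using p B(1) by blast
    have unz: "u p \<noteq> 0" using B(2)[OF p] .
    have d: "dderiv w v p = \<rho> p * dderiv w u p + dderiv w \<rho> p * u p" for w
    proof -
      have "dderiv w v p = dderiv w (\<lambda>q. \<rho> q * u q) p"
        by (rule dderiv_cong_open[OF open_ball p]) (use B(2) in \<open>simp add: \<rho>_def\<close>)
      also have "\<dots> = \<rho> p * dderiv w u p + dderiv w \<rho> p * u p"
        by (rule dderiv_mult[OF diff[OF s\<rho> p] diff[OF sv(2) p]])
      finally show ?thesis .
    qed
    have "u p * dderiv e2 \<rho> p = u p * (m p * dderiv e1 \<rho> p)"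
      using d[of e1] d[of e2] eq[OF pS] v(2)[OF pS] unz by (simp add: \<rho>_def algebra_simps)
    then have r2: "dderiv e2 \<rho> p = m p * dderiv e1 \<rho> p" using unz by simp
    have "\<rho> q \<bullet> \<rho> q = 1" if "q \<in> ball z r" for q
    proof -
      have "cmod (\<rho> q) = 1" using norm[of q] B that by (auto simp: \<rho>_def norm_divide)
      then show ?thesis by (simp add: dot_square_norm)
    qed
    then have "dderiv w (\<lambda>q. \<rho> q \<bullet> \<rho> q) p = dderiv w (\<lambda>q. 1) p" for w
      by (intro dderiv_cong_open[OF open_ball p])
    then have o: "\<rho> p \<bullet> dderiv w \<rho> p = 0" for w
      by (simp add: dderiv_inner[OF diff[OF s\<rho> p] diff[OF s\<rho> p]] inner_commute)
    define a where "a = cnj (\<rho> p) * dderiv e1 \<rho> p"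
    have "Re a = 0" using o[of e1] by (simp add: a_def inner_complex_def)
    moreover have "Re (m p * a) = 0" using o[of e2] by (simp add: a_def r2 inner_complex_def algebra_simps)
    ultimately have "Im (m p) * Im a = 0" by simp
    then have "a = 0" using \<open>Re a = 0\<close> ell[OF pS] by (simp add: complex_eq_iff)
    moreover have "\<rho> p \<noteq> 0" using norm[OF pS] unz by (auto simp: \<rho>_def)
    ultimately show ?thesis by (simp add: a_def r2)
  qed
  have "(\<rho> has_derivative (\<lambda>w. 0)) (at p within ball z r)" if p: "p \<in> ball z r" for p
  proof -
    have "dderiv w \<rho> p = 0" for w
      using dderiv_expand2[OF diff[OF s\<rho> p], of w] 0[OF p] by simp
    then show ?thesis
      using smooth_open_has_derivative[OF s\<rho> p] by (simp add: has_derivative_at_withinI)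
  qed
  then obtain c where c: "\<And>p. p \<in> ball z r \<Longrightarrow> \<rho> p = c"
    using has_derivative_zero_constant[OF convex_ball, of z r \<rho>] by blast
  have "z \<in> ball z r" using B by simp
  then have "cmod c = 1" using c[of z] norm[of z] B by (auto simp: \<rho>_def norm_divide subset_iff)
  moreover have "v p = c * u p" if "p \<in> ball z r" for p
    using c[OF that] B(2)[OF that] by (simp add: \<rho>_def field_simps)
  ultimately show ?thesis using that by blast
qed

end

section \<open>Moving frames on immersed surfaces\<close>

lemma cross3_triple:
  fixes a b c :: "real^3"
  shows "cross3 a (cross3 b c) = (a \<bullet> c) *\<^sub>R b - (a \<bullet> b) *\<^sub>R c"
    and "cross3 (cross3 a b) c = (a \<bullet> c) *\<^sub>R b - (b \<bullet> c) *\<^sub>R a"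
  by (simp_all add: cross3_simps forall_3)

text \<open>Taking \<open>B\<close> as the cross product builds the orientation into the
  frame.\<close>

locale orthonormal_frame =
  fixes N A B :: "real^3"
  assumes N: "N \<bullet> N = 1" and A: "A \<bullet> A = 1" and NA: "N \<bullet> A = 0" and B: "B = cross3 N A"
begin

lemma inner: "B \<bullet> B = 1" "N \<bullet> B = 0" "A \<bullet> B = 0" "A \<bullet> N = 0" "B \<bullet> N = 0" "B \<bullet> A = 0"
proof -
  have "B \<bullet> B = (N \<bullet> N) * (A \<bullet> A) - (N \<bullet> A)\<^sup>2"
    unfolding B by (simp add: cross3_simps power2_eq_square)
  then show "B \<bullet> B = 1" by (simp add: N A NA)
  show "N \<bullet> B = 0" "A \<bullet> B = 0" "B \<bullet> N = 0" "B \<bullet> A = 0" unfolding B by (simp_all add: dot_cross_self)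
  show "A \<bullet> N = 0" using NA by (simp add: inner_commute)
qed

lemma cross: "cross3 N A = B" "cross3 N B = - A" "cross3 A B = N"
    "cross3 A N = - B" "cross3 B N = A" "cross3 B A = - N"
proof -
  show "cross3 N A = B" by (simp add: B)
  show 1: "cross3 N B = - A" unfolding B cross3_triple by (simp add: N NA)
  show 2: "cross3 A B = N" unfolding B cross3_triple by (simp add: A inner)
  show "cross3 A N = - B" unfolding B by (rule cross_skew)
  show "cross3 B N = A" using 1 cross_skew[of B N] by simp
  show "cross3 B A = - N" using 2 cross_skew[of B A] by simp
qed

lemma expand: "w = (w \<bullet> A) *\<^sub>R A + (w \<bullet> B) *\<^sub>R B + (w \<bullet> N) *\<^sub>R N"
proof -
  have "cross3 w N = (w \<bullet> A) *\<^sub>R cross3 A N + (w \<bullet> B) *\<^sub>R cross3 B N"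
  proof -
    have "cross3 w (cross3 A B) = (w \<bullet> B) *\<^sub>R A - (w \<bullet> A) *\<^sub>R B" by (rule cross3_triple)
    then show ?thesis by (simp add: cross)
  qed
  then have "cross3 N (cross3 w N) = cross3 N ((w \<bullet> B) *\<^sub>R A - (w \<bullet> A) *\<^sub>R B)" by (simp add: cross)
  also have "\<dots> = (w \<bullet> A) *\<^sub>R A + (w \<bullet> B) *\<^sub>R B"
    by (simp add: Cross3.right_diff_distrib cross_mult_right cross)
  finally show ?thesis unfolding cross3_triple by (simp add: N inner_commute algebra_simps)
qed

lemma expand_inner: "v \<bullet> w = (v \<bullet> A) * (w \<bullet> A) + (v \<bullet> B) * (w \<bullet> B) + (v \<bullet> N) * (w \<bullet> N)"
proof -
  have "v \<bullet> w = ((v \<bullet> A) *\<^sub>R A + (v \<bullet> B) *\<^sub>R B + (v \<bullet> N) *\<^sub>R N) \<bullet> w"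
    using expand[of v] by simp
  then show ?thesis by (simp add: inner_add_left inner_commute[of w])
qed

lemma cross_inner_N: "cross3 v w \<bullet> N = (v \<bullet> A) * (w \<bullet> B) - (v \<bullet> B) * (w \<bullet> A)"
proof -
  have "cross3 v w \<bullet> N = cross3 v w \<bullet> cross3 A B" by (simp add: cross)
  also have "\<dots> = (v \<bullet> A) * (w \<bullet> B) - (v \<bullet> B) * (w \<bullet> A)" by (simp add: cross3_simps)
  finally show ?thesis .
qed

lemma cross_inner_A: "cross3 v w \<bullet> A = (v \<bullet> B) * (w \<bullet> N) - (v \<bullet> N) * (w \<bullet> B)"
proof -
  have "cross3 v w \<bullet> A = cross3 v w \<bullet> cross3 B N" by (simp add: cross)
  also have "\<dots> = (v \<bullet> B) * (w \<bullet> N) - (v \<bullet> N) * (w \<bullet> B)" by (simp add: cross3_simps)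
  finally show ?thesis .
qed

lemma cross_inner_B: "cross3 v w \<bullet> B = (v \<bullet> N) * (w \<bullet> A) - (v \<bullet> A) * (w \<bullet> N)"
proof -
  have "cross3 v w \<bullet> B = cross3 v w \<bullet> cross3 N A" by (simp add: cross)
  also have "\<dots> = (v \<bullet> N) * (w \<bullet> A) - (v \<bullet> A) * (w \<bullet> N)" by (simp add: cross3_simps)
  finally show ?thesis .
qed

end

locale frame_pair = orthonormal_frame N A B + tgt: orthonormal_frame N' A' B'
  for N A B N' A' B' :: "real^3"
begin

definition R :: "real^3 \<Rightarrow> real^3" where
  "R w = (w \<bullet> A) *\<^sub>R A' + (w \<bullet> B) *\<^sub>R B' + (w \<bullet> N) *\<^sub>R N'"

lemma R_frame: "R N = N'" "R A = A'" "R B = B'"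
  by (simp_all add: R_def inner N A NA)

lemma R_components: "R w \<bullet> A' = w \<bullet> A" "R w \<bullet> B' = w \<bullet> B" "R w \<bullet> N' = w \<bullet> N"
  by (simp_all add: R_def inner_add_left tgt.inner tgt.N tgt.A tgt.NA)

lemma R_linear: "linear R"
  by (rule linearI) (simp_all add: R_def inner_add_left algebra_simps)

lemma R_inner: "R v \<bullet> R w = v \<bullet> w"
  using tgt.expand_inner[of "R v" "R w"] expand_inner[of v w] by (simp add: R_components)

text \<open>The components of a cross product are the same polynomials in every positively oriented
  orthonormal frame. In this form the fact that \<open>R\<close> preserves orientation is
  used.\<close>

lemma R_cross: "cross3 (R v) (R w) = R (cross3 v w)"
proof -
  have "cross3 (R v) (R w) = (cross3 (R v) (R w) \<bullet> A') *\<^sub>R A' + (cross3 (R v) (R w) \<bullet> B') *\<^sub>R B'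
      + (cross3 (R v) (R w) \<bullet> N') *\<^sub>R N'"
    by (rule tgt.expand)
  then show ?thesis
    unfolding tgt.cross_inner_A tgt.cross_inner_B tgt.cross_inner_N R_components
      cross_inner_A[symmetric] cross_inner_B[symmetric] cross_inner_N[symmetric] R_def[of "cross3 v w"] .
qed

lemma R_unique:
  assumes "linear T" "T N = N'" "T A = A'" "T B = B'"
  shows "T = R"
proof
  fix w
  have "T w = T ((w \<bullet> A) *\<^sub>R A + (w \<bullet> B) *\<^sub>R B + (w \<bullet> N) *\<^sub>R N)" using expand[of w] by simp
  then show "T w = R w" using assms by (simp add: linear_add linear_scale R_def)
qed

end

section \<open>Structure equations of a parametrized surface\<close>

definition normal :: "(real^2 \<Rightarrow> real^3) \<Rightarrow> real^2 \<Rightarrow> real^3" where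
  "normal f p = sgn (cross3 (dderiv e1 f p) (dderiv e2 f p))"

text \<open>The tangent frame is Gram-Schmidt applied to the coordinate fields; it depends on the
  metric only, so isometric surfaces receive corresponding frames.\<close>

definition frame1 :: "(real^2 \<Rightarrow> real^3) \<Rightarrow> real^2 \<Rightarrow> real^3" where
  "frame1 f p = sgn (dderiv e1 f p)"

definition frame2 :: "(real^2 \<Rightarrow> real^3) \<Rightarrow> real^2 \<Rightarrow> real^3" where
  "frame2 f p = cross3 (normal f p) (frame1 f p)"

text \<open>With respect to the frame, tangent vectors are complex numbers. The coframe \<open>theta\<close> and the form
  \<open>alpha\<close>, which represents \<open>A\<close>, are complex valued 1-forms; \<open>kappa\<close> is the connection form.\<close>

definition theta :: "(real^2 \<Rightarrow> real^3) \<Rightarrow> real^2 \<Rightarrow> real^2 \<Rightarrow> complex" where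
  "theta f v p = Complex (dderiv v f p \<bullet> frame1 f p) (dderiv v f p \<bullet> frame2 f p)"

definition kappa :: "(real^2 \<Rightarrow> real^3) \<Rightarrow> real^2 \<Rightarrow> real^2 \<Rightarrow> real" where
  "kappa f v p = dderiv v (frame1 f) p \<bullet> frame2 f p"

definition alpha :: "(real^2 \<Rightarrow> real^3) \<Rightarrow> real^2 \<Rightarrow> real^2 \<Rightarrow> complex" where
  "alpha f v p = Complex (dderiv v (frame1 f) p \<bullet> normal f p) (dderiv v (frame2 f) p \<bullet> normal f p)"

definition beta :: "(real^2 \<Rightarrow> real^3) \<Rightarrow> real \<Rightarrow> real^2 \<Rightarrow> real^2 \<Rightarrow> complex" where
  "beta f H v p = alpha f v p - of_real H * theta f v p"

locale chart_immersion =
  fixes S :: "(real^2) set" and f :: "real^2 \<Rightarrow> real^3"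
  assumes S: "open S" and f: "smooth_open S f"
    and imm: "\<And>p. p \<in> S \<Longrightarrow> cross3 (dderiv e1 f p) (dderiv e2 f p) \<noteq> 0"
begin

lemma d1_nz: "p \<in> S \<Longrightarrow> dderiv e1 f p \<noteq> 0"
  using imm by (metis cross_zero_left)

lemma smooth_normal: "smooth_open S (normal f)"
  unfolding normal_def[abs_def] by (intro smooth_open_sgn smooth_open_cross3 smooth_open_dderiv S f imm)

lemma smooth_frame1: "smooth_open S (frame1 f)"
  unfolding frame1_def[abs_def] by (intro smooth_open_sgn smooth_open_dderiv S f d1_nz)

lemma smooth_frame2: "smooth_open S (frame2 f)"
  unfolding frame2_def[abs_def] by (intro smooth_open_cross3 smooth_normal smooth_frame1 S)

lemma smooth_theta: "smooth_open S (theta f v)"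
  unfolding theta_def[abs_def]
  by (intro smooth_open_Complex smooth_open_inner smooth_open_dderiv smooth_frame1 smooth_frame2 S f)

lemma smooth_kappa: "smooth_open S (kappa f v)"
  unfolding kappa_def[abs_def]
  by (intro smooth_open_inner smooth_open_dderiv smooth_frame1 smooth_frame2 S)

lemma smooth_alpha: "smooth_open S (alpha f v)"
  unfolding alpha_def[abs_def]
  by (intro smooth_open_Complex smooth_open_inner smooth_open_dderiv smooth_frame1 smooth_frame2 smooth_normal S)

lemma smooth_beta: "smooth_open S (beta f H v)"
  unfolding beta_def[abs_def]
  by (intro smooth_open_diff smooth_open_mult smooth_open_const smooth_alpha smooth_theta S)

lemma frame: "p \<in> S \<Longrightarrow> orthonormal_frame (normal f p) (frame1 f p) (frame2 f p)"
proof (standard, goal_cases)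
  case 1 then show ?case using imm by (simp add: normal_def dot_square_norm norm_sgn)
next
  case 2 then show ?case using d1_nz by (simp add: frame1_def dot_square_norm norm_sgn)
next
  case 3 then show ?case by (simp add: normal_def frame1_def sgn_div_norm dot_cross_self)
next
  case 4 then show ?case by (simp add: frame2_def)
qed

lemmas diff = smooth_open_differentiable

lemma dderiv_inner_at:
  fixes F G :: "real^2 \<Rightarrow> real^3"
  assumes "smooth_open S F" "smooth_open S G" "p \<in> S"
  shows "dderiv v (\<lambda>q. F q \<bullet> G q) p = F p \<bullet> dderiv v G p + dderiv v F p \<bullet> G p"
  by (rule dderiv_inner[OF diff[OF assms(1,3)] diff[OF assms(2,3)]])

lemma dderiv_inner_const:
  fixes F G :: "real^2 \<Rightarrow> real^3"
  assumes "smooth_open S F" "smooth_open S G" "p \<in> S" "\<And>q. q \<in> S \<Longrightarrow> F q \<bullet> G q = c"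
  shows "dderiv v F p \<bullet> G p = - (F p \<bullet> dderiv v G p)"
proof -
  have "dderiv v (\<lambda>q. F q \<bullet> G q) p = dderiv v (\<lambda>q. c) p"
    by (rule dderiv_cong_open[OF S assms(3,4)])
  then show ?thesis using dderiv_inner_at[OF assms(1-3), of v] by simp
qed

lemma d_tangent: "p \<in> S \<Longrightarrow> dderiv v f p \<bullet> normal f p = 0"
proof -
  assume p: "p \<in> S"
  have "dderiv e1 f p \<bullet> normal f p = 0" "dderiv e2 f p \<bullet> normal f p = 0"
    by (simp_all add: normal_def sgn_div_norm dot_cross_self)
  then show ?thesis
    by (subst dderiv_expand2[OF diff[OF f p]]) (simp add: inner_add_left)
qed

lemma d_f: "p \<in> S \<Longrightarrow> dderiv v f p = Re (theta f v p) *\<^sub>R frame1 f p + Im (theta f v p) *\<^sub>R frame2 f p"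
  using orthonormal_frame.expand[OF frame, of p "dderiv v f p"] d_tangent[of p v] by (simp add: theta_def)

lemma d_frame1: "p \<in> S \<Longrightarrow> dderiv v (frame1 f) p = kappa f v p *\<^sub>R frame2 f p + Re (alpha f v p) *\<^sub>R normal f p"
proof -
  assume p: "p \<in> S"
  have "dderiv v (frame1 f) p \<bullet> frame1 f p = 0"
    using dderiv_inner_const[OF smooth_frame1 smooth_frame1 p orthonormal_frame.A[OF frame], of v]
    by (simp add: inner_commute)
  then show ?thesis
    using orthonormal_frame.expand[OF frame[OF p], of "dderiv v (frame1 f) p"] by (simp add: kappa_def alpha_def)
qed

lemma d_frame2: "p \<in> S \<Longrightarrow> dderiv v (frame2 f) p = - kappa f v p *\<^sub>R frame1 f p + Im (alpha f v p) *\<^sub>R normal f p"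
proof -
  assume p: "p \<in> S"
  have "dderiv v (frame2 f) p \<bullet> frame2 f p = 0"
    using dderiv_inner_const[OF smooth_frame2 smooth_frame2 p orthonormal_frame.inner(1)[OF frame], of v]
    by (simp add: inner_commute)
  moreover have "dderiv v (frame2 f) p \<bullet> frame1 f p = - kappa f v p"
    using dderiv_inner_const[OF smooth_frame2 smooth_frame1 p orthonormal_frame.inner(6)[OF frame], of v]
    by (simp add: kappa_def inner_commute)
  ultimately show ?thesis
    using orthonormal_frame.expand[OF frame[OF p], of "dderiv v (frame2 f) p"] by (simp add: alpha_def)
qed

lemma d_normal: "p \<in> S \<Longrightarrow> dderiv v (normal f) p = - Re (alpha f v p) *\<^sub>R frame1 f p - Im (alpha f v p) *\<^sub>R frame2 f p"
proof -
  assume p: "p \<in> S"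
  have "dderiv v (normal f) p \<bullet> normal f p = 0"
    using dderiv_inner_const[OF smooth_normal smooth_normal p orthonormal_frame.N[OF frame], of v]
    by (simp add: inner_commute)
  moreover have "dderiv v (normal f) p \<bullet> frame1 f p = - Re (alpha f v p)"
    using dderiv_inner_const[OF smooth_normal smooth_frame1 p orthonormal_frame.NA[OF frame], of v]
    by (simp add: alpha_def inner_commute)
  moreover have "dderiv v (normal f) p \<bullet> frame2 f p = - Im (alpha f v p)"
    using dderiv_inner_const[OF smooth_normal smooth_frame2 p orthonormal_frame.inner(2)[OF frame], of v]
    by (simp add: alpha_def inner_commute)
  ultimately show ?thesis
    using orthonormal_frame.expand[OF frame[OF p], of "dderiv v (normal f) p"] by simp
qed

text \<open>The exterior derivative of the 1-form \<open>dF \<bullet> G\<close>: by Schwarz's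
  theorem the second derivatives of \<open>F\<close> cancel. Applied to pairs taken from the
  immersion and its frame it yields all the structure equations.\<close>

lemma exterior_inner:
  fixes F G :: "real^2 \<Rightarrow> real^3"
  assumes "smooth_open S F" "smooth_open S G" "p \<in> S"
  shows "dderiv w (\<lambda>q. dderiv v F q \<bullet> G q) p - dderiv v (\<lambda>q. dderiv w F q \<bullet> G q) p
    = dderiv v F p \<bullet> dderiv w G p - dderiv w F p \<bullet> dderiv v G p"
  using dderiv_commute[OF S assms(1,3), of w v]
  by (simp add: dderiv_inner_at[OF smooth_open_dderiv[OF assms(1)] assms(2,3)])

lemmas frame_inner = orthonormal_frame.inner[OF frame] orthonormal_frame.A[OF frame]
  orthonormal_frame.N[OF frame] orthonormal_frame.NA[OF frame]

text \<open>Cartan's first structure equation, the absence of torsion. It determines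
  \<open>kappa\<close> from \<open>theta\<close>, which makes the connection form intrinsic.\<close>

lemma structure_theta:
  assumes p: "p \<in> S"
  shows "dderiv w (theta f v) p - dderiv v (theta f w) p
    = \<i> * (of_real (kappa f v p) * theta f w p - of_real (kappa f w p) * theta f v p)"
proof -
  have d: "(\<lambda>q. dderiv v f q \<bullet> F q) differentiable (at p)" if "smooth_open S F" for v and F :: "real^2 \<Rightarrow> real^3"
    by (intro diff[OF _ p] smooth_open_inner smooth_open_dderiv f S that)
  have *: "dderiv w (theta f v) p = Complex (dderiv w (\<lambda>q. dderiv v f q \<bullet> frame1 f q) p)
      (dderiv w (\<lambda>q. dderiv v f q \<bullet> frame2 f q) p)" for v w
    unfolding theta_def[abs_def] by (rule dderiv_Complex[OF d[OF smooth_frame1] d[OF smooth_frame2]])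
  show ?thesis
    unfolding * complex_eq_iff
    using exterior_inner[OF f smooth_frame1 p, of w v] exterior_inner[OF f smooth_frame2 p, of w v]
    by (simp add: d_f[OF p] d_frame1[OF p] d_frame2[OF p] inner_add_left inner_add_right
        inner_diff_right frame_inner[OF p])
qed

text \<open>The Codazzi equations. They have the same form as the equation for \<open>theta\<close>,
  so subtracting a constant multiple of \<open>theta\<close> from \<open>alpha\<close> preserves
  them.\<close>

lemma structure_alpha:
  assumes p: "p \<in> S"
  shows "dderiv w (alpha f v) p - dderiv v (alpha f w) p
    = \<i> * (of_real (kappa f v p) * alpha f w p - of_real (kappa f w p) * alpha f v p)"
proof -
  have d: "(\<lambda>q. dderiv v F q \<bullet> normal f q) differentiable (at p)" if "smooth_open S F" for v and F :: "real^2 \<Rightarrow> real^3"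
    by (intro diff[OF _ p] smooth_open_inner smooth_open_dderiv smooth_normal S that)
  have *: "dderiv w (alpha f v) p = Complex (dderiv w (\<lambda>q. dderiv v (frame1 f) q \<bullet> normal f q) p)
      (dderiv w (\<lambda>q. dderiv v (frame2 f) q \<bullet> normal f q) p)" for v w
    unfolding alpha_def[abs_def] by (rule dderiv_Complex[OF d[OF smooth_frame1] d[OF smooth_frame2]])
  show ?thesis
    unfolding * complex_eq_iff
    using exterior_inner[OF smooth_frame1 smooth_normal p, of w v] exterior_inner[OF smooth_frame2 smooth_normal p, of w v]
    by (simp add: d_normal[OF p] d_frame1[OF p] d_frame2[OF p] inner_add_left inner_add_right
        inner_diff_left inner_diff_right frame_inner[OF p])
qed

text \<open>The Gauss equation: the right-hand side is the determinant of the shape operator times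
  the area form.\<close>

lemma gauss:
  assumes p: "p \<in> S"
  shows "dderiv w (kappa f v) p - dderiv v (kappa f w) p = Im (cnj (alpha f v p) * alpha f w p)"
proof -
  have k: "kappa f v = (\<lambda>q. dderiv v (frame1 f) q \<bullet> frame2 f q)" for v
    by (simp add: fun_eq_iff kappa_def)
  have "dderiv w (kappa f v) p - dderiv v (kappa f w) p
    = dderiv v (frame1 f) p \<bullet> dderiv w (frame2 f) p - dderiv w (frame1 f) p \<bullet> dderiv v (frame2 f) p"
    unfolding k by (rule exterior_inner[OF smooth_frame1 smooth_frame2 p])
  then show ?thesis
    by (simp add: d_frame1[OF p] d_frame2[OF p] inner_add_left inner_add_right inner_diff_right
        frame_inner[OF p] orthonormal_frame.inner[OF frame[OF p]])
qed

lemma structure_beta: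
  assumes p: "p \<in> S"
  shows "dderiv w (beta f H v) p - dderiv v (beta f H w) p
    = \<i> * (of_real (kappa f v p) * beta f H w p - of_real (kappa f w p) * beta f H v p)"
proof -
  have *: "dderiv w (beta f H v) p = dderiv w (alpha f v) p - of_real H * dderiv w (theta f v) p" for v w
  proof -
    have "dderiv w (beta f H v) p = dderiv w (alpha f v) p - dderiv w (\<lambda>q. of_real H * theta f v q) p"
      unfolding beta_def[abs_def]
      by (intro dderiv_diff diff[OF _ p] smooth_alpha smooth_theta smooth_open_mult smooth_open_const S)
    then show ?thesis
      using dderiv_linear[OF bounded_linear_mult_right diff[OF smooth_theta p], of w "of_real H" v] by simp
  qed
  have "dderiv w (beta f H v) p - dderiv v (beta f H w) p
    = (dderiv w (alpha f v) p - dderiv v (alpha f w) p) - of_real H * (dderiv w (theta f v) p - dderiv v (theta f w) p)"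
    unfolding * by (simp add: algebra_simps)
  then show ?thesis
    unfolding structure_alpha[OF p] structure_theta[OF p] by (simp add: beta_def algebra_simps)
qed

text \<open>Symmetry of the second fundamental form: differentiating the tangency relation expresses
  both sides by a mixed second derivative.\<close>

lemma alpha_symmetric:
  assumes p: "p \<in> S"
  shows "Re (cnj (theta f v p) * alpha f w p) = Re (cnj (theta f w p) * alpha f v p)"
proof -
  have "dderiv w (dderiv v f) p \<bullet> normal f p = Re (cnj (theta f v p) * alpha f w p)" for v w
  proof -
    have "dderiv w (dderiv v f) p \<bullet> normal f p = - (dderiv v f p \<bullet> dderiv w (normal f) p)"
      by (rule dderiv_inner_const[OF smooth_open_dderiv[OF f] smooth_normal p d_tangent])
    also have "dderiv v f p \<bullet> dderiv w (normal f) p = - Re (cnj (theta f v p) * alpha f w p)"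
      by (simp add: d_f[OF p] d_normal[OF p] inner_add_left inner_diff_right frame_inner[OF p])
    finally show ?thesis by simp
  qed
  from this[of w v] this[of v w] show ?thesis using dderiv_commute[OF S f p, of w v] by simp
qed

lemma theta_e1: "p \<in> S \<Longrightarrow> theta f e1 p = of_real (norm (dderiv e1 f p))"
proof -
  assume p: "p \<in> S"
  have "dderiv e1 f p \<bullet> frame1 f p = norm (dderiv e1 f p)"
    using d1_nz[OF p] by (simp add: frame1_def sgn_div_norm dot_square_norm power2_eq_square)
  moreover have "dderiv e1 f p \<bullet> frame2 f p = 0"
    by (simp add: frame2_def frame1_def sgn_div_norm cross_mult_right dot_cross_self)
  ultimately show ?thesis by (simp add: theta_def complex_eq_iff)
qed

lemma cross_normal: "p \<in> S \<Longrightarrow> cross3 (dderiv v f p) (dderiv w f p) \<bullet> normal f p = Im (cnj (theta f v p) * theta f w p)"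
  using orthonormal_frame.cross_inner_N[OF frame] by (simp add: theta_def)

lemma theta_area: "p \<in> S \<Longrightarrow> norm (dderiv e1 f p) * Im (theta f e2 p) = norm (cross3 (dderiv e1 f p) (dderiv e2 f p))"
proof -
  assume p: "p \<in> S"
  have "cross3 (dderiv e1 f p) (dderiv e2 f p) \<bullet> normal f p = norm (cross3 (dderiv e1 f p) (dderiv e2 f p))"
    using imm[OF p] by (simp add: normal_def sgn_div_norm dot_square_norm power2_eq_square)
  then show ?thesis using cross_normal[OF p, of e1 e2] by (simp add: theta_e1[OF p])
qed

lemma Im_theta: "p \<in> S \<Longrightarrow> Im (theta f e2 p) > 0"
  using theta_area imm d1_nz by (metis norm_ge_zero zero_less_mult_pos zero_less_norm_iff)

lemma linear_forms:
  assumes p: "p \<in> S"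
  shows "theta f v p = of_real (v $ 1) * theta f e1 p + of_real (v $ 2) * theta f e2 p"
    and "beta f H v p = of_real (v $ 1) * beta f H e1 p + of_real (v $ 2) * beta f H e2 p"
    and "kappa f v p = v $ 1 * kappa f e1 p + v $ 2 * kappa f e2 p"
proof -
  have ex: "dderiv v F p \<bullet> w = v $ 1 * (dderiv e1 F p \<bullet> w) + v $ 2 * (dderiv e2 F p \<bullet> w)"
    if "smooth_open S F" for w and F :: "real^2 \<Rightarrow> real^3"
    by (subst dderiv_expand2[OF diff[OF that p]]) (simp add: inner_add_left)
  show 1: "theta f v p = of_real (v $ 1) * theta f e1 p + of_real (v $ 2) * theta f e2 p"
    unfolding theta_def ex[OF f] by (rule complex_eqI) simp_all
  have 2: "alpha f v p = of_real (v $ 1) * alpha f e1 p + of_real (v $ 2) * alpha f e2 p"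
    unfolding alpha_def ex[OF smooth_frame1] ex[OF smooth_frame2] by (rule complex_eqI) simp_all
  show "beta f H v p = of_real (v $ 1) * beta f H e1 p + of_real (v $ 2) * beta f H e2 p"
    unfolding beta_def 1 2 by (simp only: ring_distribs) simp
  show "kappa f v p = v $ 1 * kappa f e1 p + v $ 2 * kappa f e2 p"
    unfolding kappa_def by (rule ex[OF smooth_frame1])
qed

end

section \<open>The Codazzi equation as an elliptic equation for one complex function\<close>

definition coef_m :: "(real^2 \<Rightarrow> real^3) \<Rightarrow> real^2 \<Rightarrow> complex" where
  "coef_m f p = cnj (theta f e2 p) / theta f e1 p"

text \<open>The zeroth order coefficient that remains after
  \<open>beta e2 = coef_m * beta e1\<close> is inserted in \<open>structure_beta\<close>. Like
  \<open>coef_m\<close> it is built from \<open>theta\<close> and \<open>kappa\<close>, hence from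
  the metric.\<close>

definition coef_n :: "(real^2 \<Rightarrow> real^3) \<Rightarrow> real^2 \<Rightarrow> complex" where
  "coef_n f p = dderiv e1 (coef_m f) p + \<i> * (of_real (kappa f e1 p) * coef_m f p - of_real (kappa f e2 p))"

text \<open>With \<open>dN = - df A\<close> the left-hand side is minus the trace of
  \<open>A\<close> times the cross product on the right. This is mean curvature \<open>H\<close>
  expressed without the shape operator.\<close>

locale chart_cmc = chart_immersion +
  fixes H :: real
  assumes mc: "\<And>p. p \<in> S \<Longrightarrow>
    cross3 (dderiv e1 (normal f) p) (dderiv e2 f p) + cross3 (dderiv e1 f p) (dderiv e2 (normal f) p)
      = (- 2 * H) *\<^sub>R cross3 (dderiv e1 f p) (dderiv e2 f p)"
begin

text \<open>\<open>beta\<close> represents the trace-free part of \<open>A\<close>, which is conjugate linear.\<close>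

lemma beta_conj_linear:
  assumes p: "p \<in> S"
  shows "beta f H e2 p = coef_m f p * beta f H e1 p"
proof -
  define a b s t where "a = alpha f e1 p" and "b = alpha f e2 p" and "s = theta f e1 p" and "t = theta f e2 p"
  have "(cross3 (dderiv e1 (normal f) p) (dderiv e2 f p) + cross3 (dderiv e1 f p) (dderiv e2 (normal f) p)) \<bullet> normal f p
      = - 2 * H * (cross3 (dderiv e1 f p) (dderiv e2 f p) \<bullet> normal f p)"
    unfolding mc[OF p] by simp
  then have "- Im (cnj a * t) - Im (cnj s * b) = - 2 * H * Im (cnj s * t)"
    unfolding cross_normal[OF p] inner_add_left orthonormal_frame.cross_inner_N[OF frame[OF p]]
    by (simp add: d_f[OF p] d_normal[OF p] inner_add_left inner_diff_left frame_inner[OF p]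
        orthonormal_frame.inner[OF frame[OF p]] a_def b_def s_def t_def algebra_simps)
  moreover have "Re (cnj s * b) = Re (cnj t * a)"
    using alpha_symmetric[OF p, of e1 e2] by (simp add: a_def b_def s_def t_def)
  \<comment> \<open>The real part is the symmetry of the second fundamental form, the imaginary part
    the mean curvature condition.\<close>
  ultimately have "cnj s * (b - of_real H * t) = cnj t * (a - of_real H * s)"
    by (simp add: complex_eq_iff algebra_simps)
  moreover have "cnj s = s" "s \<noteq> 0" using d1_nz[OF p] by (simp_all add: s_def theta_e1[OF p])
  ultimately show ?thesis
    by (simp add: beta_def coef_m_def a_def b_def s_def t_def field_simps)
qed

lemma smooth_coef_m: "smooth_open S (coef_m f)"
  unfolding coef_m_def[abs_def]
  by (intro smooth_open_divide smooth_open_cnj smooth_theta S) (simp add: theta_e1 d1_nz)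

lemma smooth_coef_n: "smooth_open S (coef_n f)"
  unfolding coef_n_def[abs_def]
  by (intro smooth_open_add smooth_open_diff smooth_open_mult smooth_open_const smooth_open_dderiv smooth_coef_m
      smooth_open_linear[OF _ bounded_linear_of_real] smooth_kappa S)

lemma Im_coef_m: "p \<in> S \<Longrightarrow> Im (coef_m f p) < 0"
  using Im_theta[of p] d1_nz[of p]
  by (simp add: coef_m_def theta_e1 Im_divide_of_real divide_neg_pos)

lemma codazzi:
  assumes p: "p \<in> S"
  shows "dderiv e2 (beta f H e1) p = coef_m f p * dderiv e1 (beta f H e1) p + coef_n f p * beta f H e1 p"
proof -
  have "dderiv e1 (beta f H e2) p = dderiv e1 (\<lambda>q. coef_m f q * beta f H e1 q) p"
    by (rule dderiv_cong_open[OF S p beta_conj_linear])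
  also have "\<dots> = coef_m f p * dderiv e1 (beta f H e1) p + dderiv e1 (coef_m f) p * beta f H e1 p"
    by (rule dderiv_mult[OF diff[OF smooth_coef_m p] diff[OF smooth_beta p]])
  finally show ?thesis
    using structure_beta[OF p, of e2 H e1] unfolding coef_n_def beta_conj_linear[OF p]
    by (simp add: algebra_simps)
qed

text \<open>The identity \<open>K = H\<^sup>2 - |b|\<^sup>2\<close> for a shape operator
  \<open>w \<mapsto> H w + b cnj w\<close>, multiplied by the area element; the sign is hidden in
  \<open>Im (coef_m f p)\<close>, which is negative.\<close>

lemma norm_beta:
  assumes p: "p \<in> S"
  shows "(cmod (beta f H e1 p))\<^sup>2 * Im (coef_m f p)
    = Im (cnj (alpha f e1 p) * alpha f e2 p) - H\<^sup>2 * Im (cnj (theta f e1 p) * theta f e2 p)"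
proof -
  define b s t where "b = beta f H e1 p" and "s = norm (dderiv e1 f p)" and "t = theta f e2 p"
  have s: "s \<noteq> 0" "theta f e1 p = of_real s" using d1_nz[OF p] by (simp_all add: s_def theta_e1[OF p])
  have a1: "alpha f e1 p = b + of_real H * of_real s" by (simp add: b_def beta_def s)
  have b2: "beta f H e2 p = cnj t / of_real s * b" using beta_conj_linear[OF p] by (simp add: coef_m_def b_def t_def s)
  define g where "g = cnj t / of_real s"
  have t: "t = of_real s * cnj g" using s(1) by (simp add: g_def)
  have a2: "alpha f e2 p = g * b + of_real H * t"
    using b2 by (simp add: beta_def t_def g_def algebra_simps)
  have "Im (cnj (b + of_real H * of_real s) * (g * b + of_real H * t)) - H\<^sup>2 * Im (cnj (of_real s) * t)
    = (cmod b)\<^sup>2 * Im g"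
    unfolding t cmod_power2 by (simp add: power2_eq_square algebra_simps)
  then show ?thesis unfolding a1 a2 s(2) coef_m_def b_def[symmetric] t_def[symmetric] g_def by simp
qed

lemma elliptic: "elliptic_solution S (coef_m f) (coef_n f) (beta f H e1)"
  using S smooth_coef_m smooth_coef_n smooth_beta Im_coef_m codazzi
  by unfold_locales (auto simp: less_imp_neq)

end

section \<open>Comparison of two isometric surfaces in one chart\<close>

definition rot :: "(real^2 \<Rightarrow> real^3) \<Rightarrow> (real^2 \<Rightarrow> real^3) \<Rightarrow> real^2 \<Rightarrow> real^3 \<Rightarrow> real^3" where
  "rot f g p w = (w \<bullet> frame1 f p) *\<^sub>R frame1 g p + (w \<bullet> frame2 f p) *\<^sub>R frame2 g p
     + (w \<bullet> normal f p) *\<^sub>R normal g p"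

text \<open>The differential of \<open>\<zeta> = N + H f\<close>. It equals
  \<open>- df (A - H)\<close>, so for mean curvature \<open>H\<close> it carries the trace-free part
  of \<open>A\<close>.\<close>

definition dzeta :: "(real^2 \<Rightarrow> real^3) \<Rightarrow> real \<Rightarrow> real^2 \<Rightarrow> real^2 \<Rightarrow> real^3" where
  "dzeta f H v p = dderiv v (normal f) p + H *\<^sub>R dderiv v f p"

text \<open>After identification of the ambient spaces by the rotation, the trace-free parts of the two
  shape operators differ by the rotation of the tangent plane with phase \<open>c\<close>.\<close>

definition chart_phase :: "(real^2 \<Rightarrow> real^3) \<Rightarrow> (real^2 \<Rightarrow> real^3) \<Rightarrow> real \<Rightarrow> complex \<Rightarrow> real^2 \<Rightarrow> bool" where
  "chart_phase f g H c p \<longleftrightarrow>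
     (\<forall>v. dzeta g H v p = rot f g p (Re c *\<^sub>R dzeta f H v p + Im c *\<^sub>R cross3 (normal f p) (dzeta f H v p)))"

context chart_immersion
begin

lemma dzeta_frame: "p \<in> S \<Longrightarrow> dzeta f H v p = - Re (beta f H v p) *\<^sub>R frame1 f p - Im (beta f H v p) *\<^sub>R frame2 f p"
  by (simp add: dzeta_def d_normal d_f beta_def algebra_simps)

end

locale chart_isometric = chart_immersion S f + other: chart_immersion S g for S f g +
  assumes iso: "\<And>p v w. p \<in> S \<Longrightarrow> dderiv v g p \<bullet> dderiv w g p = dderiv v f p \<bullet> dderiv w f p"
begin

lemma pair: "p \<in> S \<Longrightarrow> frame_pair (normal f p) (frame1 f p) (frame2 f p) (normal g p) (frame1 g p) (frame2 g p)"
  using frame other.frame by (simp add: frame_pair_def)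

lemma rot_R: "p \<in> S \<Longrightarrow> rot f g p = frame_pair.R (normal f p) (frame1 f p) (frame2 f p) (normal g p) (frame1 g p) (frame2 g p)"
  using frame_pair.R_def[OF pair] by (simp add: rot_def fun_eq_iff)

lemma norm_eq: "p \<in> S \<Longrightarrow> norm (dderiv v g p) = norm (dderiv v f p)"
  using iso[of p v v] by (simp add: norm_eq_sqrt_inner)

text \<open>On the coordinate fields every component of \<open>theta\<close> is an expression in the
  metric: lengths, inner products and, for the last component, the area element.\<close>

lemma theta_eq:
  assumes p: "p \<in> S"
  shows "theta g v p = theta f v p"
proof -
  have 1: "theta g e1 p = theta f e1 p" by (simp add: theta_e1[OF p] other.theta_e1[OF p] norm_eq[OF p])
  have "(norm (cross3 (dderiv e1 g p) (dderiv e2 g p)))\<^sup>2 = (norm (cross3 (dderiv e1 f p) (dderiv e2 f p)))\<^sup>2"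
    using norm_cross_dot[of "dderiv e1 g p" "dderiv e2 g p"] norm_cross_dot[of "dderiv e1 f p" "dderiv e2 f p"]
    unfolding norm_eq[OF p] iso[OF p] by linarith
  then have "norm (dderiv e1 f p) * Im (theta g e2 p) = norm (dderiv e1 f p) * Im (theta f e2 p)"
    using theta_area[OF p] other.theta_area[OF p] by (simp add: norm_eq[OF p])
  moreover have "Re (theta g e2 p) = Re (theta f e2 p)"
    by (simp add: theta_def frame1_def sgn_div_norm norm_eq[OF p] iso[OF p])
  ultimately have "theta g e2 p = theta f e2 p" using d1_nz[OF p] by (simp add: complex_eq_iff)
  with 1 show ?thesis using linear_forms(1)[OF p, of v] other.linear_forms(1)[OF p, of v] by simp
qed

lemma rot_linear: "p \<in> S \<Longrightarrow> linear (rot f g p)"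
  and rot_inner: "p \<in> S \<Longrightarrow> rot f g p v \<bullet> rot f g p w = v \<bullet> w"
  and rot_cross: "p \<in> S \<Longrightarrow> cross3 (rot f g p v) (rot f g p w) = rot f g p (cross3 v w)"
  and rot_normal: "p \<in> S \<Longrightarrow> rot f g p (normal f p) = normal g p"
  and rot_frame1: "p \<in> S \<Longrightarrow> rot f g p (frame1 f p) = frame1 g p"
  and rot_frame2: "p \<in> S \<Longrightarrow> rot f g p (frame2 f p) = frame2 g p"
  using frame_pair.R_linear[OF pair] frame_pair.R_inner[OF pair] frame_pair.R_cross[OF pair]
    frame_pair.R_frame[OF pair] by (simp_all add: rot_R)

lemma rot_d: "p \<in> S \<Longrightarrow> rot f g p (dderiv v f p) = dderiv v g p"
  using rot_linear[of p] by (simp add: d_f other.d_f linear_add linear_scale rot_frame1 rot_frame2 theta_eq)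

text \<open>Identifies the rotation by its action on tangent and normal vectors instead of frames,
  so that rotations read in different charts can be recognized as equal.\<close>

lemma rot_unique:
  assumes p: "p \<in> S" and T: "linear T" "\<And>v. T (dderiv v f p) = dderiv v g p" "T (normal f p) = normal g p"
    "\<And>v w. T (cross3 v w) = cross3 (T v) (T w)"
  shows "T = rot f g p"
proof -
  have 1: "T (frame1 f p) = frame1 g p"
    using T(1,2) by (simp add: frame1_def sgn_div_norm linear_scale norm_eq[OF p])
  then have "T (frame2 f p) = frame2 g p" using T by (simp add: frame2_def)
  with 1 T show ?thesis unfolding rot_R[OF p] by (intro frame_pair.R_unique[OF pair[OF p]])
qed

lemma smooth_rot: "smooth_open S (\<lambda>q. rot f g q w)"
  unfolding rot_def
  by (intro smooth_open_add smooth_open_scaleR smooth_open_inner smooth_open_const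
      smooth_frame1 smooth_frame2 smooth_normal other.smooth_frame1 other.smooth_frame2 other.smooth_normal S)

text \<open>Uniqueness of the Levi-Civita connection. As \<open>theta f e1\<close> is real and
  \<open>theta f e2\<close> is not, the one complex equation determines both real unknowns.\<close>

lemma kappa_eq:
  assumes p: "p \<in> S"
  shows "kappa g e1 p = kappa f e1 p" "kappa g e2 p = kappa f e2 p"
proof -
  have "dderiv w (theta g v) p = dderiv w (theta f v) p" for v w
    by (rule dderiv_cong_open[OF S p theta_eq])
  then have "\<i> * (of_real (kappa f e1 p) * theta f e2 p - of_real (kappa f e2 p) * theta f e1 p)
      = \<i> * (of_real (kappa g e1 p) * theta f e2 p - of_real (kappa g e2 p) * theta f e1 p)"
    using structure_theta[OF p, of e2 e1] other.structure_theta[OF p, of e2 e1] by (simp add: theta_eq[OF p])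
  then have eq: "of_real (kappa f e1 p) * theta f e2 p - of_real (kappa f e2 p) * theta f e1 p
      = of_real (kappa g e1 p) * theta f e2 p - of_real (kappa g e2 p) * theta f e1 p" by simp
  have "kappa f e1 p * Im (theta f e2 p) = kappa g e1 p * Im (theta f e2 p)"
    using arg_cong[OF eq, of Im] by (simp add: theta_e1[OF p])
  then show 1: "kappa g e1 p = kappa f e1 p" using Im_theta[OF p] by simp
  have "kappa f e2 p * norm (dderiv e1 f p) = kappa g e2 p * norm (dderiv e1 f p)"
    using arg_cong[OF eq, of Re] by (simp add: theta_e1[OF p] 1)
  then show "kappa g e2 p = kappa f e2 p" using d1_nz[OF p] by simp
qed

lemma coef_m_eq: "p \<in> S \<Longrightarrow> coef_m g p = coef_m f p"
  by (simp add: coef_m_def theta_eq)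

lemma coef_n_eq: "p \<in> S \<Longrightarrow> coef_n g p = coef_n f p"
  using dderiv_cong_open[OF S _ coef_m_eq, where v = e1 and p = p] by (simp add: coef_n_def coef_m_eq kappa_eq)

text \<open>The theorema egregium: the connection form is intrinsic, so its exterior derivative is
  too.\<close>

lemma gauss_eq:
  assumes p: "p \<in> S"
  shows "Im (cnj (alpha g e1 p) * alpha g e2 p) = Im (cnj (alpha f e1 p) * alpha f e2 p)"
proof -
  have "dderiv e2 (kappa g e1) p = dderiv e2 (kappa f e1) p"
    by (rule dderiv_cong_open[OF S p kappa_eq(1)])
  moreover have "dderiv e1 (kappa g e2) p = dderiv e1 (kappa f e2) p"
    by (rule dderiv_cong_open[OF S p kappa_eq(2)])
  ultimately show ?thesis using gauss[OF p, of e2 e1] other.gauss[OF p, of e2 e1] by simp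
qed

end

locale chart_pair = chart_isometric S f g + chart_cmc S f H + other: chart_cmc S g H for S f g H
begin

lemma norm_beta_eq:
  assumes p: "p \<in> S"
  shows "cmod (beta g H e1 p) = cmod (beta f H e1 p)"
proof -
  have "(cmod (beta g H e1 p))\<^sup>2 * Im (coef_m f p) = (cmod (beta f H e1 p))\<^sup>2 * Im (coef_m f p)"
    using norm_beta[OF p] other.norm_beta[OF p]
    unfolding gauss_eq[OF p] theta_eq[OF p] coef_m_eq[OF p] by linarith
  then show ?thesis using Im_coef_m[OF p] by (simp add: power2_eq_iff_nonneg)
qed

text \<open>In the frame, the cross product with the normal is multiplication by the imaginary
  unit.\<close>

lemma rot_rotate:
  assumes p: "p \<in> S"
  shows "rot f g p (Re c *\<^sub>R dzeta f H v p + Im c *\<^sub>R cross3 (normal f p) (dzeta f H v p))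
    = - Re (c * beta f H v p) *\<^sub>R frame1 g p - Im (c * beta f H v p) *\<^sub>R frame2 g p"
proof -
  note lin = rot_linear[OF p]
  have "cross3 (normal f p) (dzeta f H v p) = Im (beta f H v p) *\<^sub>R frame1 f p - Re (beta f H v p) *\<^sub>R frame2 f p"
    unfolding dzeta_frame[OF p]
    by (simp add: Cross3.right_diff_distrib cross_mult_right orthonormal_frame.cross[OF frame[OF p]])
  then show ?thesis
    unfolding dzeta_frame[OF p]
    by (simp add: linear_add[OF lin] linear_diff[OF lin] linear_neg[OF lin] linear_scale[OF lin] rot_frame1[OF p] rot_frame2[OF p])
       (simp add: algebra_simps)
qed

text \<open>Both forms are conjugate linear with the same \<open>coef_m\<close>, so their values on
  \<open>e1\<close> determine them.\<close>

lemma phase_iff: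
  assumes p: "p \<in> S"
  shows "chart_phase f g H c p \<longleftrightarrow> beta g H e1 p = c * beta f H e1 p"
proof
  assume *: "chart_phase f g H c p"
  have "- Re (beta g H e1 p) *\<^sub>R frame1 g p - Im (beta g H e1 p) *\<^sub>R frame2 g p
    = - Re (c * beta f H e1 p) *\<^sub>R frame1 g p - Im (c * beta f H e1 p) *\<^sub>R frame2 g p" (is "?l = ?r")
    using *[unfolded chart_phase_def, rule_format, of e1] rot_rotate[OF p, of c e1] other.dzeta_frame[OF p, of H e1]
    by simp
  then have "?l \<bullet> frame1 g p = ?r \<bullet> frame1 g p" "?l \<bullet> frame2 g p = ?r \<bullet> frame2 g p" by simp_all
  then show "beta g H e1 p = c * beta f H e1 p"
    by (simp add: inner_diff_left other.frame_inner[OF p] orthonormal_frame.inner[OF other.frame[OF p]] complex_eq_iff)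
next
  assume 1: "beta g H e1 p = c * beta f H e1 p"
  then have 2: "beta g H e2 p = c * beta f H e2 p"
    using beta_conj_linear[OF p] other.beta_conj_linear[OF p] by (simp add: coef_m_eq[OF p])
  have "beta g H v p = c * beta f H v p" for v
    using linear_forms(2)[OF p, of H v] other.linear_forms(2)[OF p, of H v] 1 2 by (simp add: algebra_simps)
  then show "chart_phase f g H c p"
    unfolding chart_phase_def rot_rotate[OF p] by (simp add: other.dzeta_frame[OF p])
qed

lemma phase_local:
  assumes z: "z \<in> S" and nz: "beta f H e1 z \<noteq> 0"
  obtains c r where "r > 0" "ball z r \<subseteq> S" "cmod c = 1" "\<And>p. p \<in> ball z r \<Longrightarrow> chart_phase f g H c p"
proof -
  obtain r1 where r1: "r1 > 0" "ball z r1 \<subseteq> S" using S z openE by blast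
  have "isCont (beta f H e1) z"
    using smooth_open_continuous_on[OF smooth_beta] S z by (simp add: continuous_on_eq_continuous_at)
  then obtain r2 where r2: "r2 > 0" "\<And>p. dist z p < r2 \<Longrightarrow> beta f H e1 p \<noteq> 0"
    using continuous_at_avoid[of z "beta f H e1" 0] nz by blast
  define r where "r = min r1 r2"
  have r: "r > 0" "ball z r \<subseteq> S" "\<And>p. p \<in> ball z r \<Longrightarrow> beta f H e1 p \<noteq> 0" using r1 r2 by (auto simp: r_def)
  have eq: "dderiv e2 (beta g H e1) p = coef_m f p * dderiv e1 (beta g H e1) p + coef_n f p * beta g H e1 p"
    if "p \<in> S" for p
    using other.codazzi[OF that] by (simp add: coef_m_eq[OF that] coef_n_eq[OF that])
  obtain c where "cmod c = 1" "\<And>p. p \<in> ball z r \<Longrightarrow> beta g H e1 p = c * beta f H e1 p"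
    using elliptic_solution.ratio_constant[OF elliptic other.smooth_beta eq norm_beta_eq r(2,3,1)] by blast
  then show ?thesis using that[of r c] r phase_iff by blast
qed

text \<open>\<open>beta g - c beta f\<close> is a complex combination of solutions of the common
  equation; unique continuation carries the phase across umbilics.\<close>

lemma phase_continue:
  assumes R: "cball z R \<subseteq> S" and T: "open T" "z \<in> T" "\<And>q. q \<in> T \<Longrightarrow> q \<in> S \<Longrightarrow> chart_phase f g H c q"
    and q: "dist q z < R"
  shows "chart_phase f g H c q"
proof -
  define u where "u p = beta g H e1 p - c * beta f H e1 p" for p
  have su: "smooth_open S u"
    unfolding u_def[abs_def] by (intro smooth_open_diff smooth_open_mult smooth_open_const smooth_beta other.smooth_beta S)
  have d: "dderiv v u p = dderiv v (beta g H e1) p - c * dderiv v (beta f H e1) p" if "p \<in> S" for v p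
  proof -
    have "dderiv v u p = dderiv v (beta g H e1) p - dderiv v (\<lambda>p. c * beta f H e1 p) p"
      unfolding u_def[abs_def]
      by (intro dderiv_diff diff[OF _ that] smooth_open_mult smooth_open_const smooth_beta other.smooth_beta S)
    then show ?thesis
      by (simp add: dderiv_linear[OF bounded_linear_mult_right diff[OF smooth_beta that]])
  qed
  interpret e: elliptic_solution S "coef_m f" "coef_n f" u
  proof
    show "dderiv e2 u p = coef_m f p * dderiv e1 u p + coef_n f p * u p" if "p \<in> S" for p
      using codazzi[OF that] other.codazzi[OF that]
      by (simp add: d[OF that] coef_m_eq[OF that] coef_n_eq[OF that] u_def algebra_simps)
  qed (use S smooth_coef_m smooth_coef_n su Im_coef_m in \<open>auto simp: less_imp_neq\<close>)
  have "z \<in> cball z R" using q by simp (metis dist_not_less_zero less_le_trans linorder_not_less order.strict_implies_order)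
  then have "z \<in> T \<inter> S" using R T by blast
  moreover have "open (T \<inter> S)" using T S by blast
  moreover have "u p = 0" if "p \<in> T \<inter> S" for p using T(3)[of p] phase_iff[of p c] that by (simp add: u_def)
  ultimately have "u q = 0" using e.vanish_local[OF R _ _ _ q] by blast
  moreover have "q \<in> S" using R q by (auto simp: dist_commute)
  ultimately show ?thesis using phase_iff by (simp add: u_def)
qed

text \<open>The norms agree, so the umbilics of both surfaces coincide, and every \<open>c\<close>
  relates 0 to 0.\<close>

lemma phase_umbilic:
  assumes p: "p \<in> S" and 0: "dzeta f H e1 p = 0"
  shows "chart_phase f g H c p"
proof -
  have "dzeta f H e1 p \<bullet> frame1 f p = 0" "dzeta f H e1 p \<bullet> frame2 f p = 0" using 0 by simp_all
  then have "beta f H e1 p = 0"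
    unfolding dzeta_frame[OF p]
    by (simp add: inner_diff_left frame_inner[OF p] orthonormal_frame.inner[OF frame[OF p]] complex_eq_iff)
  then show ?thesis using norm_beta_eq[OF p] phase_iff[OF p] by simp
qed

text \<open>The connection forms agree, so the tangential rotations of the two frames cancel. Only
  the difference \<open>(c - 1) beta f\<close> of the normal components contributes.\<close>

lemma dderiv_rot:
  assumes p: "p \<in> S" and ph: "chart_phase f g H c p"
  shows "dderiv v (\<lambda>q. rot f g q w) p = rot f g p
    (cross3 (- Im c *\<^sub>R dzeta f H v p - (1 - Re c) *\<^sub>R cross3 (normal f p) (dzeta f H v p)) w)"
proof -
  note lin = rot_linear[OF p] and fr = orthonormal_frame.cross[OF frame[OF p]]
    and fr' = orthonormal_frame.cross[OF other.frame[OF p]]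
  define b where "b = beta f H v p"
  have b1: "beta g H e1 p = c * beta f H e1 p" using ph phase_iff[OF p] by simp
  then have b2: "beta g H e2 p = c * beta f H e2 p"
    using beta_conj_linear[OF p] other.beta_conj_linear[OF p] by (simp add: coef_m_eq[OF p])
  have "beta g H v p = c * b"
    using linear_forms(2)[OF p, of H v] other.linear_forms(2)[OF p, of H v] b1 b2 by (simp add: b_def algebra_simps)
  then have al: "alpha g v p = alpha f v p + (c * b - b)"
    by (simp add: beta_def b_def theta_eq[OF p] algebra_simps)
  have ka: "kappa g v p = kappa f v p"
    using linear_forms(3)[OF p, of v] other.linear_forms(3)[OF p, of v] kappa_eq[OF p] by simp
  have dd: "dderiv v (\<lambda>q. (w \<bullet> F q) *\<^sub>R G q) p = (w \<bullet> F p) *\<^sub>R dderiv v G p + (w \<bullet> dderiv v F p) *\<^sub>R G p"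
    if "smooth_open S F" "smooth_open S G" for F G :: "real^2 \<Rightarrow> real^3"
    using dderiv_scaleR[of "\<lambda>q. w \<bullet> F q" p G v] dderiv_linear[OF bounded_linear_inner_right diff[OF that(1) p], of v w]
      diff[OF that(2) p] diff[OF smooth_open_inner[OF S smooth_open_const that(1)] p] by simp
  have "dderiv v (\<lambda>q. rot f g q w) p = dderiv v (\<lambda>q. (w \<bullet> frame1 f q) *\<^sub>R frame1 g q) p
      + dderiv v (\<lambda>q. (w \<bullet> frame2 f q) *\<^sub>R frame2 g q) p + dderiv v (\<lambda>q. (w \<bullet> normal f q) *\<^sub>R normal g q) p"
    unfolding rot_def
    by (subst dderiv_add, (intro diff[OF _ p] smooth_open_add smooth_open_scaleR smooth_open_inner smooth_open_const
        smooth_frame1 smooth_frame2 smooth_normal other.smooth_frame1 other.smooth_frame2 other.smooth_normal S)+)+ (rule refl)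
  also have "\<dots> = (Re (c * b - b) * (w \<bullet> frame1 f p) + Im (c * b - b) * (w \<bullet> frame2 f p)) *\<^sub>R normal g p
      - (w \<bullet> normal f p) *\<^sub>R (Re (c * b - b) *\<^sub>R frame1 g p + Im (c * b - b) *\<^sub>R frame2 g p)"
    unfolding dd[OF smooth_frame1 other.smooth_frame1] dd[OF smooth_frame2 other.smooth_frame2] dd[OF smooth_normal other.smooth_normal]
      d_frame1[OF p] d_frame2[OF p] d_normal[OF p] other.d_frame1[OF p] other.d_frame2[OF p] other.d_normal[OF p] ka al
    by (simp add: inner_add_right inner_diff_right algebra_simps)
  finally have L: "dderiv v (\<lambda>q. rot f g q w) p = \<dots>" .
  have Om: "- Im c *\<^sub>R dzeta f H v p - (1 - Re c) *\<^sub>R cross3 (normal f p) (dzeta f H v p)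
      = Im (c * b - b) *\<^sub>R frame1 f p - Re (c * b - b) *\<^sub>R frame2 f p" (is "?O = _")
    unfolding dzeta_frame[OF p] b_def[symmetric]
    by (simp add: Cross3.right_diff_distrib cross_mult_right fr) (simp add: algebra_simps)
  have Rw: "rot f g p w = (w \<bullet> frame1 f p) *\<^sub>R frame1 g p + (w \<bullet> frame2 f p) *\<^sub>R frame2 g p + (w \<bullet> normal f p) *\<^sub>R normal g p"
    by (simp add: rot_def)
  have "rot f g p (cross3 ?O w) = cross3 (rot f g p ?O) (rot f g p w)" by (simp add: rot_cross[OF p])
  also have "rot f g p ?O = Im (c * b - b) *\<^sub>R frame1 g p - Re (c * b - b) *\<^sub>R frame2 g p"
    unfolding Om by (simp only: linear_diff[OF lin] linear_scale[OF lin] rot_frame1[OF p] rot_frame2[OF p])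
  also have "cross3 \<dots> (rot f g p w) = (Re (c * b - b) * (w \<bullet> frame1 f p) + Im (c * b - b) * (w \<bullet> frame2 f p)) *\<^sub>R normal g p
      - (w \<bullet> normal f p) *\<^sub>R (Re (c * b - b) *\<^sub>R frame1 g p + Im (c * b - b) *\<^sub>R frame2 g p)"
    unfolding Rw
    by (simp only: Cross3.left_diff_distrib cross_add_right cross_mult_left cross_mult_right fr' cross_refl)
       (simp add: algebra_simps)
  finally show ?thesis using L by simp
qed

end

section \<open>Immersions in charts\<close>

context chart_immersion
begin

text \<open>Together with \<open>d_inj\<close> this resolves the definite description in
  \<open>shape_operator\<close>. In the frame the linear system is triangular, because
  \<open>theta f e1\<close> is real.\<close>

lemma tangent_surj:
  assumes p: "p \<in> S" and z: "z \<bullet> normal f p = 0"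
  obtains v where "dderiv v f p = z"
proof -
  define s t where "s = norm (dderiv e1 f p)" and "t = theta f e2 p"
  have s: "s \<noteq> 0" "theta f e1 p = of_real s" "Im t \<noteq> 0"
    using d1_nz[OF p] Im_theta[OF p] by (auto simp: s_def t_def theta_e1[OF p])
  define v2 where "v2 = (z \<bullet> frame2 f p) / Im t"
  define v1 where "v1 = (z \<bullet> frame1 f p - v2 * Re t) / s"
  define v where "v = v1 *\<^sub>R e1 + v2 *\<^sub>R e2"
  have v: "v $ 1 = v1" "v $ 2 = v2" by (simp_all add: v_def axis_def)
  have "theta f v p = of_real v1 * of_real s + of_real v2 * t"
    using linear_forms(1)[OF p, of v] by (simp add: v s t_def)
  then have "Re (theta f v p) = z \<bullet> frame1 f p" "Im (theta f v p) = z \<bullet> frame2 f p"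
    using s by (simp_all add: v1_def v2_def)
  then have "dderiv v f p = z"
    unfolding d_f[OF p] using orthonormal_frame.expand[OF frame[OF p], of z] z by simp
  then show ?thesis by (rule that)
qed

lemma d_inj:
  assumes p: "p \<in> S" and eq: "dderiv v f p = dderiv w f p"
  shows "v = w"
proof -
  have "theta f v p = theta f w p" using eq by (simp add: theta_def)
  then have "of_real (v $ 1 - w $ 1) * theta f e1 p + of_real (v $ 2 - w $ 2) * theta f e2 p = 0"
    using linear_forms(1)[OF p, of v] linear_forms(1)[OF p, of w] by (simp add: algebra_simps)
  then have 1: "Im (of_real (v $ 1 - w $ 1) * theta f e1 p + of_real (v $ 2 - w $ 2) * theta f e2 p) = 0"
    and 2: "Re (of_real (v $ 1 - w $ 1) * theta f e1 p + of_real (v $ 2 - w $ 2) * theta f e2 p) = 0"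
    by simp_all
  have "v $ 2 = w $ 2" using 1 Im_theta[OF p] by (simp add: theta_e1[OF p])
  moreover from this have "v $ 1 = w $ 1" using 2 d1_nz[OF p] by (simp add: theta_e1[OF p])
  ultimately show ?thesis by (simp add: vec_eq_iff forall_2)
qed

end

text \<open>The symmetrized product of \<open>n\<close> and \<open>f\<close> is an alternating
  2-form on the plane, so a change of basis multiplies it by the determinant. The case
  \<open>n = f\<close> serves the normal, the general case the mean curvature.\<close>

lemma cross_linear_det:
  fixes f n :: "real^2 \<Rightarrow> real^3"
  assumes f: "linear f" and n: "linear n" and T: "linear T"
  shows "cross3 (n (T e1)) (f (T e2)) + cross3 (f (T e1)) (n (T e2))
    = det (matrix T) *\<^sub>R (cross3 (n e1) (f e2) + cross3 (f e1) (n e2))"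
proof -
  have ex: "g (T v) = (T v $ 1) *\<^sub>R g e1 + (T v $ 2) *\<^sub>R g e2" if "linear g" for v and g :: "real^2 \<Rightarrow> real^3"
  proof -
    have "T v = (T v $ 1) *\<^sub>R e1 + (T v $ 2) *\<^sub>R e2" by (simp add: vec_eq_iff forall_2 axis_def)
    then have "g (T v) = g ((T v $ 1) *\<^sub>R e1 + (T v $ 2) *\<^sub>R e2)" by simp
    then show ?thesis by (simp only: linear_add[OF that] linear_scale[OF that])
  qed
  have d: "det (matrix T) = T e1 $ 1 * T e2 $ 2 - T e2 $ 1 * T e1 $ 2"
    by (simp add: det_2 matrix_def)
  define a where "a = cross3 (n e1) (f e2)"
  define b where "b = cross3 (f e1) (n e2)"
  define c where "c = cross3 (n e1) (f e1)"
  define e where "e = cross3 (n e2) (f e2)"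
  have sk2: "cross3 (f e1) (n e1) = - c" "cross3 (f e2) (n e2) = - e" "cross3 (f e2) (n e1) = - a" "cross3 (n e2) (f e1) = - b"
    unfolding c_def e_def a_def b_def by (rule cross_skew)+
  show ?thesis
    unfolding ex[OF f] ex[OF n] d cross_add_left cross_add_right cross_mult_left cross_mult_right sk2
      a_def[symmetric] b_def[symmetric] c_def[symmetric] e_def[symmetric]
    by (simp add: algebra_simps)
qed

definition loc :: "'m chart \<Rightarrow> ('m \<Rightarrow> 'b) \<Rightarrow> real^2 \<Rightarrow> 'b" where
  "loc k F = F \<circ> inv_into (fst k) (snd k)"

definition cdom :: "'m chart \<Rightarrow> (real^2) set" where
  "cdom k = snd k ` fst k"

locale atlas =
  fixes \<A> :: "'m::topological_space chart set"
  assumes atlas: "oriented_smooth_atlas \<A>"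
begin

lemma chart:
  assumes "k \<in> \<A>"
  shows open_chart: "open (fst k)" and open_cdom: "open (cdom k)"
    and chart_homeo: "homeomorphism (fst k) (cdom k) (snd k) (inv_into (fst k) (snd k))"
proof -
  have "\<forall>(U, \<phi>)\<in>\<A>. open U \<and> open (\<phi> ` U) \<and> homeomorphism U (\<phi> ` U) \<phi> (inv_into U \<phi>)"
    using atlas unfolding oriented_smooth_atlas_def by (rule conjunct1)
  from bspec[OF this assms] show "open (fst k)" "open (cdom k)"
    "homeomorphism (fst k) (cdom k) (snd k) (inv_into (fst k) (snd k))"
    unfolding cdom_def by (simp_all only: split_beta)
qed

lemma chart_inv: "k \<in> \<A> \<Longrightarrow> p \<in> fst k \<Longrightarrow> inv_into (fst k) (snd k) (snd k p) = p"
  by (rule homeomorphism_apply1[OF chart_homeo])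

lemma chart_mem: "p \<in> fst k \<Longrightarrow> snd k p \<in> cdom k"
  by (simp add: cdom_def)

lemma cdomE:
  assumes "k \<in> \<A>" "u \<in> cdom k"
  obtains p where "p \<in> fst k" "u = snd k p" "inv_into (fst k) (snd k) u = p"
proof -
  obtain p where p: "p \<in> fst k" "u = snd k p" using assms(2) by (auto simp: cdom_def)
  then show ?thesis using that[of p] chart_inv[OF assms(1) p(1)] by simp
qed

lemma loc_apply: "k \<in> \<A> \<Longrightarrow> p \<in> fst k \<Longrightarrow> loc k F (snd k p) = F p"
  by (simp add: loc_def chart_inv)

lemma chart_at: "chart_at \<A> p \<in> \<A>" "p \<in> fst (chart_at \<A> p)"
proof -
  have "p \<in> (\<Union>(U, \<phi>)\<in>\<A>. U)" using atlas by (simp add: oriented_smooth_atlas_def)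
  then obtain c where "c \<in> \<A>" "p \<in> (case c of (U, \<phi>) \<Rightarrow> U)" by (rule UN_E)
  then have "\<exists>c. c \<in> \<A> \<and> p \<in> fst c" by (intro exI[of _ c]) (simp add: split_beta)
  from someI_ex[OF this] show "chart_at \<A> p \<in> \<A>" "p \<in> fst (chart_at \<A> p)"
    by (simp_all add: chart_at_def)
qed

lemma differential_loc: "differential \<A> F p v = dderiv v (loc (chart_at \<A> p) F) (snd (chart_at \<A> p) p)"
  by (simp add: differential_def dderiv_def loc_def split_beta)

lemma smooth_loc: "smooth_map \<A> F \<Longrightarrow> k \<in> \<A> \<Longrightarrow> smooth_open (cdom k) (loc k F)"
  unfolding smooth_map_def cdom_def loc_def by (drule (1) bspec) (simp only: split_beta)

lemma smooth_mapI:
  assumes "\<And>k. k \<in> \<A> \<Longrightarrow> smooth_open (cdom k) (loc k F)"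
  shows "smooth_map \<A> F"
  unfolding smooth_map_def
proof (rule ballI, rule case_prodI2)
  fix k U \<phi> assume "k \<in> \<A>" "k = (U, \<phi>)"
  then show "smooth_open (\<phi> ` U) (F \<circ> inv_into U \<phi>)"
    using assms[of k] by (simp add: cdom_def loc_def)
qed

lemma chart_nbhd:
  assumes k: "k \<in> \<A>" and "p \<in> fst k" and V: "open V" "snd k p \<in> V"
  obtains W where "open W" "p \<in> W" "W \<subseteq> fst k" "\<And>q. q \<in> W \<Longrightarrow> snd k q \<in> V"
proof
  have c: "continuous_on (fst k) (snd k)" using chart_homeo[OF k] by (simp add: homeomorphism_def)
  show "open (fst k \<inter> snd k -` V)" by (rule continuous_open_preimage[OF c open_chart[OF k] V(1)])
qed (use assms in auto)

lemma chart_image_open: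
  assumes k: "k \<in> \<A>" and W: "open W"
  shows "open (snd k ` (fst k \<inter> W))"
proof -
  have "openin (top_of_set (fst k)) (fst k \<inter> W)" using W by (rule openin_open_Int)
  then have "openin (top_of_set (cdom k)) (snd k ` (fst k \<inter> W))"
    by (rule homeomorphism_imp_open_map[OF chart_homeo[OF k]])
  then show ?thesis by (simp only: openin_open_eq[OF open_cdom[OF k]])
qed

definition transition :: "'m chart \<Rightarrow> 'm chart \<Rightarrow> 'm \<Rightarrow> real^2 \<Rightarrow> real^2" where
  "transition k l p = frechet_derivative (snd l \<circ> inv_into (fst k) (snd k)) (at (snd k p))"

lemma transition:
  assumes k: "k \<in> \<A>" "p \<in> fst k" and l: "l \<in> \<A>" "p \<in> fst l"
  shows transition_linear: "linear (transition k l p)"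
    and transition_det: "det (matrix (transition k l p)) > 0"
    and dderiv_transition: "loc l F differentiable (at (snd l p)) \<Longrightarrow>
      dderiv v (loc k F) (snd k p) = dderiv (transition k l p v) (loc l F) (snd l p)"
proof -
  define \<tau> where "\<tau> = snd l \<circ> inv_into (fst k) (snd k)"
  have "\<forall>(U, \<phi>)\<in>\<A>. \<forall>(W, \<psi>)\<in>\<A>.
        smooth_open (\<phi> ` (U \<inter> W)) (\<psi> \<circ> inv_into U \<phi>) \<and>
        (\<forall>u\<in>\<phi> ` (U \<inter> W). det (matrix (frechet_derivative (\<psi> \<circ> inv_into U \<phi>) (at u))) > 0)"
    using atlas unfolding oriented_smooth_atlas_def by blast
  from bspec[OF bspec[OF this k(1), unfolded split_beta] l(1), unfolded split_beta] have at: "smooth_open (snd k ` (fst k \<inter> fst l)) \<tau>"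
    "\<forall>u\<in>snd k ` (fst k \<inter> fst l). det (matrix (frechet_derivative \<tau> (at u))) > 0"
    unfolding \<tau>_def by blast+
  have o: "open (snd k ` (fst k \<inter> fst l))" by (rule chart_image_open[OF k(1) open_chart[OF l(1)]])
  have u: "snd k p \<in> snd k ` (fst k \<inter> fst l)" using k l by blast
  have d: "\<tau> differentiable (at (snd k p))" by (rule smooth_open_differentiable[OF at(1) u])
  then show "linear (transition k l p)"
    unfolding transition_def \<tau>_def[symmetric] by (rule linear_frechet_derivative)
  show "det (matrix (transition k l p)) > 0"
    using bspec[OF at(2) u] by (simp add: transition_def \<tau>_def[symmetric])
  assume dl: "loc l F differentiable (at (snd l p))"
  have \<tau>p: "\<tau> (snd k p) = snd l p" using k by (simp add: \<tau>_def chart_inv)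
  have "dderiv v (loc k F) (snd k p) = dderiv v (loc l F \<circ> \<tau>) (snd k p)"
  proof (rule dderiv_cong_open[OF o u])
    fix u assume "u \<in> snd k ` (fst k \<inter> fst l)"
    then obtain q where "q \<in> fst k" "q \<in> fst l" "u = snd k q" by blast
    then show "loc k F u = (loc l F \<circ> \<tau>) u" by (simp add: \<tau>_def loc_def chart_inv[OF k(1)] chart_inv[OF l(1)])
  qed
  also have "\<dots> = dderiv (transition k l p v) (loc l F) (snd l p)"
    unfolding dderiv_def transition_def \<tau>_def[symmetric]
    using frechet_derivative_compose[OF d dl[folded \<tau>p]] by (simp add: \<tau>p)
  finally show "dderiv v (loc k F) (snd k p) = dderiv (transition k l p v) (loc l F) (snd l p)" .
qed

end

locale immersed = atlas \<A> for \<A> :: "'m::topological_space chart set" +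
  fixes x :: "'m \<Rightarrow> real^3"
  assumes immersion: "immersion \<A> x"
begin

lemma smooth_x: "smooth_map \<A> x"
  using immersion by (simp add: immersion_def)

lemma diff_loc: "k \<in> \<A> \<Longrightarrow> p \<in> fst k \<Longrightarrow> loc k x differentiable (at (snd k p))"
  by (rule smooth_open_differentiable[OF smooth_loc[OF smooth_x] chart_mem])

lemma cross_chart_at:
  "cross3 (dderiv e1 (loc (chart_at \<A> p) x) (snd (chart_at \<A> p) p)) (dderiv e2 (loc (chart_at \<A> p) x) (snd (chart_at \<A> p) p)) \<noteq> 0"
proof
  define D where "D = (\<lambda>v. dderiv v (loc (chart_at \<A> p) x) (snd (chart_at \<A> p) p))"
  assume 0: "cross3 (dderiv e1 (loc (chart_at \<A> p) x) (snd (chart_at \<A> p) p)) (dderiv e2 (loc (chart_at \<A> p) x) (snd (chart_at \<A> p) p)) = 0"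
  have lin: "linear D" unfolding D_def by (rule linear_dderiv[OF diff_loc[OF chart_at]])
  have "differential \<A> x p = D" by (rule ext) (simp only: D_def differential_loc)
  then have inj: "inj D" using immersion unfolding immersion_def by metis
  \<comment> \<open>The double product also vanishes and expands to a combination of
    \<open>D e1\<close> and \<open>D e2\<close>. By injectivity its coefficient
    \<open>D e1 \<bullet> D e1\<close> is 0, so \<open>D e1 = 0\<close>, against
    injectivity.\<close>
  have "(D e1 \<bullet> D e2) *\<^sub>R D e1 - (D e1 \<bullet> D e1) *\<^sub>R D e2 = cross3 (D e1) (cross3 (D e1) (D e2))"
    by (simp add: cross3_triple)
  also have "\<dots> = 0" using 0 by (simp add: D_def)
  finally have "D ((D e1 \<bullet> D e2) *\<^sub>R e1 - (D e1 \<bullet> D e1) *\<^sub>R e2) = D 0"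
    by (simp add: linear_diff[OF lin] linear_scale[OF lin] linear_0[OF lin])
  from injD[OF inj this] have "(D e1 \<bullet> D e2) *\<^sub>R e1 - (D e1 \<bullet> D e1) *\<^sub>R e2 = 0" .
  then have "((D e1 \<bullet> D e2) *\<^sub>R e1 - (D e1 \<bullet> D e1) *\<^sub>R e2) $ 2 = 0" by simp
  then have "D e1 = 0" by (simp add: axis_def)
  then have "D e1 = D 0" by (simp add: linear_0[OF lin])
  from injD[OF inj this] have "e1 = 0" .
  then show False by (simp add: axis_eq_0_iff)
qed

lemma cross_chart:
  assumes k: "k \<in> \<A>" "p \<in> fst k" and l: "l \<in> \<A>" "p \<in> fst l"
  shows "cross3 (dderiv e1 (loc k x) (snd k p)) (dderiv e2 (loc k x) (snd k p))
    = det (matrix (transition k l p)) *\<^sub>R cross3 (dderiv e1 (loc l x) (snd l p)) (dderiv e2 (loc l x) (snd l p))"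
proof -
  note tr = dderiv_transition[OF k l diff_loc[OF l]]
  have lin: "linear (\<lambda>v. dderiv v (loc l x) (snd l p))" by (rule linear_dderiv[OF diff_loc[OF l]])
  \<comment> \<open>\<open>cross_linear_det\<close> with two equal maps yields twice the
    claim.\<close>
  have half: "a = d *\<^sub>R b" if "a + a = d *\<^sub>R (b + b)" for a b :: "real^3" and d
  proof -
    have "2 *\<^sub>R (a - d *\<^sub>R b) = (a + a) - d *\<^sub>R (b + b)"
      by (simp only: scaleR_2 scaleR_add_right add_diff_add)
    also have "\<dots> = 0" unfolding that by (rule diff_self)
    finally show ?thesis by simp
  qed
  show ?thesis by (rule half) (use cross_linear_det[OF lin lin transition_linear[OF k l]] in \<open>simp only: tr\<close>)
qed

lemma chart_immersion: "k \<in> \<A> \<Longrightarrow> chart_immersion (cdom k) (loc k x)"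
proof
  assume k: "k \<in> \<A>"
  show "open (cdom k)" by (rule open_cdom[OF k])
  show "smooth_open (cdom k) (loc k x)" by (rule smooth_loc[OF smooth_x k])
  fix u assume "u \<in> cdom k"
  then obtain p where p: "p \<in> fst k" "u = snd k p" using cdomE[OF k] by metis
  show "cross3 (dderiv e1 (loc k x) u) (dderiv e2 (loc k x) u) \<noteq> 0"
    using cross_chart[OF k p(1) chart_at] transition_det[OF k p(1) chart_at] cross_chart_at[of p] p(2) by simp
qed

text \<open>The orientation of the atlas enters here: the two cross products differ by a positive
  factor.\<close>

lemma normal_chart:
  assumes k: "k \<in> \<A>" "p \<in> fst k" and l: "l \<in> \<A>" "p \<in> fst l"
  shows "normal (loc k x) (snd k p) = normal (loc l x) (snd l p)"
  using cross_chart[OF assms] transition_det[OF assms] by (simp add: normal_def sgn_scaleR)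

lemma unit_normal_chart: "k \<in> \<A> \<Longrightarrow> p \<in> fst k \<Longrightarrow> unit_normal \<A> x p = normal (loc k x) (snd k p)"
  using normal_chart[OF _ _ chart_at] by (simp add: unit_normal_def differential_loc normal_def)

lemma loc_unit_normal: "k \<in> \<A> \<Longrightarrow> u \<in> cdom k \<Longrightarrow> loc k (unit_normal \<A> x) u = normal (loc k x) u"
  by (metis cdomE loc_apply unit_normal_chart)

lemma smooth_unit_normal: "smooth_map \<A> (unit_normal \<A> x)"
proof (rule smooth_mapI)
  fix k assume k: "k \<in> \<A>"
  show "smooth_open (cdom k) (loc k (unit_normal \<A> x))"
    by (rule smooth_open_cong[OF open_cdom[OF k] chart_immersion.smooth_normal[OF chart_immersion[OF k]]])
       (simp add: loc_unit_normal[OF k])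
qed

lemma dderiv_unit_normal:
  assumes k: "k \<in> \<A>" "p \<in> fst k"
  shows "dderiv v (loc k (unit_normal \<A> x)) (snd k p) = dderiv v (normal (loc k x)) (snd k p)"
  by (rule dderiv_cong_open[OF open_cdom[OF k(1)] chart_mem[OF k(2)] loc_unit_normal[OF k(1)]])

lemma dderiv_normal_transition:
  assumes k: "k \<in> \<A>" "p \<in> fst k" and l: "l \<in> \<A>" "p \<in> fst l"
  shows "dderiv v (normal (loc k x)) (snd k p) = dderiv (transition k l p v) (normal (loc l x)) (snd l p)"
  using dderiv_transition[OF assms smooth_open_differentiable[OF smooth_loc[OF smooth_unit_normal l(1)] chart_mem[OF l(2)]]]
  by (simp add: dderiv_unit_normal k l)

text \<open>Replaces the shape operator, with its definite description, by an equation between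
  derivatives whose behaviour under coordinate changes is known from
  \<open>cross_linear_det\<close>.\<close>

lemma mean_curvature_iff:
  fixes p
  defines "l \<equiv> chart_at \<A> p"
  defines "f \<equiv> loc l x" and "u \<equiv> snd l p"
  shows "mean_curvature \<A> x p = H \<longleftrightarrow>
    cross3 (dderiv e1 (normal f) u) (dderiv e2 f u) + cross3 (dderiv e1 f u) (dderiv e2 (normal f) u)
      = (- 2 * H) *\<^sub>R cross3 (dderiv e1 f u) (dderiv e2 f u)"
proof -
  have l: "l \<in> \<A>" "p \<in> fst l" by (simp_all add: l_def chart_at)
  interpret c: chart_immersion "cdom l" f unfolding f_def by (rule chart_immersion[OF l(1)])
  have u: "u \<in> cdom l" unfolding u_def by (rule chart_mem[OF l(2)])
  have dN: "differential \<A> (unit_normal \<A> x) p v = dderiv v (normal f) u" for v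
    using dderiv_unit_normal[OF l] by (simp add: differential_loc l_def f_def u_def)
  have df: "differential \<A> x p v = dderiv v f u" for v
    by (simp add: differential_loc l_def f_def u_def)
  define T where "T = shape_operator \<A> x p"
  have T: "dderiv v (normal f) u = - dderiv (T v) f u" for v
  proof -
    have "- dderiv v (normal f) u \<bullet> normal f u = 0"
      by (simp add: c.d_normal[OF u] inner_diff_left inner_add_left c.frame_inner[OF u] orthonormal_frame.inner[OF c.frame[OF u]])
    then obtain w where w: "dderiv w f u = - dderiv v (normal f) u" using c.tangent_surj[OF u] by metis
    have "\<exists>!w. dderiv v (normal f) u = - dderiv w f u"
    proof
      show "dderiv v (normal f) u = - dderiv w f u" by (simp add: w)
    next
      fix w' assume "dderiv v (normal f) u = - dderiv w' f u"
      then show "w' = w" using w by (intro c.d_inj[OF u]) simp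
    qed
    from theI'[OF this] show ?thesis by (simp add: T_def shape_operator_def dN df)
  qed
  have ex: "dderiv (T v) f u = (T v $ 1) *\<^sub>R dderiv e1 f u + (T v $ 2) *\<^sub>R dderiv e2 f u" for v
    by (rule dderiv_expand2[OF c.diff[OF c.f u]])
  have tr: "mean_curvature \<A> x p = (T e1 $ 1 + T e2 $ 2) / 2"
    by (simp add: mean_curvature_def T_def[symmetric] trace_def matrix_def sum_2)
  have key: "cross3 (dderiv e1 (normal f) u) (dderiv e2 f u) + cross3 (dderiv e1 f u) (dderiv e2 (normal f) u)
    = - (T e1 $ 1 + T e2 $ 2) *\<^sub>R cross3 (dderiv e1 f u) (dderiv e2 f u)"
    unfolding T ex
    by (simp only: cross_minus_left cross_minus_right cross_add_left cross_add_right cross_mult_left cross_mult_right cross_refl)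
       (simp add: algebra_simps)
  show ?thesis unfolding key tr scaleR_cancel_right using c.imm[OF u] by auto
qed

end

lemma dzeta_linear:
  assumes "f differentiable (at p)" "normal f differentiable (at p)"
  shows "dzeta f H v p = dderiv v (\<lambda>q. normal f q + H *\<^sub>R f q) p"
proof -
  have "(\<lambda>q. H *\<^sub>R f q) differentiable (at p)" using assms by (simp add: differentiable_scaleR)
  then have "dderiv v (\<lambda>q. normal f q + H *\<^sub>R f q) p = dderiv v (normal f) p + dderiv v (\<lambda>q. H *\<^sub>R f q) p"
    by (rule dderiv_add[OF assms(2)])
  then show ?thesis using dderiv_linear[OF bounded_linear_scaleR_right assms(1), of v H] by (simp add: dzeta_def)
qed

section \<open>Smooth maps and curves on the surface\<close>

context atlas
begin

lemma differential_add:
  assumes "smooth_map \<A> F" "smooth_map \<A> G"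
  shows "differential \<A> (\<lambda>p. F p + G p) p v = differential \<A> F p v + differential \<A> G p v"
proof -
  note d = smooth_open_differentiable[OF smooth_loc[OF _ chart_at(1)] chart_mem[OF chart_at(2)]]
  show ?thesis
    unfolding differential_loc using dderiv_add[OF d[OF assms(1)] d[OF assms(2)]]
    by (simp add: loc_def comp_def)
qed

lemma differential_linear:
  assumes "bounded_linear h" "smooth_map \<A> F"
  shows "differential \<A> (\<lambda>p. h (F p)) p v = h (differential \<A> F p v)"
proof -
  note d = smooth_open_differentiable[OF smooth_loc[OF _ chart_at(1)] chart_mem[OF chart_at(2)]]
  show ?thesis
    unfolding differential_loc using dderiv_linear[OF assms(1) d[OF assms(2)]]
    by (simp add: loc_def comp_def)
qed

lemma smooth_map_add:
  assumes "smooth_map \<A> F" "smooth_map \<A> G"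
  shows "smooth_map \<A> (\<lambda>p. F p + G p)"
proof (rule smooth_mapI)
  fix k assume k: "k \<in> \<A>"
  show "smooth_open (cdom k) (loc k (\<lambda>p. F p + G p))"
    using smooth_open_add[OF open_cdom[OF k] smooth_loc[OF assms(1) k] smooth_loc[OF assms(2) k]]
    by (simp add: loc_def comp_def)
qed

lemma smooth_map_linear:
  assumes "bounded_linear h" "smooth_map \<A> F"
  shows "smooth_map \<A> (\<lambda>p. h (F p))"
proof (rule smooth_mapI)
  fix k assume k: "k \<in> \<A>"
  show "smooth_open (cdom k) (loc k (\<lambda>p. h (F p)))"
    using smooth_open_linear[OF open_cdom[OF k] assms(1) smooth_loc[OF assms(2) k]]
    by (simp add: loc_def comp_def)
qed

lemma dderiv_loc_zero:
  assumes F: "smooth_map \<A> F" and 0: "\<And>p v. differential \<A> F p v = 0" and k: "k \<in> \<A>" "u \<in> cdom k"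
  shows "dderiv v (loc k F) u = 0"
proof -
  obtain p where p: "p \<in> fst k" "u = snd k p" using cdomE[OF k] by metis
  have "loc (chart_at \<A> p) F differentiable (at (snd (chart_at \<A> p) p))"
    by (rule smooth_open_differentiable[OF smooth_loc[OF F chart_at(1)] chart_mem[OF chart_at(2)]])
  from dderiv_transition[OF k(1) p(1) chart_at this] show ?thesis
    using 0 by (simp add: p(2) differential_loc)
qed

lemma constant_map:
  fixes F :: "'m \<Rightarrow> 'b::real_normed_vector"
  assumes conn: "connected (UNIV :: 'm set)" and F: "smooth_map \<A> F"
    and 0: "\<And>p v. differential \<A> F p v = 0"
  shows "F p = F q"
proof (rule connected_local_const[OF conn, of p q])
  show "\<forall>a\<in>UNIV. \<forall>\<^sub>F b in at a within UNIV. F a = F b"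
  proof
    fix a :: 'm
    define k where "k = chart_at \<A> a"
    have k: "k \<in> \<A>" "a \<in> fst k" by (simp_all add: k_def chart_at)
    obtain r where r: "r > 0" "ball (snd k a) r \<subseteq> cdom k"
      using openE[OF open_cdom[OF k(1)] chart_mem[OF k(2)]] by metis
    have "(loc k F has_derivative (\<lambda>v. 0)) (at u within ball (snd k a) r)" if "u \<in> ball (snd k a) r" for u
    proof -
      have u: "u \<in> cdom k" using that r(2) by blast
      show ?thesis
        using smooth_open_has_derivative[OF smooth_loc[OF F k(1)] u]
        by (simp add: dderiv_loc_zero[OF F 0 k(1) u] has_derivative_at_withinI)
    qed
    then obtain c where c: "\<And>u. u \<in> ball (snd k a) r \<Longrightarrow> loc k F u = c"
      using has_derivative_zero_constant[OF convex_ball, of "snd k a" r "loc k F"] by blast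
    have a: "snd k a \<in> ball (snd k a) r" using r by simp
    obtain W where W: "open W" "a \<in> W" "W \<subseteq> fst k" "\<And>q. q \<in> W \<Longrightarrow> snd k q \<in> ball (snd k a) r"
      by (rule chart_nbhd[OF k open_ball a]) blast
    have "F b = c" if "b \<in> W" for b
      using c[OF W(4)[OF that]] loc_apply[OF k(1) subsetD[OF W(3) that], of F] by simp
    then have "F a = F b" if "b \<in> W" for b using W(2) that by simp
    then show "\<forall>\<^sub>F b in at a within UNIV. F a = F b"
      unfolding eventually_at_topological by (intro exI[of _ W]) (simp add: W(1,2))
  qed
qed auto

lemma curve_chart:
  assumes F: "smooth_map \<A> F" and g: "smooth_curve \<A> \<gamma>" and k: "k \<in> \<A>" "\<gamma> s \<in> fst k"
  shows "((\<lambda>s. F (\<gamma> s)) has_vector_derivative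
    dderiv (vector_derivative (snd k \<circ> \<gamma>) (at s)) (loc k F) (snd k (\<gamma> s))) (at s)"
    and "open (\<gamma> -` fst k)" and "smooth_open (\<gamma> -` fst k) (snd k \<circ> \<gamma>)"
proof -
  show o: "open (\<gamma> -` fst k)"
    using g open_chart[OF k(1)] unfolding smooth_curve_def by (auto intro: open_vimage)
  have "\<forall>(U, \<phi>)\<in>\<A>. smooth_open (\<gamma> -` U) (\<phi> \<circ> \<gamma>)" using g by (simp add: smooth_curve_def)
  from bspec[OF this k(1), unfolded split_beta] show sm: "smooth_open (\<gamma> -` fst k) (snd k \<circ> \<gamma>)" .
  have "(snd k \<circ> \<gamma>) differentiable (at s)" using smooth_open_differentiable[OF sm] k(2) by simp
  then have 1: "((snd k \<circ> \<gamma>) has_vector_derivative vector_derivative (snd k \<circ> \<gamma>) (at s)) (at s)"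
    by (simp add: vector_derivative_works)
  have d: "loc k F differentiable (at (snd k (\<gamma> s)))"
    by (rule smooth_open_differentiable[OF smooth_loc[OF F k(1)] chart_mem[OF k(2)]])
  have 2: "(loc k F has_derivative (\<lambda>v. dderiv v (loc k F) (snd k (\<gamma> s)))) (at ((snd k \<circ> \<gamma>) s))"
    using has_derivative_dderiv[OF d] by simp
  have "((\<lambda>s. loc k F ((snd k \<circ> \<gamma>) s)) has_derivative
     (\<lambda>h. h *\<^sub>R dderiv (vector_derivative (snd k \<circ> \<gamma>) (at s)) (loc k F) (snd k (\<gamma> s)))) (at s)"
    using has_derivative_compose[OF 1[unfolded has_vector_derivative_def] 2]
    by (simp add: dderiv_direction_scaleR[OF d])
  moreover have "loc k F ((snd k \<circ> \<gamma>) s') = F (\<gamma> s')" if "s' \<in> \<gamma> -` fst k" for s'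
    using that loc_apply[OF k(1)] by simp
  ultimately show "((\<lambda>s. F (\<gamma> s)) has_vector_derivative
    dderiv (vector_derivative (snd k \<circ> \<gamma>) (at s)) (loc k F) (snd k (\<gamma> s))) (at s)"
    unfolding has_vector_derivative_def using k(2) o
    by (elim has_derivative_transform_within_open) auto
qed

lemma curve_derivative:
  assumes "smooth_map \<A> F" "smooth_curve \<A> \<gamma>"
  shows "((\<lambda>s. F (\<gamma> s)) has_vector_derivative differential \<A> F (\<gamma> s) (velocity \<A> \<gamma> s)) (at s)"
  unfolding differential_loc velocity_def split_beta by (rule curve_chart(1)[OF assms chart_at])

text \<open>The chart selected by \<open>chart_at\<close> may jump along the curve, so velocity and
  differential need not be continuous separately. Their composite is the derivative of
  \<open>F \<circ> \<gamma>\<close>, which a single chart expresses continuously near each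
  parameter.\<close>

lemma curve_derivative_continuous:
  assumes F: "smooth_map \<A> F" and g: "smooth_curve \<A> \<gamma>"
  shows "continuous_on UNIV (\<lambda>s. differential \<A> F (\<gamma> s) (velocity \<A> \<gamma> s))"
proof -
  have "isCont (\<lambda>s. differential \<A> F (\<gamma> s) (velocity \<A> \<gamma> s)) s" for s
  proof -
    define k where "k = chart_at \<A> (\<gamma> s)"
    have k: "k \<in> \<A>" "\<gamma> s \<in> fst k" by (simp_all add: k_def chart_at)
    note c = curve_chart[OF F g k(1)]
    define T where "T = \<gamma> -` fst k"
    have T: "open T" "s \<in> T" "smooth_open T (snd k \<circ> \<gamma>)" using c(2,3)[of s] k(2) by (simp_all add: T_def)
    define v where "v = dderiv 1 (snd k \<circ> \<gamma>)"
    have v: "vector_derivative (snd k \<circ> \<gamma>) (at t) = v t" if "t \<in> T" for t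
      using frechet_derivative_eq_vector_derivative[OF smooth_open_differentiable[OF T(3) that]]
      by (simp add: v_def dderiv_def)
    have eq: "differential \<A> F (\<gamma> t) (velocity \<A> \<gamma> t)
      = v t $ 1 *\<^sub>R dderiv e1 (loc k F) ((snd k \<circ> \<gamma>) t) + v t $ 2 *\<^sub>R dderiv e2 (loc k F) ((snd k \<circ> \<gamma>) t)"
      if t: "t \<in> T" for t
    proof -
      have tk: "\<gamma> t \<in> fst k" using t by (simp add: T_def)
      have "differential \<A> F (\<gamma> t) (velocity \<A> \<gamma> t) = dderiv (v t) (loc k F) (snd k (\<gamma> t))"
        using vector_derivative_unique_at[OF curve_derivative[OF F g] c(1)[OF tk]] by (simp add: v[OF t])
      then show ?thesis
        using dderiv_expand2[OF smooth_open_differentiable[OF smooth_loc[OF F k(1)] chart_mem[OF tk]], of "v t"] by simp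
    qed
    have im: "(snd k \<circ> \<gamma>) ` T \<subseteq> cdom k" by (auto simp: T_def cdom_def)
    have cv: "continuous_on T v" unfolding v_def by (rule smooth_open_continuous_on[OF smooth_open_dderiv[OF T(3)]])
    have cd: "continuous_on T (\<lambda>t. dderiv e (loc k F) ((snd k \<circ> \<gamma>) t))" for e
      by (rule continuous_on_compose2[OF smooth_open_continuous_on[OF smooth_open_dderiv[OF smooth_loc[OF F k(1)]]]
            smooth_open_continuous_on[OF T(3)] im])
    have "continuous_on T (\<lambda>t. v t $ 1 *\<^sub>R dderiv e1 (loc k F) ((snd k \<circ> \<gamma>) t) + v t $ 2 *\<^sub>R dderiv e2 (loc k F) ((snd k \<circ> \<gamma>) t))"
      by (intro continuous_on_add continuous_on_scaleR cd continuous_on_component cv)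
    then have "continuous_on T (\<lambda>s. differential \<A> F (\<gamma> s) (velocity \<A> \<gamma> s))"
      by (rule continuous_on_eq) (rule eq[symmetric])
    then show ?thesis using T(1,2) by (simp add: continuous_on_eq_continuous_at)
  qed
  then show ?thesis by (simp add: continuous_on_eq_continuous_at)
qed

end

context immersed
begin

lemma
  shows unit_normal_unit: "unit_normal \<A> x p \<bullet> unit_normal \<A> x p = 1"
    and differential_tangent: "differential \<A> x p v \<bullet> unit_normal \<A> x p = 0"
    and differential_surj: "z \<bullet> unit_normal \<A> x p = 0 \<Longrightarrow> \<exists>v. differential \<A> x p v = z"
    and differential_unit_normal_tangent: "differential \<A> (unit_normal \<A> x) p v \<bullet> unit_normal \<A> x p = 0"
proof -
  define k where "k = chart_at \<A> p"
  have k: "k \<in> \<A>" "p \<in> fst k" by (simp_all add: k_def chart_at)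
  interpret c: chart_immersion "cdom k" "loc k x" by (rule chart_immersion[OF k(1)])
  note u = chart_mem[OF k(2)]
  have N: "unit_normal \<A> x p = normal (loc k x) (snd k p)" by (rule unit_normal_chart[OF k])
  have D: "differential \<A> x p v = dderiv v (loc k x) (snd k p)" for v by (simp add: differential_loc k_def)
  have DN: "differential \<A> (unit_normal \<A> x) p v = dderiv v (normal (loc k x)) (snd k p)"
    using dderiv_unit_normal[OF k] by (simp add: differential_loc k_def)
  show "unit_normal \<A> x p \<bullet> unit_normal \<A> x p = 1" unfolding N by (rule c.frame_inner(8)[OF u])
  show "differential \<A> x p v \<bullet> unit_normal \<A> x p = 0" unfolding N D by (rule c.d_tangent[OF u])
  show "z \<bullet> unit_normal \<A> x p = 0 \<Longrightarrow> \<exists>v. differential \<A> x p v = z" unfolding N D by (metis c.tangent_surj[OF u])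
  show "differential \<A> (unit_normal \<A> x) p v \<bullet> unit_normal \<A> x p = 0"
    unfolding N DN by (simp add: c.d_normal[OF u] inner_diff_left inner_add_left c.frame_inner[OF u])
qed

end

locale isometric_pair = immersed \<A> x + target: immersed \<A> y
  for \<A> :: "'m::topological_space chart set" and x y +
  assumes iso: "\<And>p. induced_metric \<A> y p = induced_metric \<A> x p"
begin

lemma chart_isometric: "k \<in> \<A> \<Longrightarrow> chart_isometric (cdom k) (loc k x) (loc k y)"
proof (intro chart_isometric.intro chart_isometric_axioms.intro chart_immersion target.chart_immersion)
  fix u v w assume k: "k \<in> \<A>" and "u \<in> cdom k"
  then obtain p where p: "p \<in> fst k" "u = snd k p" using cdomE by metis
  define l where "l = chart_at \<A> p"
  have l: "l \<in> \<A>" "p \<in> fst l" by (simp_all add: l_def chart_at)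
  have "differential \<A> y p a \<bullet> differential \<A> y p b = differential \<A> x p a \<bullet> differential \<A> x p b" for a b
    using iso[of p] by (simp add: induced_metric_def fun_eq_iff)
  then show "dderiv v (loc k y) u \<bullet> dderiv w (loc k y) u = dderiv v (loc k x) u \<bullet> dderiv w (loc k x) u"
    unfolding p(2) dderiv_transition[OF k p(1) l target.diff_loc[OF l]] dderiv_transition[OF k p(1) l diff_loc[OF l]]
    by (simp add: differential_loc l_def)
qed

definition Rot :: "'m \<Rightarrow> real^3 \<Rightarrow> real^3" where
  "Rot p = rot (loc (chart_at \<A> p) x) (loc (chart_at \<A> p) y) (snd (chart_at \<A> p) p)"

lemma Rot_linear: "linear (Rot p)"
  and Rot_inner: "Rot p v \<bullet> Rot p w = v \<bullet> w"
  and Rot_cross: "cross3 (Rot p v) (Rot p w) = Rot p (cross3 v w)"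
  using chart_isometric.rot_linear[OF chart_isometric[OF chart_at(1)] chart_mem[OF chart_at(2)]]
    chart_isometric.rot_inner[OF chart_isometric[OF chart_at(1)] chart_mem[OF chart_at(2)]]
    chart_isometric.rot_cross[OF chart_isometric[OF chart_at(1)] chart_mem[OF chart_at(2)]]
  by (simp_all add: Rot_def)

lemma Rot_normal: "Rot p (unit_normal \<A> x p) = unit_normal \<A> y p"
  and Rot_differential: "Rot p (differential \<A> x p v) = differential \<A> y p v"
  using chart_isometric.rot_normal[OF chart_isometric[OF chart_at(1)] chart_mem[OF chart_at(2)], of p]
    chart_isometric.rot_d[OF chart_isometric[OF chart_at(1)] chart_mem[OF chart_at(2)], of p v]
  by (simp_all add: Rot_def differential_loc unit_normal_chart[OF chart_at] target.unit_normal_chart[OF chart_at])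

text \<open>\<open>Rot\<close> is defined through a selected chart at each point; its smoothness
  requires one formula on a whole neighbourhood. \<open>rot_unique\<close> supplies it.\<close>

lemma Rot_chart:
  assumes k: "k \<in> \<A>" "p \<in> fst k"
  shows "Rot p = rot (loc k x) (loc k y) (snd k p)"
proof (rule chart_isometric.rot_unique[OF chart_isometric[OF k(1)] chart_mem[OF k(2)] Rot_linear])
  show "Rot p (dderiv v (loc k x) (snd k p)) = dderiv v (loc k y) (snd k p)" for v
    using dderiv_transition[OF k chart_at diff_loc[OF chart_at]] dderiv_transition[OF k chart_at target.diff_loc[OF chart_at]]
      Rot_differential[of p] by (simp add: differential_loc)
  show "Rot p (normal (loc k x) (snd k p)) = normal (loc k y) (snd k p)"
    using Rot_normal[of p] by (simp add: unit_normal_chart[OF k] target.unit_normal_chart[OF k])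
qed (simp add: Rot_cross)

lemma loc_Rot: "k \<in> \<A> \<Longrightarrow> u \<in> cdom k \<Longrightarrow> loc k (\<lambda>p. Rot p w) u = rot (loc k x) (loc k y) u w"
  by (metis Rot_chart cdomE loc_apply)

lemma smooth_Rot: "smooth_map \<A> (\<lambda>p. Rot p w)"
proof (rule smooth_mapI)
  fix k assume k: "k \<in> \<A>"
  show "smooth_open (cdom k) (loc k (\<lambda>p. Rot p w))"
    by (rule smooth_open_cong[OF open_cdom[OF k] chart_isometric.smooth_rot[OF chart_isometric[OF k]]])
       (simp add: loc_Rot[OF k])
qed

end

section \<open>The phase between two isometric immersions\<close>

lemma congruence_rigid:
  assumes g: "linear g" "\<And>v w. g v \<bullet> g w = v \<bullet> w" "\<And>v w. cross3 (g v) (g w) = g (cross3 v w)"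
  shows "congruence (\<lambda>q. g q + k)"
proof -
  have ot: "orthogonal_transformation g" using g(1,2) by (simp add: orthogonal_transformation_def)
  have m: "matrix g *v v = g v" for v using g(1) by (simp add: matrix_works)
  have om: "orthogonal_matrix (matrix g)" using ot by (simp add: orthogonal_transformation_matrix)
  \<comment> \<open>Every matrix satisfies
    \<open>M\<^sup>T (M e \<times> M f) = det M (e \<times> f)\<close>. Since \<open>g\<close>
    respects cross products and \<open>M\<^sup>T M = 1\<close>, the determinant must be 1.\<close>
  have "transpose (matrix g) *v (cross3 (matrix g *v e) (matrix g *v f)) = cross3 e f" for e f
    using om unfolding m g(3) orthogonal_matrix_def by (metis m matrix_vector_mul_assoc matrix_vector_mul_lid)
  from this[of "axis 1 1" "axis 2 1"]
  have "det (matrix g) *\<^sub>R cross3 (axis 1 1) (axis 2 1) = cross3 (axis 1 1) (axis 2 (1::real))"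
    unfolding cross_matrix_mult .
  then have "(det (matrix g) - 1) *\<^sub>R axis 3 (1::real) = (0 :: real^3)"
    by (simp add: cross_basis scaleR_diff_left)
  then have "det (matrix g) = 1" by (simp add: axis_eq_0_iff)
  moreover have "(\<lambda>q. g q + k - (g 0 + k)) = g" using g(1) by (simp add: linear_0 fun_eq_iff)
  moreover have "dist (g a + k) (g b + k) = dist a b" for a b
    using ot by (simp add: orthogonal_transformation_isometry dist_norm)
  ultimately show ?thesis by (simp add: congruence_def)
qed

text \<open>The link between force and phase: for mean curvature \<open>H\<close> the force form is
  \<open>zeta \<times> dx\<close>, and the differential of \<open>zeta\<close> carries the
  trace-free part of the shape operator.\<close>

definition zeta :: "'m chart set \<Rightarrow> ('m \<Rightarrow> real^3) \<Rightarrow> real \<Rightarrow> 'm \<Rightarrow> real^3" where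
  "zeta \<A> x H p = unit_normal \<A> x p + H *\<^sub>R x p"

context immersed
begin

lemma smooth_zeta: "smooth_map \<A> (zeta \<A> x H)"
  using smooth_map_add[OF smooth_unit_normal smooth_map_linear[OF bounded_linear_scaleR_right smooth_x]]
  by (simp add: zeta_def[abs_def])

lemma differential_zeta:
  "differential \<A> (zeta \<A> x H) p v = differential \<A> (unit_normal \<A> x) p v + H *\<^sub>R differential \<A> x p v"
  using differential_add[OF smooth_unit_normal smooth_map_linear[OF bounded_linear_scaleR_right smooth_x]]
    differential_linear[OF bounded_linear_scaleR_right smooth_x]
  by (simp add: zeta_def[abs_def])

lemma dderiv_zeta:
  assumes k: "k \<in> \<A>" "p \<in> fst k"
  shows "dderiv v (loc k (zeta \<A> x H)) (snd k p) = dzeta (loc k x) H v (snd k p)"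
proof -
  interpret c: chart_immersion "cdom k" "loc k x" by (rule chart_immersion[OF k(1)])
  note u = chart_mem[OF k(2)]
  have "dderiv v (loc k (zeta \<A> x H)) (snd k p) = dderiv v (\<lambda>q. normal (loc k x) q + H *\<^sub>R loc k x q) (snd k p)"
    by (rule dderiv_cong_open[OF c.S u])
       (simp add: zeta_def loc_unit_normal[OF k(1), symmetric], simp add: loc_def zeta_def)
  then show ?thesis using dzeta_linear[OF c.diff[OF c.f u] c.diff[OF c.smooth_normal u]] by simp
qed

lemma differential_zeta_tangent: "differential \<A> (zeta \<A> x H) p v \<bullet> unit_normal \<A> x p = 0"
  by (simp add: differential_zeta inner_add_left differential_tangent differential_unit_normal_tangent)

lemma chart_cmc:
  assumes H: "constant_mean_curvature \<A> x H" and k: "k \<in> \<A>"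
  shows "chart_cmc (cdom k) (loc k x) H"
proof (intro chart_cmc.intro chart_cmc_axioms.intro chart_immersion k)
  fix u assume "u \<in> cdom k"
  then obtain p where p: "p \<in> fst k" "u = snd k p" using cdomE[OF k] by metis
  define l where "l = chart_at \<A> p"
  have l: "l \<in> \<A>" "p \<in> fst l" by (simp_all add: l_def chart_at)
  interpret c: chart_immersion "cdom l" "loc l x" by (rule chart_immersion[OF l(1)])
  note ul = chart_mem[OF l(2)]
  have lin: "linear (\<lambda>v. dderiv v (loc l x) (snd l p))" "linear (\<lambda>v. dderiv v (normal (loc l x)) (snd l p))"
    by (rule linear_dderiv[OF c.diff[OF c.f ul]], rule linear_dderiv[OF c.diff[OF c.smooth_normal ul]])
  have "mean_curvature \<A> x p = H" using H by (simp add: constant_mean_curvature_def)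
  then have mc: "cross3 (dderiv e1 (normal (loc l x)) (snd l p)) (dderiv e2 (loc l x) (snd l p))
      + cross3 (dderiv e1 (loc l x) (snd l p)) (dderiv e2 (normal (loc l x)) (snd l p))
      = (- 2 * H) *\<^sub>R cross3 (dderiv e1 (loc l x) (snd l p)) (dderiv e2 (loc l x) (snd l p))"
    by (simp only: mean_curvature_iff l_def)
  show "cross3 (dderiv e1 (normal (loc k x)) u) (dderiv e2 (loc k x) u) + cross3 (dderiv e1 (loc k x) u) (dderiv e2 (normal (loc k x)) u)
      = (- 2 * H) *\<^sub>R cross3 (dderiv e1 (loc k x) u) (dderiv e2 (loc k x) u)"
    unfolding p(2) cross_chart[OF k p(1) l] dderiv_normal_transition[OF k p(1) l] dderiv_transition[OF k p(1) l diff_loc[OF l]]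
      cross_linear_det[OF lin transition_linear[OF k p(1) l]] mc
    unfolding cross_chart[OF k p(1) l, unfolded dderiv_transition[OF k p(1) l diff_loc[OF l]]]
    by simp
qed

end

locale cmc_pair = isometric_pair +
  fixes H
  assumes Hx: "constant_mean_curvature \<A> x H" and Hy: "constant_mean_curvature \<A> y H"
begin

lemma chart_pair: "k \<in> \<A> \<Longrightarrow> chart_pair (cdom k) (loc k x) (loc k y) H"
  by (intro chart_pair.intro chart_isometric chart_cmc target.chart_cmc Hx Hy)

definition phase :: "complex \<Rightarrow> 'a \<Rightarrow> bool" where
  "phase c p \<longleftrightarrow> (\<forall>v. differential \<A> (zeta \<A> y H) p v =
     Rot p (Re c *\<^sub>R differential \<A> (zeta \<A> x H) p v
       + Im c *\<^sub>R cross3 (unit_normal \<A> x p) (differential \<A> (zeta \<A> x H) p v)))"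

lemma phase_chart:
  assumes k: "k \<in> \<A>" "p \<in> fst k"
  shows "phase c p \<longleftrightarrow> chart_phase (loc k x) (loc k y) H c (snd k p)"
proof -
  define l where "l = chart_at \<A> p"
  have l: "l \<in> \<A>" "p \<in> fst l" by (simp_all add: l_def chart_at)
  have d: "loc j (zeta \<A> x H) differentiable (at (snd j p))" "loc j (zeta \<A> y H) differentiable (at (snd j p))"
    if "j \<in> \<A>" "p \<in> fst j" for j
    by (rule smooth_open_differentiable[OF smooth_loc[OF smooth_zeta that(1)] chart_mem[OF that(2)]],
        rule smooth_open_differentiable[OF smooth_loc[OF target.smooth_zeta that(1)] chart_mem[OF that(2)]])
  have 1: "dzeta (loc k x) H v (snd k p) = differential \<A> (zeta \<A> x H) p (transition k l p v)"
    "dzeta (loc k y) H v (snd k p) = differential \<A> (zeta \<A> y H) p (transition k l p v)" for v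
    using dderiv_transition[OF k l d(1)[OF l]] dderiv_transition[OF k l d(2)[OF l]]
    by (simp_all add: dderiv_zeta[OF k] target.dderiv_zeta[OF k] differential_loc l_def)
  have 2: "differential \<A> (zeta \<A> x H) p v = dzeta (loc k x) H (transition l k p v) (snd k p)"
    "differential \<A> (zeta \<A> y H) p v = dzeta (loc k y) H (transition l k p v) (snd k p)" for v
    using dderiv_transition[OF l k d(1)[OF k]] dderiv_transition[OF l k d(2)[OF k]]
    by (simp_all add: dderiv_zeta[OF k] target.dderiv_zeta[OF k] differential_loc l_def)
  show ?thesis
  proof
    assume "phase c p"
    then show "chart_phase (loc k x) (loc k y) H c (snd k p)"
      unfolding phase_def chart_phase_def 1 Rot_chart[OF k, symmetric] unit_normal_chart[OF k, symmetric] by blast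
  next
    assume "chart_phase (loc k x) (loc k y) H c (snd k p)"
    then show "phase c p"
      unfolding phase_def chart_phase_def 2 Rot_chart[OF k] unit_normal_chart[OF k] by blast
  qed
qed

text \<open>\<open>W\<close> is chosen before \<open>c\<close> and \<open>V\<close>, so one
  neighbourhood of \<open>p\<close> serves every open set on which a phase is known, however near to
  \<open>p\<close> it comes.\<close>

lemma phase_spread:
  assumes k: "k \<in> \<A>" "p \<in> fst k"
  obtains W where "open W" "p \<in> W"
    "\<forall>c V. open V \<longrightarrow> V \<inter> W \<noteq> {} \<longrightarrow> (\<forall>a\<in>V. phase c a) \<longrightarrow> (\<forall>b\<in>W. phase c b)"
proof -
  interpret c: chart_pair "cdom k" "loc k x" "loc k y" H by (rule chart_pair[OF k(1)])
  obtain r where r: "r > 0" "ball (snd k p) r \<subseteq> cdom k"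
    using openE[OF open_cdom[OF k(1)] chart_mem[OF k(2)]] by metis
  \<comment> \<open>With radius \<open>r / 4\<close> any two points of \<open>W\<close> are less
    than \<open>r / 2\<close> apart in coordinates, while the closed ball of radius
    \<open>r / 2\<close> about either stays in the chart image.\<close>
  have "snd k p \<in> ball (snd k p) (r / 4)" using r(1) by simp
  from chart_nbhd[OF k open_ball this] obtain W where W: "open W" "p \<in> W" "W \<subseteq> fst k"
    "\<And>q. q \<in> W \<Longrightarrow> snd k q \<in> ball (snd k p) (r / 4)" by metis
  have "\<forall>c V. open V \<longrightarrow> V \<inter> W \<noteq> {} \<longrightarrow> (\<forall>a\<in>V. phase c a) \<longrightarrow> (\<forall>b\<in>W. phase c b)"
  proof (intro allI impI ballI)
    fix c V b assume oV: "open V" and ne: "V \<inter> W \<noteq> {}" and phV: "\<forall>a\<in>V. phase c a" and b: "b \<in> W"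
    obtain q where q: "q \<in> V" "q \<in> W" using ne by blast
    note V = oV q bspec[OF phV]
    have qk: "q \<in> fst k" and bk: "b \<in> fst k" using V(3) b W(3) by blast+
    have dq: "dist (snd k p) (snd k q) < r / 4" and db: "dist (snd k p) (snd k b) < r / 4"
      using W(4)[OF V(3)] W(4)[OF b] by simp_all
    have "cball (snd k q) (r / 2) \<subseteq> ball (snd k p) r"
    proof
      fix u assume "u \<in> cball (snd k q) (r / 2)"
      then have "dist (snd k q) u \<le> r / 2" by simp
      then show "u \<in> ball (snd k p) r" using dist_triangle[of "snd k p" u "snd k q"] dq r(1) by simp
    qed
    then have R: "cball (snd k q) (r / 2) \<subseteq> cdom k" using r(2) by (rule subset_trans)
    define T where "T = snd k ` (fst k \<inter> V)"
    have T: "open T" unfolding T_def by (rule chart_image_open[OF k(1) V(1)])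
    have qT: "snd k q \<in> T" using qk V(2) by (simp add: T_def)
    have ph: "chart_phase (loc k x) (loc k y) H c u" if u: "u \<in> T" for u
    proof -
      obtain a where a: "a \<in> fst k" "a \<in> V" "u = snd k a" using u unfolding T_def by blast
      show ?thesis using V(4)[OF a(2)] phase_chart[OF k(1) a(1)] a(3) by simp
    qed
    have "dist (snd k b) (snd k q) < r / 2"
      using dist_triangle[of "snd k b" "snd k q" "snd k p"] dq db by (simp add: dist_commute)
    from c.phase_continue[OF R T qT ph this] show "phase c b" using phase_chart[OF k(1) bk] by simp
  qed
  with W(1,2) show ?thesis by (rule that)
qed

text \<open>The set of points near which \<open>c\<close> is a phase is open by construction and
  closed by \<open>phase_spread\<close>.\<close>

lemma phase_global_of_local:
  assumes conn: "connected (UNIV :: 'a set)" and V: "open V" "p0 \<in> V" "\<And>a. a \<in> V \<Longrightarrow> phase c a"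
  shows "phase c p"
proof -
  define Z where "Z = \<Union>{V. open V \<and> (\<forall>a\<in>V. phase c a)}"
  have "open Z" unfolding Z_def by (rule open_Union) blast
  moreover have "open (- Z)"
  proof (subst open_subopen, rule ballI)
    fix q assume q: "q \<in> - Z"
    obtain W where W: "open W" "q \<in> W"
      "\<forall>c V. open V \<longrightarrow> V \<inter> W \<noteq> {} \<longrightarrow> (\<forall>a\<in>V. phase c a) \<longrightarrow> (\<forall>b\<in>W. phase c b)"
      by (rule phase_spread[OF chart_at[of q]])
    have "W \<subseteq> - Z"
    proof (rule ccontr)
      assume "\<not> W \<subseteq> - Z"
      then obtain a V where aV: "a \<in> W" "a \<in> V" "open V" "\<forall>a\<in>V. phase c a" unfolding Z_def by blast
      have "\<forall>b\<in>W. phase c b" using W(3) aV by blast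
      then have "q \<in> Z" unfolding Z_def using W(1,2) by blast
      then show False using q by blast
    qed
    then show "\<exists>T. open T \<and> q \<in> T \<and> T \<subseteq> - Z" using W(1,2) by blast
  qed
  ultimately have "Z = {} \<or> - Z = {}"
    using connectedD[OF conn, of Z "- Z"] by auto
  moreover have "p0 \<in> Z" unfolding Z_def using V by blast
  ultimately have "p \<in> Z" by blast
  then show ?thesis unfolding Z_def by blast
qed

lemma phase_umbilic:
  assumes "\<And>v. differential \<A> (zeta \<A> x H) p v = 0"
  shows "phase c p"
proof -
  have "dzeta (loc (chart_at \<A> p) x) H e1 (snd (chart_at \<A> p) p) = 0"
    using assms[of e1] dderiv_zeta[OF chart_at] by (simp add: differential_loc)
  from chart_pair.phase_umbilic[OF chart_pair[OF chart_at(1)] chart_mem[OF chart_at(2)] this]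
  show ?thesis using phase_chart[OF chart_at] by simp
qed

lemma phase_exists:
  assumes conn: "connected (UNIV :: 'a set)"
  obtains c where "cmod c = 1" "\<And>p. phase c p"
proof (cases "\<forall>p v. differential \<A> (zeta \<A> x H) p v = 0")
  case True
  \<comment> \<open>On a totally umbilic surface every phase is admissible.\<close>
  then show ?thesis using that[of 1] phase_umbilic by simp
next
  case False
  then obtain p where np: "\<exists>v. differential \<A> (zeta \<A> x H) p v \<noteq> 0" by blast
  define k where "k = chart_at \<A> p"
  have k: "k \<in> \<A>" "p \<in> fst k" by (simp_all add: k_def chart_at)
  interpret c: chart_pair "cdom k" "loc k x" "loc k y" H by (rule chart_pair[OF k(1)])
  note u = chart_mem[OF k(2)]
  have "beta (loc k x) H e1 (snd k p) \<noteq> 0"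
  proof
    assume 0: "beta (loc k x) H e1 (snd k p) = 0"
    have "beta (loc k x) H v (snd k p) = 0" for v
      using c.linear_forms(2)[OF u, of H v] c.beta_conj_linear[OF u] 0 by simp
    then have "differential \<A> (zeta \<A> x H) p v = 0" for v
      using dderiv_zeta[OF k] c.dzeta_frame[OF u] by (simp add: differential_loc k_def)
    then show False using np by blast
  qed
  from c.phase_local[OF u this] obtain c r where c: "r > 0" "ball (snd k p) r \<subseteq> cdom k" "cmod c = 1"
    "\<And>u. u \<in> ball (snd k p) r \<Longrightarrow> chart_phase (loc k x) (loc k y) H c u" by metis
  have "snd k p \<in> ball (snd k p) r" using c(1) by simp
  from chart_nbhd[OF k open_ball this] obtain W where W: "open W" "p \<in> W" "W \<subseteq> fst k"
    "\<And>q. q \<in> W \<Longrightarrow> snd k q \<in> ball (snd k p) r" by metis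
  have "phase c q" if "q \<in> W" for q
    using c(4)[OF W(4)[OF that]] phase_chart[OF k(1) subsetD[OF W(3) that]] by simp
  from phase_global_of_local[OF conn W(1,2) this] that[OF c(3)] show ?thesis by metis
qed

lemma differential_Rot:
  assumes ph: "phase c p"
  shows "differential \<A> (\<lambda>p. Rot p w) p v = Rot p (cross3
    (- Im c *\<^sub>R differential \<A> (zeta \<A> x H) p v
      - (1 - Re c) *\<^sub>R cross3 (unit_normal \<A> x p) (differential \<A> (zeta \<A> x H) p v)) w)"
proof -
  define k where "k = chart_at \<A> p"
  have k: "k \<in> \<A>" "p \<in> fst k" by (simp_all add: k_def chart_at)
  interpret c: chart_pair "cdom k" "loc k x" "loc k y" H by (rule chart_pair[OF k(1)])
  note u = chart_mem[OF k(2)]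
  have z: "differential \<A> (zeta \<A> x H) p v = dzeta (loc k x) H v (snd k p)"
    using dderiv_zeta[OF k] by (simp add: differential_loc k_def)
  have "differential \<A> (\<lambda>p. Rot p w) p v = dderiv v (loc k (\<lambda>p. Rot p w)) (snd k p)"
    by (simp add: differential_loc k_def)
  also have "\<dots> = dderiv v (\<lambda>u. rot (loc k x) (loc k y) u w) (snd k p)"
    by (rule dderiv_cong_open[OF c.S u loc_Rot[OF k(1)]])
  finally show ?thesis
    using c.dderiv_rot[OF u, of c v w] ph phase_chart[OF k]
    unfolding z Rot_chart[OF k] unit_normal_chart[OF k] by simp
qed

text \<open>For phase 1 the angular velocity vanishes, so \<open>Rot\<close> is a constant rotation
  \<open>g\<close>, and \<open>y - g x\<close> has differential 0.\<close>

lemma phase_one_rigid: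
  assumes conn: "connected (UNIV :: 'a set)" and ph: "\<And>p. phase 1 p"
  obtains g d where "linear g" "\<And>v w. g v \<bullet> g w = v \<bullet> w" "\<And>v w. cross3 (g v) (g w) = g (cross3 v w)"
    "\<And>p. y p = g (x p) + d"
proof -
  fix o1 :: 'a
  define g where "g = Rot o1"
  have "differential \<A> (\<lambda>p. Rot p w) p v = 0" for p v w
    using differential_Rot[OF ph, of w p v] linear_0[OF Rot_linear] by simp
  from constant_map[OF conn smooth_Rot this] have R: "Rot p w = g w" for p w by (simp add: g_def)
  have lin: "linear g" and bl: "bounded_linear g"
    using Rot_linear linear_conv_bounded_linear by (auto simp: g_def)
  define F where "F p = y p + - g (x p)" for p
  have blm: "bounded_linear (\<lambda>v. - g v)" by (rule bounded_linear_minus[OF bl])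
  have "smooth_map \<A> F" unfolding F_def[abs_def]
    by (rule smooth_map_add[OF target.smooth_x smooth_map_linear[OF blm smooth_x]])
  moreover have "differential \<A> F p v = 0" for p v
    unfolding F_def[abs_def] differential_add[OF target.smooth_x smooth_map_linear[OF blm smooth_x]]
      differential_linear[OF blm smooth_x]
    using Rot_differential[of p v] by (simp add: R)
  ultimately have "F p = F o1" for p by (rule constant_map[OF conn])
  then have "y p = g (x p) + F o1" for p by (simp add: F_def algebra_simps)
  moreover have "g v \<bullet> g w = v \<bullet> w" "cross3 (g v) (g w) = g (cross3 v w)" for v w
    by (simp_all add: g_def Rot_inner Rot_cross)
  ultimately show ?thesis using that lin by blast
qed

lemma phase_one_congruent:
  assumes conn: "connected (UNIV :: 'a set)" and ph: "\<And>p. phase 1 p"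
  shows "congruent_immersions x y"
proof -
  obtain g d where g: "linear g" "\<And>v w. g v \<bullet> g w = v \<bullet> w" "\<And>v w. cross3 (g v) (g w) = g (cross3 v w)"
    and y: "\<And>p. y p = g (x p) + d" using phase_one_rigid[OF conn ph] by blast
  have "y = (\<lambda>q. g q + d) \<circ> x" using y by (simp add: fun_eq_iff)
  then show ?thesis
    unfolding congruent_immersions_def using congruence_rigid[OF g] by blast
qed

end

section \<open>Rotations along closed curves\<close>

lemma has_vector_derivative_cross3:
  assumes "(F has_vector_derivative F') (at s)" "(G has_vector_derivative G') (at s)"
  shows "((\<lambda>s. cross3 (F s) (G s)) has_vector_derivative (cross3 (F s) G' + cross3 F' (G s))) (at s)"
  using bounded_bilinear.has_vector_derivative[OF bounded_bilinear_cross3 assms] .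

lemma norm_cross3_le: "norm (cross3 a b) \<le> norm a * norm b"
proof -
  have "(norm (cross3 a b))\<^sup>2 \<le> (norm a * norm b)\<^sup>2"
    using norm_cross_dot[of a b] zero_le_power2[of "a \<bullet> b"] by linarith
  then show ?thesis by (rule power2_le_imp_le) simp
qed

lemma has_integral_derivative_periodic:
  fixes f :: "real \<Rightarrow> 'b::euclidean_space"
  assumes "\<And>s. (f has_vector_derivative f' s) (at s)" "f L = f 0" "L > 0"
  shows "(f' has_integral 0) {0..L}"
proof -
  have "(f' has_integral f L - f 0) {0..L}"
    by (rule fundamental_theorem_of_calculus) (use assms(3) in simp, rule has_vector_derivative_at_within[OF assms(1)])
  then show ?thesis using assms(2) by simp
qed

lemma has_integral_bound_interval:
  fixes f :: "real \<Rightarrow> 'b::real_normed_vector"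
  assumes "(f has_integral i) {a..b}" "0 \<le> B" "a \<le> b" "\<And>x. x \<in> {a..b} \<Longrightarrow> norm (f x) \<le> B"
  shows "norm i \<le> B * (b - a)"
proof -
  have "norm i \<le> B * measure lborel {a..b}"
    by (rule has_integral_bound_real[OF assms(2) finite.emptyI assms(1)]) (use assms(4) in blast)
  then show ?thesis by (simp only: content_real[OF assms(3)])
qed

text \<open>What remains of the two surfaces along the closed curve: \<open>X\<close>,
  \<open>Y\<close>, \<open>z\<close>, \<open>n\<close> are the restrictions of \<open>x\<close>,
  \<open>y\<close>, \<open>zeta\<close> and the unit normal, \<open>X'\<close>, \<open>Y'\<close>,
  \<open>z'\<close> are derivatives, and \<open>r\<close> is the rotation, given by its angular
  velocity.\<close>

locale rotating_curve =
  fixes L :: real and c :: complex and r :: "real \<Rightarrow> real^3 \<Rightarrow> real^3" and X X' Y Y' z z' n :: "real \<Rightarrow> real^3"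
  assumes L: "L > 0" and c: "cmod c = 1"
    and lin: "\<And>s. linear (r s)" and inner: "\<And>s v w. r s v \<bullet> r s w = v \<bullet> w"
    and r': "\<And>s w. ((\<lambda>s. r s w) has_vector_derivative
        r s (cross3 (- Im c *\<^sub>R z' s - (1 - Re c) *\<^sub>R cross3 (n s) (z' s)) w)) (at s)"
    and X: "\<And>s. (X has_vector_derivative X' s) (at s)"
    and Y: "\<And>s. (Y has_vector_derivative Y' s) (at s)"
    and z: "\<And>s. (z has_vector_derivative z' s) (at s)"
    and rX: "\<And>s. r s (X' s) = Y' s"
    and cont: "continuous_on UNIV X'" "continuous_on UNIV z'" "continuous_on UNIV n"
    and n: "\<And>s. n s \<bullet> n s = 1" "\<And>s. X' s \<bullet> n s = 0" "\<And>s. z' s \<bullet> n s = 0"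
    and per: "X L = X 0" "Y L = Y 0" "z L = z 0" "r L = r 0"
begin

definition Om :: "real \<Rightarrow> real^3" where
  "Om s = - Im c *\<^sub>R z' s - (1 - Re c) *\<^sub>R cross3 (n s) (z' s)"

definition W :: "real^3" where
  "W = integral {0..L} (\<lambda>s. cross3 (z s) (X' s))"

lemma norm_r: "norm (r s v) = norm v"
  using inner[of s v v] by (simp add: norm_eq_sqrt_inner)

lemma contX: "continuous_on A X" and contz: "continuous_on A z"
  using has_vector_derivative_continuous[OF X] has_vector_derivative_continuous[OF z]
  by (simp_all add: continuous_at_imp_continuous_on)

lemmas cont' = continuous_on_subset[OF cont(1) subset_UNIV] continuous_on_subset[OF cont(2) subset_UNIV]
  continuous_on_subset[OF cont(3) subset_UNIV]

lemma cont_Om: "continuous_on A Om"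
  unfolding Om_def[abs_def] by (intro continuous_intros continuous_on_cross cont')

lemma W_integral: "((\<lambda>s. cross3 (z s) (X' s)) has_integral W) {0..L}"
  unfolding W_def
  by (intro integrable_integral integrable_continuous_interval continuous_on_cross contz cont')

text \<open>Differentiating \<open>r X\<close> expresses \<open>Y' = r X'\<close> through \<open>r (Om \<times> X)\<close> alone.\<close>

lemma moving_has_derivative:
  assumes F: "(F has_vector_derivative F') (at s)"
  shows "((\<lambda>s. r s (F s)) has_vector_derivative (r s F' + r s (cross3 (Om s) (F s)))) (at s)"
proof -
  \<comment> \<open>The derivative of \<open>r\<close> is given only on fixed vectors, so the moving
    argument is expanded in a fixed basis.\<close>
  have ex: "v = (\<Sum>b\<in>Basis. (v \<bullet> b) *\<^sub>R b)" for v :: "real^3" by (simp add: euclidean_representation)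
  have rex: "r t v = (\<Sum>b\<in>Basis. (v \<bullet> b) *\<^sub>R r t b)" for t v
    by (subst ex[of v]) (simp add: linear_sum[OF lin] linear_scale[OF lin])
  have "((\<lambda>s. \<Sum>b\<in>Basis. (F s \<bullet> b) *\<^sub>R r s b) has_vector_derivative
      (\<Sum>b\<in>Basis. (F s \<bullet> b) *\<^sub>R r s (cross3 (Om s) b) + (F' \<bullet> b) *\<^sub>R r s b)) (at s)"
    unfolding Om_def
    by (intro has_vector_derivative_sum bounded_bilinear.has_vector_derivative[OF bounded_bilinear_scaleR]
        bounded_linear.has_vector_derivative[OF bounded_linear_inner_left F] r')
  moreover have "(\<Sum>b\<in>Basis. (F s \<bullet> b) *\<^sub>R r s (cross3 (Om s) b)) = r s (cross3 (Om s) (F s))"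
  proof -
    have lc: "linear (\<lambda>v. r s (cross3 (Om s) v))"
      by (rule linearI) (simp_all add: cross_add_right cross_mult_right linear_add[OF lin] linear_scale[OF lin])
    show ?thesis
      using ex[of "F s"] linear_sum[OF lc, of "\<lambda>b. (F s \<bullet> b) *\<^sub>R b" Basis] linear_scale[OF lc] by simp
  qed
  ultimately show ?thesis unfolding rex[symmetric] by (simp add: sum.distrib rex[symmetric] add.commute)
qed

lemma integral_Om: "((\<lambda>s. r s (cross3 (Om s) (X s))) has_integral 0) {0..L}"
proof (rule has_integral_derivative_periodic)
  show "((\<lambda>s. r s (X s) - Y s) has_vector_derivative r s (cross3 (Om s) (X s))) (at s)" for s
    using has_vector_derivative_diff[OF moving_has_derivative[OF X] Y, of s] by (simp add: rX)
qed (use per L in auto)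

text \<open>The integral \<open>I\<close> of \<open>Om \<times> X\<close> is evaluated twice.
  Freezing \<open>r\<close> at its initial value in \<open>integral_Om\<close> shows that it is of
  second order in \<open>c - 1\<close>; integration by parts shows that it is \<open>Im c W\<close>
  up to second order.\<close>

lemma force_bound:
  assumes K: "\<And>s. s \<in> {0..L} \<Longrightarrow> norm (z' s) \<le> K" and M: "\<And>s. s \<in> {0..L} \<Longrightarrow> norm (X s) \<le> M"
  shows "\<bar>Im c\<bar> * norm W \<le> (4 * L\<^sup>2 * K\<^sup>2 * M + L * K * M) * (cmod (c - 1))\<^sup>2"
proof -
  define \<delta> where "\<delta> = cmod (c - 1)"
  have c2: "(Re c)\<^sup>2 + (Im c)\<^sup>2 = 1" using c cmod_power2[of c] by simp
  have Re1: "0 \<le> 1 - Re c" using complex_Re_le_cmod[of c] c by simp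
  have "\<delta>\<^sup>2 = (Re c - 1)\<^sup>2 + (Im c)\<^sup>2" by (simp add: \<delta>_def cmod_power2)
  \<comment> \<open>On the unit circle \<open>1 - Re c\<close> is already quadratic in the distance
    to 1.\<close>
  then have d2: "1 - Re c = \<delta>\<^sup>2 / 2" using c2 by (simp add: power2_eq_square algebra_simps)
  have Imd: "\<bar>Im c\<bar> \<le> \<delta>" using abs_Im_le_cmod[of "c - 1"] by (simp add: \<delta>_def)
  have Red: "1 - Re c \<le> \<delta>" using abs_Re_le_cmod[of "c - 1"] by (simp add: \<delta>_def)
  have d0: "\<delta> \<ge> 0" by (simp add: \<delta>_def)
  have K0: "K \<ge> 0" by (rule order_trans[OF norm_ge_zero K[of 0]]) (use L in simp)
  have M0: "M \<ge> 0" by (rule order_trans[OF norm_ge_zero M[of 0]]) (use L in simp)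
  have n1: "norm (n s) = 1" for s using n(1)[of s] by (simp add: norm_eq_sqrt_inner)
  have nz: "norm (cross3 (n s) (z' s)) \<le> K" if "s \<in> {0..L}" for s
    using norm_cross3_le[of "n s" "z' s"] K[OF that] by (simp add: n1)
  have Om: "norm (Om s) \<le> 2 * \<delta> * K" if "s \<in> {0..L}" for s
  proof -
    have "norm (Om s) \<le> norm (- Im c *\<^sub>R z' s) + norm ((1 - Re c) *\<^sub>R cross3 (n s) (z' s))"
      unfolding Om_def by (rule norm_triangle_ineq4)
    also have "\<dots> \<le> \<delta> * K + \<delta> * K"
      unfolding norm_scaleR using Imd Red Re1 d0 K[OF that] nz[OF that]
      by (intro add_mono mult_mono) auto
    finally show ?thesis by (simp add: algebra_simps)
  qed
  have OmX: "norm (cross3 (Om s) (X s)) \<le> 2 * \<delta> * K * M" if "s \<in> {0..L}" for s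
    using norm_cross3_le[of "Om s" "X s"] mult_mono[OF Om[OF that] M[OF that]] d0 K0 by simp
  \<comment> \<open>\<open>r\<close> preserves norms, so the bound on its angular velocity
    integrates to a bound of order \<delta> on its drift.\<close>
  have drift: "norm (r s w - r 0 w) \<le> 2 * \<delta> * K * norm w * L" if s: "s \<in> {0..L}" for s w
  proof -
    have "((\<lambda>t. r t (cross3 (Om t) w)) has_integral (r s w - r 0 w)) {0..s}"
      by (rule fundamental_theorem_of_calculus) (use s r'[of w] in \<open>auto simp: Om_def has_vector_derivative_at_within\<close>)
    then have "norm (r s w - r 0 w) \<le> (2 * \<delta> * K * norm w) * (s - 0)"
    proof (rule has_integral_bound_interval)
      show "norm (r t (cross3 (Om t) w)) \<le> 2 * \<delta> * K * norm w" if "t \<in> {0..s}" for t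
        unfolding norm_r using norm_cross3_le[of "Om t" w] mult_right_mono[OF Om, of t "norm w"] that s by auto
    qed (use s d0 K0 in auto)
    also have "\<dots> \<le> (2 * \<delta> * K * norm w) * L" using s d0 K0 by (intro mult_left_mono) auto
    finally show ?thesis .
  qed
  define I where "I = integral {0..L} (\<lambda>s. cross3 (Om s) (X s))"
  have I: "((\<lambda>s. cross3 (Om s) (X s)) has_integral I) {0..L}"
    unfolding I_def by (intro integrable_integral integrable_continuous_interval continuous_on_cross cont_Om contX)
  have bl: "bounded_linear (r 0)" using lin linear_conv_bounded_linear by blast
  \<comment> \<open>The integral with the moving \<open>r\<close> vanishes, so the error of freezing
    \<open>r\<close> is all of \<open>- r 0 I\<close>.\<close>
  have "((\<lambda>s. r s (cross3 (Om s) (X s)) - r 0 (cross3 (Om s) (X s))) has_integral 0 - r 0 I) {0..L}"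
    by (intro has_integral_diff integral_Om has_integral_linear[OF I bl, unfolded comp_def])
  then have "norm (0 - r 0 I) \<le> (2 * \<delta> * K * (2 * \<delta> * K * M) * L) * (L - 0)"
  proof (rule has_integral_bound_interval)
    show "0 \<le> 2 * \<delta> * K * (2 * \<delta> * K * M) * L" using d0 K0 M0 L by simp
    show "norm (r s (cross3 (Om s) (X s)) - r 0 (cross3 (Om s) (X s))) \<le> 2 * \<delta> * K * (2 * \<delta> * K * M) * L"
      if "s \<in> {0..L}" for s
    proof -
      have "2 * \<delta> * K * norm (cross3 (Om s) (X s)) * L \<le> 2 * \<delta> * K * (2 * \<delta> * K * M) * L"
        using OmX[OF that] d0 K0 L by (intro mult_right_mono mult_left_mono) auto
      then show ?thesis using drift[OF that, of "cross3 (Om s) (X s)"] by linarith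
    qed
  qed (use L in auto)
  then have nI: "norm I \<le> 4 * L\<^sup>2 * K\<^sup>2 * M * \<delta>\<^sup>2"
    by (simp add: norm_r power2_eq_square algebra_simps)
  define Q where "Q = integral {0..L} (\<lambda>s. cross3 (cross3 (n s) (z' s)) (X s))"
  have Q: "((\<lambda>s. cross3 (cross3 (n s) (z' s)) (X s)) has_integral Q) {0..L}"
    unfolding Q_def by (intro integrable_integral integrable_continuous_interval continuous_on_cross contX cont')
  have nQ: "norm Q \<le> (K * M) * (L - 0)"
    using Q
  proof (rule has_integral_bound_interval)
    show "norm (cross3 (cross3 (n s) (z' s)) (X s)) \<le> K * M" if "s \<in> {0..L}" for s
      using norm_cross3_le[of "cross3 (n s) (z' s)" "X s"] mult_mono[OF nz[OF that] M[OF that]] K0 by simp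
  qed (use K0 M0 L in auto)
  \<comment> \<open>Integration by parts around the closed curve: the integral of
    \<open>z' \<times> X\<close> is minus that of \<open>z \<times> X'\<close>, which is
    \<open>W\<close>.\<close>
  have "((\<lambda>s. cross3 (z s) (X' s) + cross3 (z' s) (X s)) has_integral 0) {0..L}"
    by (rule has_integral_derivative_periodic[OF has_vector_derivative_cross3[OF z X] _ L]) (simp add: per)
  from has_integral_diff[OF this W_integral]
  have zX: "((\<lambda>s. cross3 (z' s) (X s)) has_integral - W) {0..L}" by simp
  have "((\<lambda>s. - Im c *\<^sub>R cross3 (z' s) (X s) - (1 - Re c) *\<^sub>R cross3 (cross3 (n s) (z' s)) (X s))
      has_integral (- Im c *\<^sub>R - W - (1 - Re c) *\<^sub>R Q)) {0..L}"
    by (intro has_integral_diff has_integral_cmul zX Q)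
  moreover have "- Im c *\<^sub>R cross3 (z' s) (X s) - (1 - Re c) *\<^sub>R cross3 (cross3 (n s) (z' s)) (X s) = cross3 (Om s) (X s)" for s
    unfolding Om_def by (simp only: Cross3.left_diff_distrib cross_mult_left)
  ultimately have "I = Im c *\<^sub>R W - (1 - Re c) *\<^sub>R Q"
    using has_integral_unique[OF I] by simp
  then have "Im c *\<^sub>R W = I + (1 - Re c) *\<^sub>R Q" by simp
  then have "\<bar>Im c\<bar> * norm W = norm (I + (1 - Re c) *\<^sub>R Q)" by (metis norm_scaleR)
  also have "\<dots> \<le> norm I + (1 - Re c) * norm Q"
    using norm_triangle_ineq[of I "(1 - Re c) *\<^sub>R Q"] Re1 by simp
  also have "\<dots> \<le> 4 * L\<^sup>2 * K\<^sup>2 * M * \<delta>\<^sup>2 + \<delta>\<^sup>2 / 2 * (K * M * L)"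
    using nI nQ Re1 by (intro add_mono) (auto simp: d2 intro!: mult_left_mono)
  also have "\<dots> \<le> (4 * L\<^sup>2 * K\<^sup>2 * M + L * K * M) * \<delta>\<^sup>2"
    using K0 M0 L by (simp add: algebra_simps)
  finally show ?thesis unfolding \<delta>_def .
qed

text \<open>If \<open>z = n\<close>, then \<open>r\<close> composed with the rotation by the angle \<open>arg c\<close> about \<open>n\<close> is constant.\<close>

lemma force_zero:
  assumes zn: "z = n"
  shows "Im c *\<^sub>R W = 0"
proof -
  define a b where "a = Re c" and "b = Im c"
  have ab: "a\<^sup>2 + b\<^sup>2 = 1" using c cmod_power2[of c] by (simp add: a_def b_def)
  \<comment> \<open>Rodrigues' formula for the rotation about \<open>n s\<close>, with cosine
    \<open>a\<close> and sine \<open>b\<close>.\<close>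
  define Q where "Q w s = a *\<^sub>R w + b *\<^sub>R cross3 (n s) w + ((1 - a) * (n s \<bullet> w)) *\<^sub>R n s" for w s
  define Q' where "Q' w s = b *\<^sub>R cross3 (z' s) w + (1 - a) *\<^sub>R ((z' s \<bullet> w) *\<^sub>R n s + (n s \<bullet> w) *\<^sub>R z' s)" for w s
  have dn: "(n has_vector_derivative z' s) (at s)" for s using z[of s] by (simp add: zn)
  have dQ: "(Q w has_vector_derivative Q' w s) (at s)" for w s
  proof -
    have 1: "((\<lambda>s. cross3 (n s) w) has_vector_derivative cross3 (z' s) w) (at s)"
      using has_vector_derivative_cross3[OF dn has_vector_derivative_const[of w]] by simp
    have 2: "((\<lambda>s. (n s \<bullet> w) *\<^sub>R n s) has_vector_derivative ((n s \<bullet> w) *\<^sub>R z' s + (z' s \<bullet> w) *\<^sub>R n s)) (at s)"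
      by (intro bounded_bilinear.has_vector_derivative[OF bounded_bilinear_scaleR]
          bounded_linear.has_vector_derivative[OF bounded_linear_inner_left] dn)
    have "((\<lambda>s. a *\<^sub>R w + b *\<^sub>R cross3 (n s) w + (1 - a) *\<^sub>R ((n s \<bullet> w) *\<^sub>R n s)) has_vector_derivative
        0 + b *\<^sub>R cross3 (z' s) w + (1 - a) *\<^sub>R ((n s \<bullet> w) *\<^sub>R z' s + (z' s \<bullet> w) *\<^sub>R n s)) (at s)"
      by (intro has_vector_derivative_add has_vector_derivative_const
          bounded_linear.has_vector_derivative[OF bounded_linear_scaleR_right] 1 2)
    then show ?thesis by (simp add: Q_def[abs_def] Q'_def add.commute)
  qed
  have key: "cross3 (Om s) (Q w s) + Q' w s = 0" for w s
  proof -
    define m where "m = z' s"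
    define N where "N = n s"
    have N: "N \<bullet> N = 1" "m \<bullet> N = 0" "N \<bullet> m = 0" using n(1,3)[of s] by (simp_all add: m_def N_def inner_commute)
    have i1: "cross3 m (cross3 N w) = (m \<bullet> w) *\<^sub>R N" using cross3_triple(1)[of m N w] N by simp
    have i2: "cross3 (cross3 N m) w = (N \<bullet> w) *\<^sub>R m - (m \<bullet> w) *\<^sub>R N" by (rule cross3_triple(2))
    have i3: "cross3 (cross3 N m) N = m" using cross3_triple(2)[of N m N] N by simp
    have i4: "cross3 (cross3 N m) (cross3 N w) = cross3 m w - (N \<bullet> w) *\<^sub>R cross3 m N"
    proof -
      have "cross3 (cross3 N m) (cross3 N w) = (N \<bullet> cross3 m w) *\<^sub>R N"
        by (simp add: cross3_simps forall_3)
      also have "\<dots> = (N \<bullet> N) *\<^sub>R cross3 m w - cross3 N (cross3 (cross3 m w) N)"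
        by (simp add: cross3_triple(1) inner_commute N)
      also have "cross3 (cross3 m w) N = - (w \<bullet> N) *\<^sub>R m" using cross3_triple(2)[of m w N] N by simp
      finally show ?thesis using cross_skew[of N m] by (simp add: N cross_mult_right inner_commute)
    qed
    have b2: "b * b = 1 - a * a" using ab by (simp add: power2_eq_square)
    have "cross3 (Om s) (Q w s) + Q' w s =
        - (a * b) *\<^sub>R cross3 m w - (b * b) *\<^sub>R ((m \<bullet> w) *\<^sub>R N) - (b * (1 - a) * (N \<bullet> w)) *\<^sub>R cross3 m N
        - ((1 - a) * a) *\<^sub>R ((N \<bullet> w) *\<^sub>R m - (m \<bullet> w) *\<^sub>R N) - ((1 - a) * b) *\<^sub>R (cross3 m w - (N \<bullet> w) *\<^sub>R cross3 m N)
        - ((1 - a) * ((1 - a) * (N \<bullet> w))) *\<^sub>R m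
        + (b *\<^sub>R cross3 m w + (1 - a) *\<^sub>R ((m \<bullet> w) *\<^sub>R N + (N \<bullet> w) *\<^sub>R m))"
      unfolding Om_def Q_def Q'_def m_def[symmetric] N_def[symmetric] a_def[symmetric] b_def[symmetric]
        Cross3.left_diff_distrib cross_add_right cross_mult_left cross_mult_right i1 i2 i3 i4
      by (simp only: vec_eq_iff vector_add_component vector_minus_component vector_uminus_component
          vector_scaleR_component zero_index) (simp add: algebra_simps)
    also have "\<dots> = 0"
      unfolding b2
      by (simp only: vec_eq_iff vector_add_component vector_minus_component vector_uminus_component
          vector_scaleR_component zero_index) (simp add: algebra_simps)
    finally show ?thesis .
  qed
  have S: "r s (Q w s) = r 0 (Q w 0)" for w s
  proof -
    have "((\<lambda>s. r s (Q w s)) has_derivative (\<lambda>h. 0)) (at t within UNIV)" for t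
    proof -
      have "r t (Q' w t) + r t (cross3 (Om t) (Q w t)) = r t (cross3 (Om t) (Q w t) + Q' w t)"
        by (simp add: linear_add[OF lin])
      then have "r t (Q' w t) + r t (cross3 (Om t) (Q w t)) = 0" by (simp add: key linear_0[OF lin])
      then show ?thesis using moving_has_derivative[OF dQ[of w t]] by (simp add: has_vector_derivative_def)
    qed
    then obtain k where "\<And>t. r t (Q w t) = k"
      using has_derivative_zero_constant[of UNIV "\<lambda>s. r s (Q w s)"] by auto
    then show ?thesis by simp
  qed
  have "(b *\<^sub>R W) \<bullet> w = 0" for w
  proof -
    \<comment> \<open>The constant vector \<open>r 0 (Q w 0)\<close> equals
      \<open>r s (Q w s)\<close> for every \<open>s\<close>. Paired with it, \<open>Y'\<close>
      integrates to 0, as does \<open>X'\<close> with \<open>w\<close>; what is left is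
      \<open>b (W \<bullet> w)\<close>.\<close>
    have e: "Y' s \<bullet> r 0 (Q w 0) = a * (X' s \<bullet> w) - b * (cross3 (z s) (X' s) \<bullet> w)" for s
    proof -
      have "Y' s \<bullet> r 0 (Q w 0) = r s (X' s) \<bullet> r s (Q w s)" by (simp add: rX S[of s w])
      also have "\<dots> = X' s \<bullet> Q w s" by (rule inner)
      also have "\<dots> = a * (X' s \<bullet> w) + b * (X' s \<bullet> cross3 (n s) w)"
        by (simp add: Q_def inner_add_right n)
      also have "X' s \<bullet> cross3 (n s) w = - (cross3 (z s) (X' s) \<bullet> w)"
        unfolding zn by (simp add: cross3_simps)
      finally show ?thesis by simp
    qed
    have "(Y' has_integral 0) {0..L}" by (rule has_integral_derivative_periodic[OF Y per(2) L])
    from has_integral_linear[OF this bounded_linear_inner_left, of "r 0 (Q w 0)"]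
    have 1: "((\<lambda>s. a * (X' s \<bullet> w) - b * (cross3 (z s) (X' s) \<bullet> w)) has_integral 0) {0..L}"
      by (simp add: comp_def e)
    have "(X' has_integral 0) {0..L}" by (rule has_integral_derivative_periodic[OF X per(1) L])
    from has_integral_linear[OF this bounded_linear_inner_left, of w]
    have "((\<lambda>s. a * (X' s \<bullet> w)) has_integral a * 0) {0..L}"
      by (intro has_integral_mult_right) (simp add: comp_def)
    moreover from has_integral_linear[OF W_integral bounded_linear_inner_left, of w]
    have "((\<lambda>s. b * (cross3 (z s) (X' s) \<bullet> w)) has_integral b * (W \<bullet> w)) {0..L}"
      by (intro has_integral_mult_right) (simp add: comp_def)
    ultimately have "((\<lambda>s. a * (X' s \<bullet> w) - b * (cross3 (z s) (X' s) \<bullet> w)) has_integral a * 0 - b * (W \<bullet> w)) {0..L}"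
      by (rule has_integral_diff)
    from has_integral_unique[OF this 1] show ?thesis by simp
  qed
  then have "b *\<^sub>R W = 0" using vector_eq_rdot[of "b *\<^sub>R W" 0] by simp
  then show ?thesis by (simp add: b_def)
qed

end

section \<open>The force formula\<close>

context immersed
begin

text \<open>The factor \<open>k\<close> is the area element. It converts the coordinate sign
  condition in \<open>complex_structure\<close> into one on cross products.\<close>

lemma chart_at_cross:
  obtains k where "k > 0"
    "\<And>v w. cross3 (differential \<A> x p v) (differential \<A> x p w) = ((v $ 1 * w $ 2 - v $ 2 * w $ 1) * k) *\<^sub>R unit_normal \<A> x p"
proof -
  define C where "C = cross3 (differential \<A> x p e1) (differential \<A> x p e2)"
  have C: "C \<noteq> 0" using cross_chart_at[of p] by (simp add: C_def differential_loc)
  have "unit_normal \<A> x p = sgn C" by (simp add: unit_normal_def C_def)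
  then have CN: "C = norm C *\<^sub>R unit_normal \<A> x p" by (simp add: sgn_div_norm C)
  have ex: "differential \<A> x p v = (v $ 1) *\<^sub>R differential \<A> x p e1 + (v $ 2) *\<^sub>R differential \<A> x p e2" for v
    using dderiv_expand2[OF diff_loc[OF chart_at], where v = v] by (simp add: differential_loc)
  have "cross3 (differential \<A> x p v) (differential \<A> x p w) = ((v $ 1 * w $ 2 - v $ 2 * w $ 1) * norm C) *\<^sub>R unit_normal \<A> x p" for v w
  proof -
    have sk: "cross3 (differential \<A> x p e2) (differential \<A> x p e1) = - C" unfolding C_def by (rule cross_skew)
    have "cross3 (differential \<A> x p v) (differential \<A> x p w) = (v $ 1 * w $ 2 - v $ 2 * w $ 1) *\<^sub>R C"
      unfolding ex[of v] ex[of w] cross_add_left cross_add_right cross_mult_left cross_mult_right cross_refl sk C_def[symmetric]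
      by (simp add: algebra_simps)
    then show ?thesis by (subst (asm) CN) simp
  qed
  then show ?thesis using that[of "norm C"] C by simp
qed

lemma differential_inj: "differential \<A> x p v = differential \<A> x p w \<Longrightarrow> v = w"
  using immersion by (simp add: immersion_def inj_eq)

text \<open>The cross product with the normal meets the defining conditions. Conversely,
  orthogonality and equal length fix the image vector up to sign, the orientation fixes the sign,
  and injectivity of the differential gives uniqueness.\<close>

lemma complex_structure:
  "differential \<A> x p (complex_structure \<A> x p v) = cross3 (unit_normal \<A> x p) (differential \<A> x p v)"
proof -
  define D where "D = differential \<A> x p"
  define N where "N = unit_normal \<A> x p"
  have NN: "N \<bullet> N = 1" by (simp add: N_def unit_normal_unit)
  have DN: "D u \<bullet> N = 0" "N \<bullet> D u = 0" for u using differential_tangent[of p u] by (simp_all add: D_def N_def inner_commute)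
  obtain k where k: "k > 0" "\<And>v w. cross3 (D v) (D w) = ((v $ 1 * w $ 2 - v $ 2 * w $ 1) * k) *\<^sub>R N"
    using chart_at_cross[of p] unfolding D_def N_def by metis
  obtain w where w: "D w = cross3 N (D v)"
    using differential_surj[of "cross3 N (D v)" p] by (auto simp: D_def N_def dot_cross_self)
  have nw: "D w \<bullet> D w = D v \<bullet> D v"
    unfolding w using norm_cross_dot[of N "D v"]
    by (simp add: power_mult_distrib power2_norm_eq_inner NN DN)
  have nN: "norm N = 1" using NN by (simp add: norm_eq_sqrt_inner)
  let ?P = "\<lambda>w. D v \<bullet> D w = 0 \<and> D w \<bullet> D w = D v \<bullet> D v \<and> v $ 1 * w $ 2 - v $ 2 * w $ 1 \<ge> 0"
  have "?P w"
  proof (intro conjI nw)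
    show "D v \<bullet> D w = 0" unfolding w by (simp add: dot_cross_self)
    have "cross3 (D v) (D w) = (D v \<bullet> D v) *\<^sub>R N"
      unfolding w cross3_triple(1) by (simp add: DN)
    then have "((v $ 1 * w $ 2 - v $ 2 * w $ 1) * k) *\<^sub>R N = (D v \<bullet> D v) *\<^sub>R N" using k(2) by simp
    moreover have "N \<noteq> 0" using NN by auto
    ultimately have "(v $ 1 * w $ 2 - v $ 2 * w $ 1) * k = D v \<bullet> D v" unfolding scaleR_cancel_right by blast
    moreover have "D v \<bullet> D v \<ge> 0" by simp
    ultimately show "0 \<le> v $ 1 * w $ 2 - v $ 2 * w $ 1" using k(1) by (metis zero_le_mult_iff not_less)
  qed
  moreover have "w' = w" if P: "?P w'" for w'
  proof -
    have "D w' = cross3 N (D v)"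
    proof (cases "D v = 0")
      case True then show ?thesis using P by simp
    next
      case False
      define m where "m = (v $ 1 * w' $ 2 - v $ 2 * w' $ 1) * k"
      have m0: "m \<ge> 0" using P k(1) by (simp add: m_def)
      have c: "cross3 (D v) (D w') = m *\<^sub>R N" using k(2) by (simp add: m_def)
      have "cross3 (cross3 (D v) (D w')) (D v) = (D v \<bullet> D v) *\<^sub>R D w'"
        unfolding cross3_triple(2) using P by (simp add: inner_commute)
      then have e: "(D v \<bullet> D v) *\<^sub>R D w' = m *\<^sub>R cross3 N (D v)" unfolding c cross_mult_left by simp
      have "norm (cross3 (D v) (D w')) = m" unfolding c using nN m0 by simp
      moreover have "(norm (cross3 (D v) (D w')))\<^sup>2 = (D v \<bullet> D v)\<^sup>2"
      proof -
        have "(norm (cross3 (D v) (D w')))\<^sup>2 = (D v \<bullet> D v) * (D w' \<bullet> D w')"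
          using norm_cross_dot[of "D v" "D w'"] P by (simp add: power_mult_distrib power2_norm_eq_inner)
        then show ?thesis using P by (simp add: power2_eq_square)
      qed
      ultimately have "m = D v \<bullet> D v" using m0 by (simp add: power2_eq_iff_nonneg)
      then show ?thesis using e False by simp
    qed
    then have "D w' = D w" by (simp add: w)
    then show ?thesis unfolding D_def by (rule differential_inj)
  qed
  ultimately have "(THE w. ?P w) = w" by (rule the_equality)
  then have "complex_structure \<A> x p v = w" by (simp add: complex_structure_def induced_metric_def D_def)
  then show ?thesis using w by (simp add: D_def N_def)
qed

lemma curve_x: "smooth_curve \<A> \<gamma> \<Longrightarrow>
    ((\<lambda>s. x (\<gamma> s)) has_vector_derivative differential \<A> x (\<gamma> s) (velocity \<A> \<gamma> s)) (at s)"
  by (rule curve_derivative[OF smooth_x])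

lemma curve_continuous:
  assumes "smooth_map \<A> F" "smooth_curve \<A> \<gamma>"
  shows "continuous_on A (\<lambda>s. F (\<gamma> s))"
  using has_vector_derivative_continuous[OF curve_derivative[OF assms]]
  by (simp add: continuous_at_imp_continuous_on)

lemma force_integral:
  assumes H: "constant_mean_curvature \<A> x H" and g: "smooth_curve \<A> \<gamma>"
  shows "((\<lambda>s. cross3 (zeta \<A> x H (\<gamma> s)) (differential \<A> x (\<gamma> s) (velocity \<A> \<gamma> s))) has_integral force \<A> x L \<gamma>) {0..L}"
proof -
  have e: "force_form \<A> x (\<gamma> s) (velocity \<A> \<gamma> s) = cross3 (zeta \<A> x H (\<gamma> s)) (differential \<A> x (\<gamma> s) (velocity \<A> \<gamma> s))" for s
    using H by (simp add: force_form_def zeta_def constant_mean_curvature_def add.commute)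
  have "continuous_on {0..L} (\<lambda>s. cross3 (zeta \<A> x H (\<gamma> s)) (differential \<A> x (\<gamma> s) (velocity \<A> \<gamma> s)))"
    by (intro continuous_on_cross curve_continuous[OF smooth_zeta g]
        continuous_on_subset[OF curve_derivative_continuous[OF smooth_x g] subset_UNIV])
  then show ?thesis unfolding force_def e by (intro integrable_integral integrable_continuous_interval)
qed

end

text \<open>Since \<open>V\<close> is orthogonal to \<open>T\<close>, one has
  \<open>V = \<nu> N + a (N \<times> T)\<close> with \<open>a\<^sup>2 + \<nu>\<^sup>2 = 1\<close>.
  Orthogonality of \<open>q\<close> and \<open>V\<close> then eliminates the component of
  \<open>q\<close> along \<open>N \<times> T\<close>.\<close>

lemma force_pointwise:
  fixes q V T N :: "real^3"
  assumes V: "norm V = 1" and T: "T \<bullet> T = 1" "T \<bullet> V = 0" and N: "N \<bullet> N = 1" "N \<bullet> T = 0" and q: "q \<bullet> V = 0"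
    and a: "a = cross3 N T \<bullet> V" "a \<noteq> 0"
  shows "cross3 (H *\<^sub>R q + N) T \<bullet> V = 1 / a * (a\<^sup>2 + H * (q \<bullet> N))"
proof -
  interpret orthonormal_frame N T "cross3 N T" by standard (use T N in auto)
  define \<nu> where "\<nu> = V \<bullet> N"
  define B where "B = cross3 N T"
  have VA: "V \<bullet> T = 0" "V \<bullet> B = a" using T(2) a(1) by (simp_all add: B_def inner_commute)
  have VV: "a\<^sup>2 + \<nu>\<^sup>2 = 1"
    using expand_inner[of V V, folded B_def] V by (simp add: VA \<nu>_def power2_eq_square dot_square_norm)
  have qV: "(q \<bullet> B) * a + (q \<bullet> N) * \<nu> = 0"
    using expand_inner[of q V, folded B_def] q by (simp add: VA \<nu>_def)
  have T0: "T \<bullet> N = 0" "T \<bullet> B = 0" by (simp_all add: inner B_def)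
  have qT: "cross3 q T \<bullet> V = (q \<bullet> N) * a - (q \<bullet> B) * \<nu>"
    using expand_inner[of "cross3 q T" V, folded B_def] cross_inner_A[of q T, folded B_def]
      cross_inner_B[of q T, folded B_def] cross_inner_N[of q T, folded B_def]
    by (simp add: VA T0 T(1) \<nu>_def)
  have "a * (cross3 q T \<bullet> V) = (q \<bullet> N) * a\<^sup>2 - ((q \<bullet> B) * a) * \<nu>"
    unfolding qT by (simp add: algebra_simps power2_eq_square)
  also have "(q \<bullet> B) * a = - ((q \<bullet> N) * \<nu>)" using qV by simp
  finally have "a * (cross3 q T \<bullet> V) = (q \<bullet> N) * (a\<^sup>2 + \<nu>\<^sup>2)"
    by (simp add: algebra_simps power2_eq_square)
  then have "a * (cross3 q T \<bullet> V) = q \<bullet> N" by (simp only: VV mult_1_right)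
  then have qT: "cross3 q T \<bullet> V = (q \<bullet> N) / a" using a(2) by (simp add: field_simps)
  have "cross3 (H *\<^sub>R q + N) T \<bullet> V = H * (cross3 q T \<bullet> V) + a"
    by (simp add: cross_add_left cross_mult_left inner_add_left a(1))
  then show ?thesis unfolding qT using a(2) by (simp add: field_simps power2_eq_square)
qed

text \<open>By connectedness of the interval the function has constant sign.\<close>

lemma integral_nonzero_of_nonzero:
  fixes f :: "real \<Rightarrow> real"
  assumes c: "continuous_on {0..L} f" and nz: "\<And>s. s \<in> {0..L} \<Longrightarrow> f s \<noteq> 0" and L: "L > 0"
  shows "integral {0..L} f \<noteq> 0"
proof
  assume 0: "integral {0..L} f = 0"
  have pos: False if g: "continuous_on {0..L} g" "\<And>s. s \<in> {0..L} \<Longrightarrow> g s > 0" "integral {0..L} g = 0" for g :: "real \<Rightarrow> real"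
  proof -
    have "(g has_integral 0) (cbox 0 L)"
      using integrable_integral[OF integrable_continuous_interval[OF g(1)]] g(3) by simp
    then have "g 0 = 0"
    proof (rule has_integral_0_cbox_imp_0[rotated 2])
      show "0 \<le> g s" if "s \<in> box 0 L" for s using g(2)[of s] that by (simp add: less_imp_le)
    qed (use g L in auto)
    then show False using g(2)[of 0] L by simp
  qed
  have conn: "connected (f ` {0..L})" using c by (intro connected_continuous_image) auto
  have "(\<forall>s\<in>{0..L}. f s > 0) \<or> (\<forall>s\<in>{0..L}. f s < 0)"
  proof (rule ccontr)
    assume "\<not> ?thesis"
    then obtain s t where st: "s \<in> {0..L}" "t \<in> {0..L}" "f s \<le> 0" "0 \<le> f t" by force
    from connectedD_interval[OF conn imageI[OF st(1)] imageI[OF st(2)] st(3,4)] nz show False by auto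
  qed
  then show False
  proof
    assume "\<forall>s\<in>{0..L}. f s > 0" then show False using pos[of f] c 0 by blast
  next
    assume n: "\<forall>s\<in>{0..L}. f s < 0"
    show False
    proof (rule pos[of "\<lambda>s. - f s"])
      show "continuous_on {0..L} (\<lambda>s. - f s)" using c by (rule continuous_on_minus)
      show "- f s > 0" if "s \<in> {0..L}" for s using n that by simp
      show "integral {0..L} (\<lambda>s. - f s) = 0" using 0 by simp
    qed
  qed
qed

locale plane_curve = immersed \<A> x for \<A> :: "'m::topological_space chart set" and x +
  fixes H L :: real and \<gamma> :: "real \<Rightarrow> 'm" and P V
  assumes H: "constant_mean_curvature \<A> x H" and V: "unit_normal_to_plane P V"
    and closed: "smooth_closed_curve \<A> L \<gamma>" and unit: "unit_speed \<A> x \<gamma>"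
    and plane: "meets_plane_transversally_in \<A> x P \<gamma>"
begin

abbreviation T where "T s \<equiv> differential \<A> x (\<gamma> s) (velocity \<A> \<gamma> s)"
abbreviation N where "N s \<equiv> unit_normal \<A> x (\<gamma> s)"

lemma curve: "smooth_curve \<A> \<gamma>" "L > 0" "\<gamma> L = \<gamma> 0"
  using closed spec[of "\<lambda>s. \<gamma> (s + L) = \<gamma> s" 0] by (simp_all add: smooth_closed_curve_def)

lemma V1: "norm V = 1" and PV: "a \<in> P \<Longrightarrow> b \<in> P \<Longrightarrow> (a - b) \<bullet> V = 0"
  using V unfolding unit_normal_to_plane_def by blast+

lemma onP: "x (\<gamma> s) \<in> P"
  using plane by (simp add: meets_plane_transversally_in_def)

lemma T1: "T s \<bullet> T s = 1"
  using unit by (simp add: unit_speed_def induced_metric_def)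

lemma TV: "T s \<bullet> V = 0"
proof -
  have "((\<lambda>s. (x (\<gamma> s) - x (\<gamma> 0)) \<bullet> V) has_vector_derivative (T s - 0) \<bullet> V) (at s)"
    by (intro bounded_linear.has_vector_derivative[OF bounded_linear_inner_left] has_vector_derivative_diff
        curve_x curve has_vector_derivative_const)
  then have "((\<lambda>s. 0) has_vector_derivative (T s \<bullet> V)) (at s)" by (simp add: PV onP)
  then show ?thesis
    using vector_derivative_unique_at[OF has_vector_derivative_const[of 0]] by metis
qed

text \<open>Otherwise \<open>V\<close>, being orthogonal to \<open>T\<close>, would be a multiple of
  the surface normal. The tangent plane and the directions of \<open>P\<close> would then both be
  orthogonal to \<open>V\<close>, against transversality.\<close>

lemma conormal: "cross3 (N s) (T s) \<bullet> V \<noteq> 0"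
proof
  assume a0: "cross3 (N s) (T s) \<bullet> V = 0"
  interpret fr: orthonormal_frame "N s" "T s" "cross3 (N s) (T s)"
    by standard (use T1 unit_normal_unit differential_tangent in \<open>auto simp: inner_commute\<close>)
  have "T s \<bullet> V = 0" by (rule TV)
  then have VN: "V = (V \<bullet> N s) *\<^sub>R N s" using fr.expand[of V] a0 by (simp add: inner_commute)
  have "V \<in> {differential \<A> x (\<gamma> s) v + (a - b) | v a b. a \<in> P \<and> b \<in> P}"
    using plane by (simp add: meets_plane_transversally_in_def transversal_at_def)
  then obtain v a b where v: "V = differential \<A> x (\<gamma> s) v + (a - b)" "a \<in> P" "b \<in> P" by blast
  have "differential \<A> x (\<gamma> s) v \<bullet> V = 0"
    by (subst VN) (simp add: differential_tangent)
  then have "V \<bullet> V = 0" using PV[OF v(2,3)] by (subst (1) v(1)) (simp add: inner_add_left)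
  then show False using V1 by simp
qed

lemma force_formula:
  assumes "orig \<in> P"
  shows "force \<A> x L \<gamma> \<bullet> V = plane_curve_integral \<A> x H V orig L \<gamma>"
proof -
  define a where "a s = cross3 (N s) (T s) \<bullet> V" for s
  have pw: "cross3 (zeta \<A> x H (\<gamma> s)) (T s) \<bullet> V - H * (cross3 orig (T s) \<bullet> V)
      = 1 / a s * ((a s)\<^sup>2 + H * ((x (\<gamma> s) - orig) \<bullet> N s))" for s
  proof -
    have "cross3 (H *\<^sub>R (x (\<gamma> s) - orig) + N s) (T s) \<bullet> V = 1 / a s * ((a s)\<^sup>2 + H * ((x (\<gamma> s) - orig) \<bullet> N s))"
      using conormal[of s] PV[OF onP assms] differential_tangent[of "\<gamma> s"]
      by (intro force_pointwise V1 T1 TV unit_normal_unit a_def) (simp_all add: a_def inner_commute)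
    moreover have "cross3 (H *\<^sub>R (x (\<gamma> s) - orig) + N s) (T s) = cross3 (zeta \<A> x H (\<gamma> s)) (T s) - H *\<^sub>R cross3 orig (T s)"
      by (simp add: zeta_def cross_add_left cross_mult_left Cross3.left_diff_distrib scaleR_diff_right)
    ultimately show ?thesis by (simp add: inner_diff_left)
  qed
  have 1: "((\<lambda>s. cross3 (zeta \<A> x H (\<gamma> s)) (T s) \<bullet> V) has_integral force \<A> x L \<gamma> \<bullet> V) {0..L}"
    using has_integral_linear[OF force_integral[OF H curve(1)] bounded_linear_inner_left, of V L] by (simp add: comp_def)
  have "(T has_integral 0) {0..L}"
    by (rule has_integral_derivative_periodic[OF curve_x[OF curve(1)]]) (simp_all add: curve)
  moreover have "bounded_linear (\<lambda>v. H * (cross3 orig v \<bullet> V))"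
    by (intro bounded_linear_const_mult bounded_linear_compose[OF bounded_linear_inner_left]
        bounded_bilinear.bounded_linear_right[OF bounded_bilinear_cross3])
  ultimately have 2: "((\<lambda>s. H * (cross3 orig (T s) \<bullet> V)) has_integral 0) {0..L}"
    using has_integral_linear[of T 0 "{0..L}" "\<lambda>v. H * (cross3 orig v \<bullet> V)"] by (simp add: comp_def)
  have "((\<lambda>s. 1 / a s * ((a s)\<^sup>2 + H * ((x (\<gamma> s) - orig) \<bullet> N s))) has_integral force \<A> x L \<gamma> \<bullet> V) {0..L}"
    using has_integral_diff[OF 1 2] by (simp add: pw)
  then have "integral {0..L} (\<lambda>s. 1 / a s * ((a s)\<^sup>2 + H * ((x (\<gamma> s) - orig) \<bullet> N s))) = force \<A> x L \<gamma> \<bullet> V"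
    by (rule integral_unique)
  then show ?thesis
    by (simp add: plane_curve_integral_def complex_structure a_def Let_def)
qed

text \<open>For \<open>H = 0\<close> the integrand reduces to the conormal component, which has no
  zeros by transversality.\<close>

lemma minimal_force_nonzero:
  assumes "H = 0" "orig \<in> P"
  shows "force \<A> x L \<gamma> \<bullet> V \<noteq> 0"
proof -
  have "plane_curve_integral \<A> x H V orig L \<gamma> = integral {0..L} (\<lambda>s. cross3 (N s) (T s) \<bullet> V)"
    unfolding plane_curve_integral_def Let_def complex_structure
    using conormal by (simp add: assms(1) power2_eq_square)
  moreover have "integral {0..L} (\<lambda>s. cross3 (N s) (T s) \<bullet> V) \<noteq> 0"
    by (intro integral_nonzero_of_nonzero conormal curve continuous_on_inner continuous_on_const continuous_on_cross
        curve_continuous[OF smooth_unit_normal] continuous_on_subset[OF curve_derivative_continuous[OF smooth_x] subset_UNIV])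
  ultimately show ?thesis using force_formula[OF assms(2)] by simp
qed

end

section \<open>Rigidity\<close>

context cmc_pair
begin

lemma rotating_curve:
  assumes g: "smooth_closed_curve \<A> L \<gamma>" and c: "cmod c = 1" and ph: "\<And>p. phase c p"
  shows "rotating_curve L c (\<lambda>s. Rot (\<gamma> s)) (\<lambda>s. x (\<gamma> s)) (\<lambda>s. differential \<A> x (\<gamma> s) (velocity \<A> \<gamma> s))
    (\<lambda>s. y (\<gamma> s)) (\<lambda>s. differential \<A> y (\<gamma> s) (velocity \<A> \<gamma> s)) (\<lambda>s. zeta \<A> x H (\<gamma> s))
    (\<lambda>s. differential \<A> (zeta \<A> x H) (\<gamma> s) (velocity \<A> \<gamma> s)) (\<lambda>s. unit_normal \<A> x (\<gamma> s))"
proof (rule rotating_curve.intro)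
  have sc: "smooth_curve \<A> \<gamma>" and L: "L > 0" and "\<gamma> (0 + L) = \<gamma> 0"
    using g unfolding smooth_closed_curve_def by blast+
  then have gL: "\<gamma> L = \<gamma> 0" by simp
  show "0 < L" by (rule L)
  show "cmod c = 1" by (rule c)
  show "linear (Rot (\<gamma> s))" for s by (rule Rot_linear)
  show "Rot (\<gamma> s) v \<bullet> Rot (\<gamma> s) w = v \<bullet> w" for s v w by (rule Rot_inner)
  show "((\<lambda>s. Rot (\<gamma> s) w) has_vector_derivative Rot (\<gamma> s) (cross3
      (- Im c *\<^sub>R differential \<A> (zeta \<A> x H) (\<gamma> s) (velocity \<A> \<gamma> s)
        - (1 - Re c) *\<^sub>R cross3 (unit_normal \<A> x (\<gamma> s)) (differential \<A> (zeta \<A> x H) (\<gamma> s) (velocity \<A> \<gamma> s))) w)) (at s)" for s w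
    using curve_derivative[OF smooth_Rot sc, of w s] unfolding differential_Rot[OF ph] .
  show "((\<lambda>s. x (\<gamma> s)) has_vector_derivative differential \<A> x (\<gamma> s) (velocity \<A> \<gamma> s)) (at s)" for s
    by (rule curve_derivative[OF smooth_x sc])
  show "((\<lambda>s. y (\<gamma> s)) has_vector_derivative differential \<A> y (\<gamma> s) (velocity \<A> \<gamma> s)) (at s)" for s
    by (rule curve_derivative[OF target.smooth_x sc])
  show "((\<lambda>s. zeta \<A> x H (\<gamma> s)) has_vector_derivative differential \<A> (zeta \<A> x H) (\<gamma> s) (velocity \<A> \<gamma> s)) (at s)" for s
    by (rule curve_derivative[OF smooth_zeta sc])
  show "Rot (\<gamma> s) (differential \<A> x (\<gamma> s) (velocity \<A> \<gamma> s)) = differential \<A> y (\<gamma> s) (velocity \<A> \<gamma> s)" for s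
    by (rule Rot_differential)
  show "continuous_on UNIV (\<lambda>s. differential \<A> x (\<gamma> s) (velocity \<A> \<gamma> s))"
    by (rule curve_derivative_continuous[OF smooth_x sc])
  show "continuous_on UNIV (\<lambda>s. differential \<A> (zeta \<A> x H) (\<gamma> s) (velocity \<A> \<gamma> s))"
    by (rule curve_derivative_continuous[OF smooth_zeta sc])
  show "continuous_on UNIV (\<lambda>s. unit_normal \<A> x (\<gamma> s))"
    by (rule curve_continuous[OF smooth_unit_normal sc])
  show "unit_normal \<A> x (\<gamma> s) \<bullet> unit_normal \<A> x (\<gamma> s) = 1" for s by (rule unit_normal_unit)
  show "differential \<A> x (\<gamma> s) (velocity \<A> \<gamma> s) \<bullet> unit_normal \<A> x (\<gamma> s) = 0" for s by (rule differential_tangent)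
  show "differential \<A> (zeta \<A> x H) (\<gamma> s) (velocity \<A> \<gamma> s) \<bullet> unit_normal \<A> x (\<gamma> s) = 0" for s
    by (rule differential_zeta_tangent)
  show "x (\<gamma> L) = x (\<gamma> 0)" "y (\<gamma> L) = y (\<gamma> 0)" "zeta \<A> x H (\<gamma> L) = zeta \<A> x H (\<gamma> 0)" "Rot (\<gamma> L) = Rot (\<gamma> 0)"
    by (simp_all only: gL)
qed

lemma force_W:
  assumes g: "smooth_closed_curve \<A> L \<gamma>"
  shows "force \<A> x L \<gamma> = integral {0..L} (\<lambda>s. cross3 (zeta \<A> x H (\<gamma> s)) (differential \<A> x (\<gamma> s) (velocity \<A> \<gamma> s)))"
  using force_integral[OF Hx, of \<gamma> L] g by (simp add: smooth_closed_curve_def integral_unique)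

end

context immersed
begin

text \<open>\<open>y\<close> and \<open>c\<close> are quantified inside the conclusion because one
  \<delta> must serve a whole deformation.\<close>

lemma phase_gap:
  assumes H: "constant_mean_curvature \<A> x H" and g: "smooth_closed_curve \<A> L \<gamma>" and W: "force \<A> x L \<gamma> \<noteq> 0"
  obtains \<delta> where "\<delta> > 0" "\<forall>y c. cmc_pair \<A> x y H \<longrightarrow> cmod c = 1 \<longrightarrow>
    (\<forall>p. cmc_pair.phase \<A> x y H c p) \<longrightarrow> Re c \<noteq> 1 \<longrightarrow> Re c \<le> 1 - \<delta>"
proof -
  have sc: "smooth_curve \<A> \<gamma>" and L: "L > 0" using g by (simp_all add: smooth_closed_curve_def)
  have bound: "\<exists>B\<ge>0. \<forall>s\<in>{0..L}. norm (f s) \<le> B" if "continuous_on UNIV f" for f :: "real \<Rightarrow> real^3"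
  proof -
    have "bounded (f ` {0..L})"
      using that by (intro compact_imp_bounded compact_continuous_image continuous_on_subset[OF that]) auto
    then obtain B where "B > 0" "\<And>v. v \<in> f ` {0..L} \<Longrightarrow> norm v \<le> B" using bounded_pos by metis
    then show ?thesis by (intro exI[of _ B]) auto
  qed
  obtain K where K: "K \<ge> 0" "\<And>s. s \<in> {0..L} \<Longrightarrow> norm (differential \<A> (zeta \<A> x H) (\<gamma> s) (velocity \<A> \<gamma> s)) \<le> K"
    using bound[OF curve_derivative_continuous[OF smooth_zeta sc]] by blast
  obtain M where M: "M \<ge> 0" "\<And>s. s \<in> {0..L} \<Longrightarrow> norm (x (\<gamma> s)) \<le> M"
    using bound[OF curve_continuous[OF smooth_x sc]] by blast
  define C where "C = 4 * L\<^sup>2 * K\<^sup>2 * M + L * K * M"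
  have C: "C \<ge> 0" using K M L by (simp add: C_def)
  define w where "w = norm (force \<A> x L \<gamma>)"
  have w: "w > 0" using W by (simp add: w_def)
  \<comment> \<open>With \<open>d = 1 - Re c\<close> one has
    \<open>(Im c)\<^sup>2 = d (2 - d)\<close> and \<open>|c - 1|\<^sup>2 = 2 d\<close>. The square
    of \<open>force_bound\<close>, divided by \<open>d\<close>, is
    \<open>(2 - d) w\<^sup>2 \<le> 4 C\<^sup>2 d\<close>; solved for \<open>d\<close> it gives this
    constant.\<close>
  define \<delta> where "\<delta> = 2 * w\<^sup>2 / (4 * C\<^sup>2 + w\<^sup>2)"
  have den: "4 * C\<^sup>2 + w\<^sup>2 > 0" using w by (simp add: add_nonneg_pos)
  have "\<delta> > 0" using w den by (simp add: \<delta>_def)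
  moreover have "\<forall>y c. cmc_pair \<A> x y H \<longrightarrow> cmod c = 1 \<longrightarrow>
    (\<forall>p. cmc_pair.phase \<A> x y H c p) \<longrightarrow> Re c \<noteq> 1 \<longrightarrow> Re c \<le> 1 - \<delta>"
  proof (intro allI impI)
    fix y c assume P: "cmc_pair \<A> x y H" and c: "cmod c = 1"
      and ph': "\<forall>p. cmc_pair.phase \<A> x y H c p" and ne: "Re c \<noteq> 1"
    note ph = ph'[rule_format]
    interpret cp: cmc_pair \<A> x y H by (rule P)
    interpret rc: rotating_curve L c "\<lambda>s. cp.Rot (\<gamma> s)" "\<lambda>s. x (\<gamma> s)" "\<lambda>s. differential \<A> x (\<gamma> s) (velocity \<A> \<gamma> s)"
      "\<lambda>s. y (\<gamma> s)" "\<lambda>s. differential \<A> y (\<gamma> s) (velocity \<A> \<gamma> s)" "\<lambda>s. zeta \<A> x H (\<gamma> s)"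
      "\<lambda>s. differential \<A> (zeta \<A> x H) (\<gamma> s) (velocity \<A> \<gamma> s)" "\<lambda>s. unit_normal \<A> x (\<gamma> s)"
      by (rule cp.rotating_curve[OF g c ph])
    define d where "d = 1 - Re c"
    have c2: "(Re c)\<^sup>2 + (Im c)\<^sup>2 = 1" using c cmod_power2[of c] by simp
    have d: "d > 0" using complex_Re_le_cmod[of c] c ne by (simp add: d_def)
    have im: "(Im c)\<^sup>2 = d * (2 - d)" using c2 by (simp add: d_def power2_eq_square algebra_simps)
    have "(cmod (c - 1))\<^sup>2 = (Re c - 1)\<^sup>2 + (Im c)\<^sup>2" by (simp add: cmod_power2)
    then have dd: "(cmod (c - 1))\<^sup>2 = 2 * d" using c2 by (simp add: d_def power2_eq_square algebra_simps)
    have "rc.W = force \<A> x L \<gamma>" unfolding rc.W_def by (rule cp.force_W[OF g, symmetric])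
    with rc.force_bound[OF K(2) M(2)] have "\<bar>Im c\<bar> * w \<le> C * (2 * d)"
      by (simp add: w_def C_def dd)
    then have "(\<bar>Im c\<bar> * w)\<^sup>2 \<le> (C * (2 * d))\<^sup>2" using w by (intro power_mono) auto
    then have "d * ((2 - d) * w\<^sup>2) \<le> d * (4 * C\<^sup>2 * d)"
      by (simp add: power_mult_distrib im) (simp add: power2_eq_square algebra_simps)
    then have "(2 - d) * w\<^sup>2 \<le> 4 * C\<^sup>2 * d" using d by simp
    then have "2 * w\<^sup>2 \<le> d * (4 * C\<^sup>2 + w\<^sup>2)" by (simp add: algebra_simps)
    then have "\<delta> \<le> d" using den by (simp add: \<delta>_def pos_divide_le_eq)
    then show "Re c \<le> 1 - \<delta>" by (simp add: d_def)
  qed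
  ultimately show ?thesis by (rule that)
qed

end

text \<open>Near time 0 smoothness means existence of local extensions \<open>g\<close> in time and
  space together. At a fixed time the derivatives in \<open>u\<close> are derivatives of
  \<open>g\<close> in directions \<open>(0, v)\<close>, hence continuous in time.\<close>

lemma smooth_extendable_derivatives_continuous:
  fixes G :: "real \<Rightarrow> real^2 \<Rightarrow> real^3"
  assumes ext: "smooth_extendable_on ({0..<e} \<times> D) (\<lambda>(t, u). G t u)" and D: "open D" "u0 \<in> D"
  shows "continuous_on {0..<e} (\<lambda>t. dderiv w (G t) u0)"
    and "continuous_on {0..<e} (\<lambda>t. dderiv v (dderiv w (G t)) u0)"
proof -
  have ex: "(\<exists>I h. open I \<and> t0 \<in> I \<and> isCont h t0 \<and> (\<forall>t\<in>I \<inter> {0..<e}. dderiv w (G t) u0 = h t))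
    \<and> (\<exists>I h. open I \<and> t0 \<in> I \<and> isCont h t0 \<and> (\<forall>t\<in>I \<inter> {0..<e}. dderiv v (dderiv w (G t)) u0 = h t))"
    if t0: "t0 \<in> {0..<e}" for t0
  proof -
    have "(t0, u0) \<in> {0..<e} \<times> D" using t0 D(2) by simp
    from bspec[OF ext[unfolded smooth_extendable_on_def] this]
    obtain U g where U: "open U" "(t0, u0) \<in> U" "smooth_open U g"
      "\<forall>q\<in>({0..<e} \<times> D) \<inter> U. (case q of (t, u) \<Rightarrow> G t u) = g q" by (elim exE conjE)
    obtain I J where IJ: "open I" "open J" "(t0, u0) \<in> I \<times> J" "I \<times> J \<subseteq> U"
      by (rule open_prod_elim[OF U(1,2)])
    define J' where "J' = J \<inter> D"
    have J': "open J'" "u0 \<in> J'" using IJ D by (auto simp: J'_def)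
    have G: "G t u = g (t, u)" if "t \<in> I" "t \<in> {0..<e}" "u \<in> J'" for t u
      using bspec[OF U(4), of "(t, u)"] that IJ(4) by (auto simp: J'_def)
    have slice: "dderiv v (\<lambda>u. h (t, u)) u = dderiv (0, v) h (t, u)" if "smooth_open U h" "t \<in> I" "u \<in> J'"
      for h :: "real \<times> (real^2) \<Rightarrow> real^3" and t u v
    proof (rule dderivI)
      have "(t, u) \<in> U" using that IJ(4) by (auto simp: J'_def)
      from smooth_open_has_derivative[OF that(1) this]
      have 1: "(h has_derivative (\<lambda>v. dderiv v h (t, u))) (at (t, u))" .
      have 2: "((\<lambda>u. (t, u)) has_derivative (\<lambda>v. (0, v))) (at u)"
        by (intro has_derivative_Pair has_derivative_const has_derivative_ident)
      from has_derivative_compose[OF 2 1] show "((\<lambda>u. h (t, u)) has_derivative (\<lambda>v. dderiv (0, v) h (t, u))) (at u)" .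
    qed
    have d1: "dderiv w (G t) u = dderiv (0, w) g (t, u)" if t: "t \<in> I" "t \<in> {0..<e}" and u: "u \<in> J'" for t u
    proof -
      have "dderiv w (G t) u = dderiv w (\<lambda>u. g (t, u)) u"
        by (rule dderiv_cong_open[OF J'(1) u G[OF t]])
      then show ?thesis using slice[OF U(3) t(1) u] by simp
    qed
    have d2: "dderiv v (dderiv w (G t)) u0 = dderiv (0, v) (dderiv (0, w) g) (t, u0)" if t: "t \<in> I" "t \<in> {0..<e}" for t
    proof -
      have "dderiv v (dderiv w (G t)) u0 = dderiv v (\<lambda>u. dderiv (0, w) g (t, u)) u0"
        by (rule dderiv_cong_open[OF J' d1[OF t]])
      then show ?thesis using slice[OF smooth_open_dderiv[OF U(3)] t(1) J'(2)] by simp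
    qed
    have cont: "isCont (\<lambda>t. h (t, u0)) t0" if "smooth_open U h" for h :: "real \<times> (real^2) \<Rightarrow> real^3"
    proof -
      have "isCont h (t0, u0)"
        using smooth_open_continuous_on[OF that] U(1,2) by (simp add: continuous_on_eq_continuous_at)
      then show ?thesis
        by (intro isCont_o2[where g = h and f = "\<lambda>t. (t, u0)"]) (auto intro!: continuous_intros)
    qed
    have tI: "t0 \<in> I" using IJ(3) by simp
    show ?thesis
    proof (intro conjI exI ballI)
      show "open I" "open I" "t0 \<in> I" "t0 \<in> I" by (fact IJ(1) tI)+
      show "isCont (\<lambda>t. dderiv (0, w) g (t, u0)) t0" by (rule cont[OF smooth_open_dderiv[OF U(3)]])
      show "isCont (\<lambda>t. dderiv (0, v) (dderiv (0, w) g) (t, u0)) t0"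
        by (rule cont[OF smooth_open_dderiv[OF smooth_open_dderiv[OF U(3)]]])
      show "dderiv w (G t) u0 = dderiv (0, w) g (t, u0)" if "t \<in> I \<inter> {0..<e}" for t
        by (rule d1[OF _ _ J'(2)]) (use that in blast)+
      show "dderiv v (dderiv w (G t)) u0 = dderiv (0, v) (dderiv (0, w) g) (t, u0)" if "t \<in> I \<inter> {0..<e}" for t
        by (rule d2) (use that in blast)+
    qed
  qed
  have glue: "continuous_on {0..<e} f"
    if "\<And>t0. t0 \<in> {0..<e} \<Longrightarrow> \<exists>I h. open I \<and> t0 \<in> I \<and> isCont h t0 \<and> (\<forall>t\<in>I \<inter> {0..<e}. f t = h t)"
    for f :: "real \<Rightarrow> real^3"
    unfolding continuous_on_def
  proof
    fix t0 assume t0: "t0 \<in> {0..<e}"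
    from that[OF t0] obtain I h where h: "isCont h t0" "\<forall>t\<in>I \<inter> {0..<e}. f t = h t" and I: "open I" "t0 \<in> I"
      by (elim exE conjE)
    have "(h \<longlongrightarrow> h t0) (at t0 within {0..<e})"
      using h(1) by (simp add: isCont_def Lim_at_imp_Lim_at_within)
    then have "(f \<longlongrightarrow> h t0) (at t0 within {0..<e})"
    proof (rule Lim_transform_within_openin)
      show "openin (top_of_set {0..<e}) ({0..<e} \<inter> I)" using I by (simp add: openin_open_Int)
      show "t0 \<in> {0..<e} \<inter> I" using I t0 by simp
      show "h t = f t" if "t \<in> {0..<e} \<inter> I" for t using h(2) that by simp
    qed
    moreover have "f t0 = h t0" using h(2) I t0 by simp
    ultimately show "(f \<longlongrightarrow> f t0) (at t0 within {0..<e})" by simp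
  qed
  show "continuous_on {0..<e} (\<lambda>t. dderiv w (G t) u0)" by (rule glue[OF ex[THEN conjunct1]])
  show "continuous_on {0..<e} (\<lambda>t. dderiv v (dderiv w (G t)) u0)" by (rule glue[OF ex[THEN conjunct2]])
qed

context immersed
begin

lemma cmc_pairI:
  assumes "constant_mean_curvature \<A> x H" "isometric_immersion \<A> x y" "constant_mean_curvature \<A> y H"
  shows "cmc_pair \<A> x y H"
proof -
  have "immersed \<A> y" using assms(2) atlas by (simp add: immersed_def immersed_axioms_def atlas_def isometric_immersion_def)
  then have "isometric_pair \<A> x y"
    using assms(2) immersed_axioms
    by (simp add: isometric_pair_def isometric_pair_axioms_def isometric_immersion_def)
  then show ?thesis using assms(1,3) by (simp add: cmc_pair_def cmc_pair_axioms_def)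
qed

text \<open>Moves the derivative from the normal to the immersion. The right-hand side contains only
  first and second derivatives of \<open>x\<close>, whose analogues along a deformation are
  continuous in time.\<close>

lemma second_fundamental_chart:
  assumes k: "k \<in> \<A>" "p \<in> fst k"
  shows "dzeta (loc k x) H v (snd k p) \<bullet> dderiv w (loc k x) (snd k p)
    = - (normal (loc k x) (snd k p) \<bullet> dderiv v (dderiv w (loc k x)) (snd k p))
      + H * (dderiv v (loc k x) (snd k p) \<bullet> dderiv w (loc k x) (snd k p))"
proof -
  interpret c: chart_immersion "cdom k" "loc k x" by (rule chart_immersion[OF k(1)])
  note u = chart_mem[OF k(2)]
  have "dderiv v (normal (loc k x)) (snd k p) \<bullet> dderiv w (loc k x) (snd k p)
    = - (normal (loc k x) (snd k p) \<bullet> dderiv v (dderiv w (loc k x)) (snd k p))"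
    by (rule c.dderiv_inner_const[OF c.smooth_normal smooth_open_dderiv[OF c.f] u, of _ 0])
       (subst inner_commute, rule c.d_tangent)
  then show ?thesis by (simp add: dzeta_def inner_add_left)
qed

lemma no_deformation:
  assumes conn: "connected (UNIV :: 'm set)"
    and H: "constant_mean_curvature \<A> x H" and g: "smooth_closed_curve \<A> L \<gamma>" and W: "force \<A> x L \<gamma> \<noteq> 0"
  shows "\<not> admits_nontrivial_isometric_cmc_deformation \<A> x H"
proof
  assume "admits_nontrivial_isometric_cmc_deformation \<A> x H"
  then obtain \<epsilon> X t1 where def: "isometric_cmc_deformation \<A> x H \<epsilon> X" and t1: "t1 \<in> {0..<\<epsilon>}" "\<not> congruent_immersions x (X t1)"
    unfolding admits_nontrivial_isometric_cmc_deformation_def by blast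
  from def have X0: "X 0 = x" and
    Xt: "\<And>t. t \<in> {0..<\<epsilon>} \<Longrightarrow> isometric_immersion \<A> x (X t) \<and> constant_mean_curvature \<A> (X t) H" and
    ext: "\<forall>(U, \<phi>)\<in>\<A>. smooth_extendable_on ({0..<\<epsilon>} \<times> \<phi> ` U) (\<lambda>(t, u). X t (inv_into U \<phi> u))"
    unfolding isometric_cmc_deformation_def by blast+
  have P: "cmc_pair \<A> x (X t) H" if "t \<in> {0..<\<epsilon>}" for t using cmc_pairI[OF H] Xt[OF that] by blast
  have one: False if "\<And>p. cmc_pair.phase \<A> x (X t1) H 1 p"
    using cmc_pair.phase_one_congruent[OF P[OF t1(1)] conn that] t1(2) by blast
  \<comment> \<open>In the totally umbilic case phase 1 is admissible for \<open>X t1\<close>, which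
    makes it congruent to \<open>x\<close>.\<close>
  have "\<exists>p v. differential \<A> (zeta \<A> x H) p v \<noteq> 0"
  proof (rule ccontr)
    assume "\<not> ?thesis"
    then have "cmc_pair.phase \<A> x (X t1) H 1 p" for p
      by (intro cmc_pair.phase_umbilic[OF P[OF t1(1)]]) simp
    then show False by (rule one)
  qed
  then obtain p0 v0 where z0: "differential \<A> (zeta \<A> x H) p0 v0 \<noteq> 0" by blast
  define z where "z = differential \<A> (zeta \<A> x H) p0 v0"
  have zz: "z \<bullet> z > 0" using z0 by (simp add: z_def)
  obtain w0 where w0: "differential \<A> x p0 w0 = z"
    using differential_surj[OF differential_zeta_tangent[where H = H and p = p0 and v = v0]] unfolding z_def by blast
  have "\<forall>t\<in>{0..<\<epsilon>}. \<exists>c. cmod c = 1 \<and> (\<forall>p. cmc_pair.phase \<A> x (X t) H c p)"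
  proof
    fix t assume t: "t \<in> {0..<\<epsilon>}"
    show "\<exists>c. cmod c = 1 \<and> (\<forall>p. cmc_pair.phase \<A> x (X t) H c p)"
      by (rule cmc_pair.phase_exists[OF P[OF t] conn]) blast
  qed
  from bchoice[OF this] obtain c where
    c': "\<forall>t\<in>{0..<\<epsilon>}. cmod (c t) = 1 \<and> (\<forall>p. cmc_pair.phase \<A> x (X t) H (c t) p)"
    by (rule exE)
  note c = bspec[OF c']
  \<comment> \<open>The phases are chosen separately for each \<open>t\<close>, with no continuity.
    Evaluated at a non-umbilic point and paired with the image of \<open>z\<close>, the phase
    identity shows that \<open>f t\<close> is \<open>Re (c t)\<close> times a positive constant,
    while \<open>f\<close> is continuous by its expression in derivatives of
    \<open>X t\<close>.\<close>
  define f where "f t = differential \<A> (zeta \<A> (X t) H) p0 v0 \<bullet> differential \<A> (X t) p0 w0" for t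
  have f: "f t = Re (c t) * (z \<bullet> z)" if t: "t \<in> {0..<\<epsilon>}" for t
  proof -
    interpret cp: cmc_pair \<A> x "X t" H by (rule P[OF t])
    have "cp.phase (c t) p0" using c[OF t] by blast
    then have "differential \<A> (zeta \<A> (X t) H) p0 v0
        = cp.Rot p0 (Re (c t) *\<^sub>R z + Im (c t) *\<^sub>R cross3 (unit_normal \<A> x p0) z)"
      unfolding cp.phase_def z_def by blast
    moreover have "differential \<A> (X t) p0 w0 = cp.Rot p0 z" using cp.Rot_differential[of p0 w0] w0 by simp
    ultimately show ?thesis by (simp add: f_def cp.Rot_inner inner_add_left dot_cross_self)
  qed
  define k where "k = chart_at \<A> p0"
  have k: "k \<in> \<A>" "p0 \<in> fst k" by (simp_all add: k_def chart_at)
  define D where "D w t = dderiv w (loc k (X t)) (snd k p0)" for w t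
  define DD where "DD t = dderiv v0 (dderiv w0 (loc k (X t))) (snd k p0)" for t
  have f2: "f t = - (sgn (cross3 (D e1 t) (D e2 t)) \<bullet> DD t) + H * (D v0 t \<bullet> D w0 t)"
    and nz: "cross3 (D e1 t) (D e2 t) \<noteq> 0" if t: "t \<in> {0..<\<epsilon>}" for t
  proof -
    interpret cp: cmc_pair \<A> x "X t" H by (rule P[OF t])
    show "cross3 (D e1 t) (D e2 t) \<noteq> 0" using cp.target.cross_chart_at[of p0] by (simp add: D_def k_def)
    have "f t = dzeta (loc k (X t)) H v0 (snd k p0) \<bullet> dderiv w0 (loc k (X t)) (snd k p0)"
      using cp.target.dderiv_zeta[OF k] by (simp add: f_def differential_loc k_def)
    then show "f t = - (sgn (cross3 (D e1 t) (D e2 t)) \<bullet> DD t) + H * (D v0 t \<bullet> D w0 t)"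
      unfolding cp.target.second_fundamental_chart[OF k] by (simp add: D_def DD_def normal_def)
  qed
  have "smooth_extendable_on ({0..<\<epsilon>} \<times> cdom k) (\<lambda>(t, u). loc k (X t) u)"
    using bspec[OF ext k(1), unfolded split_beta] by (simp add: cdom_def loc_def case_prod_unfold)
  note cont = smooth_extendable_derivatives_continuous[OF this open_cdom[OF k(1)] chart_mem[OF k(2)]]
  have "continuous_on {0..<\<epsilon>} (\<lambda>t. - (sgn (cross3 (D e1 t) (D e2 t)) \<bullet> DD t) + H * (D v0 t \<bullet> D w0 t))"
    using nz unfolding D_def DD_def
    by (intro continuous_on_add continuous_on_minus continuous_on_inner continuous_on_mult continuous_on_const
        continuous_on_sgn continuous_on_cross cont) auto
  then have "continuous_on {0..<\<epsilon>} f" by (rule continuous_on_eq) (simp add: f2)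
  then have "continuous_on {0..<\<epsilon>} (\<lambda>t. f t / (z \<bullet> z))" by (intro continuous_on_divide continuous_on_const) (use zz in auto)
  then have cRe: "continuous_on {0..<\<epsilon>} (\<lambda>t. Re (c t))" by (rule continuous_on_eq) (use zz in \<open>simp add: f\<close>)
  have e0: "0 \<in> {0..<\<epsilon>}" using t1 by auto
  have "Re (c 0) = 1"
  proof -
    have "f 0 = z \<bullet> z" by (simp add: f_def X0 w0 z_def)
    then show ?thesis using f[OF e0] zz by simp
  qed
  obtain \<delta> where \<delta>0: "\<delta> > 0" and gap: "\<forall>y c. cmc_pair \<A> x y H \<longrightarrow> cmod c = 1 \<longrightarrow>
    (\<forall>p. cmc_pair.phase \<A> x y H c p) \<longrightarrow> Re c \<noteq> 1 \<longrightarrow> Re c \<le> 1 - \<delta>"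
    by (rule phase_gap[OF H g W])
  have gapt: "Re (c t) \<le> 1 - \<delta>" if "t \<in> {0..<\<epsilon>}" "Re (c t) \<noteq> 1" for t
    using gap[rule_format, OF P[OF that(1)] _ _ that(2)] c[OF that(1)] by blast
  note \<delta> = \<delta>0 gapt
  have "Re (c t1) \<noteq> 1"
  proof
    assume re: "Re (c t1) = 1"
    then have "Im (c t1) = 0" using c[OF t1(1)] cmod_power2[of "c t1"] by simp
    with re have "c t1 = 1" by (simp add: complex_eq_iff)
    then show False using one c[OF t1(1)] by simp
  qed
  then have "Re (c t1) \<le> 1 - \<delta>" by (rule \<delta>(2)[OF t1(1)])
  moreover have "continuous_on {0..t1} (\<lambda>t. Re (c t))"
    by (rule continuous_on_subset[OF cRe]) (use t1(1) in auto)
  \<comment> \<open>The value \<open>1 - \<delta> / 2\<close> lies strictly inside the forbidden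
    gap.\<close>
  ultimately obtain s where s: "0 \<le> s" "s \<le> t1" "Re (c s) = 1 - \<delta> / 2"
    using IVT2'[of "\<lambda>t. Re (c t)" t1 "1 - \<delta> / 2" 0] \<delta>(1) \<open>Re (c 0) = 1\<close> t1(1) by auto
  then show False using \<delta>(2)[of s] \<delta>(1) t1(1) by simp
qed

section \<open>The reflected surface and minimal immersions\<close>

lemma mean_curvature_differential:
  "mean_curvature \<A> x p = H \<longleftrightarrow>
    cross3 (differential \<A> (unit_normal \<A> x) p e1) (differential \<A> x p e2)
    + cross3 (differential \<A> x p e1) (differential \<A> (unit_normal \<A> x) p e2)
      = (- 2 * H) *\<^sub>R cross3 (differential \<A> x p e1) (differential \<A> x p e2)"
  unfolding mean_curvature_iff differential_loc dderiv_unit_normal[OF chart_at] ..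

lemma differential_uminus: "differential \<A> (\<lambda>p. - x p) p v = - differential \<A> x p v"
  by (rule differential_linear[OF bounded_linear_minus[OF bounded_linear_ident] smooth_x])

lemma unit_normal_uminus: "unit_normal \<A> (\<lambda>p. - x p) = unit_normal \<A> x"
  by (rule ext) (simp add: unit_normal_def differential_uminus)

lemma immersed_uminus: "immersed \<A> (\<lambda>p. - x p)"
proof
  have "inj (differential \<A> (\<lambda>p. - x p) p)" for p
    using differential_inj[of p] by (auto simp: inj_def differential_uminus)
  then show "immersion \<A> (\<lambda>p. - x p)"
    using smooth_map_linear[OF bounded_linear_minus[OF bounded_linear_ident] smooth_x] by (simp add: immersion_def)
qed

text \<open>The normal comes from a product of two tangent vectors and is unchanged for
  \<open>- x\<close>, while the differential changes sign. The mean curvature therefore changes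
  sign, and the value 0 persists.\<close>

lemma minimal_uminus:
  assumes "constant_mean_curvature \<A> x 0"
  shows "constant_mean_curvature \<A> (\<lambda>p. - x p) 0"
proof -
  interpret neg: immersed \<A> "\<lambda>p. - x p" by (rule immersed_uminus)
  have "mean_curvature \<A> x p = 0" for p using assms by (simp add: constant_mean_curvature_def)
  then have 0: "cross3 (differential \<A> (unit_normal \<A> x) p e1) (differential \<A> x p e2)
    + cross3 (differential \<A> x p e1) (differential \<A> (unit_normal \<A> x) p e2) = 0" for p
    by (simp add: mean_curvature_differential)
  have "- cross3 (differential \<A> (unit_normal \<A> x) p e1) (differential \<A> x p e2)
    + - cross3 (differential \<A> x p e1) (differential \<A> (unit_normal \<A> x) p e2) = 0" for p
    using 0[of p] by (metis add.inverse_distrib_swap add.commute neg_0_equal_iff_equal)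
  then show ?thesis
    by (simp add: constant_mean_curvature_def neg.mean_curvature_differential unit_normal_uminus differential_uminus)
qed

lemma induced_metric_uminus: "induced_metric \<A> (\<lambda>p. - x p) p = induced_metric \<A> x p"
  by (simp add: induced_metric_def fun_eq_iff differential_uminus)

end

context plane_curve
begin

text \<open>The linear part of such a congruence is -1 on tangent vectors and fixes the normal. On
  the derivatives of the normal, which are tangent, it acts with both signs, so the normal is
  constant. The force form is then exact, against the nonzero force.\<close>

lemma minimal_not_congruent_uminus:
  assumes H0: "H = 0" and orig: "orig \<in> P"
  shows "\<not> congruent_immersions x (\<lambda>p. - x p)"
proof
  assume "congruent_immersions x (\<lambda>p. - x p)"
  then obtain \<Phi> where \<Phi>: "congruence \<Phi>" "(\<lambda>p. - x p) = \<Phi> \<circ> x" unfolding congruent_immersions_def by blast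
  define h where "h q = \<Phi> q - \<Phi> 0" for q
  have ot: "orthogonal_transformation h"
    using \<Phi>(1) unfolding orthogonal_transformation_isometry congruence_def h_def by (simp add: dist_norm)
  then have lin: "linear h" by (rule orthogonal_transformation_linear)
  then have bl: "bounded_linear h" by (simp add: linear_conv_bounded_linear)
  have "det (matrix h) > 0" using \<Phi>(1) by (simp add: congruence_def h_def[abs_def])
  moreover have om: "orthogonal_matrix (matrix h)" using ot by (simp add: orthogonal_transformation_matrix)
  ultimately have "rotation_matrix (matrix h)"
    using det_orthogonal_matrix[OF om] by (auto simp: rotation_matrix_def)
  then have hc: "cross3 (h a) (h b) = h (cross3 a b)" for a b
    using cross_rotation_matrix[of "matrix h" a b] lin by (simp add: matrix_works)
  have eq: "- x p = h (x p) + \<Phi> 0" for p using fun_cong[OF \<Phi>(2), of p] by (simp add: h_def)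
  have hx: "h (differential \<A> x p v) = - differential \<A> x p v" for p v
  proof -
    have "smooth_map \<A> (\<lambda>p. \<Phi> 0)"
      by (rule smooth_mapI) (simp add: loc_def comp_def smooth_open_const)
    note const = this
    have "differential \<A> (\<lambda>p. \<Phi> 0) p v = 0" by (simp add: differential_loc loc_def comp_def)
    then have "differential \<A> (\<lambda>p. h (x p) + \<Phi> 0) p v = h (differential \<A> x p v)"
      unfolding differential_add[OF smooth_map_linear[OF bl smooth_x] const] differential_linear[OF bl smooth_x]
      by (simp only: add_0_right)
    moreover have "(\<lambda>p. h (x p) + \<Phi> 0) = (\<lambda>p. - x p)" by (rule ext) (rule eq[symmetric])
    ultimately show ?thesis by (simp only: differential_uminus)
  qed
  have hN: "h (unit_normal \<A> x p) = unit_normal \<A> x p" for p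
    unfolding unit_normal_def sgn_div_norm linear_scale[OF lin] hc[symmetric] hx cross_minus_left cross_minus_right minus_minus ..
  have dN: "differential \<A> (unit_normal \<A> x) p v = 0" for p v
  proof -
    obtain w where w: "differential \<A> x p w = differential \<A> (unit_normal \<A> x) p v"
      using differential_surj[OF differential_unit_normal_tangent, of p v] by blast
    have "h (differential \<A> (unit_normal \<A> x) p v) = differential \<A> (unit_normal \<A> x) p v"
      unfolding differential_linear[OF bl smooth_unit_normal, symmetric] hN ..
    moreover have "h (differential \<A> (unit_normal \<A> x) p v) = - differential \<A> (unit_normal \<A> x) p v"
      using hx[of p w] unfolding w .
    ultimately have "differential \<A> (unit_normal \<A> x) p v = - differential \<A> (unit_normal \<A> x) p v" by simp
    then have "2 *\<^sub>R differential \<A> (unit_normal \<A> x) p v = 0" by (simp only: scaleR_2 eq_neg_iff_add_eq_0)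
    then show ?thesis by simp
  qed
  have "((\<lambda>s. cross3 (N s) (x (\<gamma> s))) has_vector_derivative cross3 (N s) (T s)) (at s)" for s
    using has_vector_derivative_cross3[OF curve_derivative[OF smooth_unit_normal curve(1)] curve_x[OF curve(1)], of s]
    by (simp add: dN)
  then have "((\<lambda>s. cross3 (N s) (T s)) has_integral 0) {0..L}"
    by (rule has_integral_derivative_periodic) (simp_all add: curve)
  moreover have "((\<lambda>s. cross3 (N s) (T s)) has_integral force \<A> x L \<gamma>) {0..L}"
    using force_integral[OF H curve(1), of L] by (simp add: zeta_def H0)
  ultimately have "force \<A> x L \<gamma> = 0" by (rule has_integral_unique[symmetric])
  then show False using minimal_force_nonzero[OF H0 orig] by simp
qed

lemma minimal_classification:
  assumes conn: "connected (UNIV :: 'm set)" and H0: "H = 0" and orig: "orig \<in> P"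
    and y: "minimal_isometric_immersion \<A> x y"
  shows "congruent_immersions x y \<or> congruent_immersions (\<lambda>p. - x p) y"
proof -
  have Hx: "constant_mean_curvature \<A> x 0" using H H0 by simp
  have yi: "isometric_immersion \<A> x y" "constant_mean_curvature \<A> y 0"
    using y by (simp_all add: minimal_isometric_immersion_def)
  interpret cp: cmc_pair \<A> x y 0 by (rule cmc_pairI[OF Hx yi])
  obtain c where c: "cmod c = 1" "\<And>p. cp.phase c p" using cp.phase_exists[OF conn] by blast
  have z0: "zeta \<A> F 0 = unit_normal \<A> F" for F by (simp add: zeta_def fun_eq_iff)
  interpret rc: rotating_curve L c "\<lambda>s. cp.Rot (\<gamma> s)" "\<lambda>s. x (\<gamma> s)" "\<lambda>s. differential \<A> x (\<gamma> s) (velocity \<A> \<gamma> s)"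
    "\<lambda>s. y (\<gamma> s)" "\<lambda>s. differential \<A> y (\<gamma> s) (velocity \<A> \<gamma> s)" "\<lambda>s. zeta \<A> x 0 (\<gamma> s)"
    "\<lambda>s. differential \<A> (zeta \<A> x 0) (\<gamma> s) (velocity \<A> \<gamma> s)" "\<lambda>s. unit_normal \<A> x (\<gamma> s)"
    by (rule cp.rotating_curve[OF closed c])
  have "rc.W = force \<A> x L \<gamma>" unfolding rc.W_def by (rule cp.force_W[OF closed, symmetric])
  then have "rc.W \<noteq> 0" using minimal_force_nonzero[OF H0 orig] by auto
  moreover have "Im c *\<^sub>R rc.W = 0" by (rule rc.force_zero) (simp add: z0)
  ultimately have Im0: "Im c = 0" by simp
  then have "(Re c)\<^sup>2 = 1" using c(1) cmod_power2[of c] by simp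
  then have "c = 1 \<or> c = -1" using Im0 by (simp add: complex_eq_iff power2_eq_1_iff)
  then show ?thesis
  proof
    assume "c = 1"
    then show ?thesis using cp.phase_one_congruent[OF conn] c(2) by blast
  next
    assume cm: "c = -1"
    \<comment> \<open>Phase -1 for \<open>y\<close> is phase 1 for \<open>- y\<close>: the sign
      change keeps the normal and reverses the images of tangent vectors. So \<open>- y\<close> is a
      rigid motion of \<open>x\<close>, and its linear part applied to \<open>- x\<close> gives
      \<open>y\<close> up to translation.\<close>
    interpret ny: immersed \<A> "\<lambda>p. - y p" by (rule cp.target.immersed_uminus)
    have "isometric_immersion \<A> x (\<lambda>p. - y p)"
      using yi(1) ny.immersion by (simp add: isometric_immersion_def cp.target.induced_metric_uminus)
    from cmc_pairI[OF Hx this cp.target.minimal_uminus[OF yi(2)]]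
    interpret cq: cmc_pair \<A> x "\<lambda>p. - y p" 0 .
    have "cq.phase 1 p" for p
      unfolding cq.phase_def
    proof
      fix v
      define \<omega> where "\<omega> = differential \<A> (unit_normal \<A> x) p v"
      obtain w where w: "differential \<A> x p w = \<omega>"
        using differential_surj[OF differential_unit_normal_tangent, of p v] unfolding \<omega>_def by blast
      have "differential \<A> (unit_normal \<A> y) p v = cp.Rot p (- \<omega>)"
        using c(2)[of p] unfolding cp.phase_def z0 \<omega>_def cm by simp
      also have "\<dots> = - differential \<A> y p w"
        using cp.Rot_differential[of p w] by (simp add: linear_neg[OF cp.Rot_linear] w)
      also have "\<dots> = cq.Rot p \<omega>"
        using cq.Rot_differential[of p w] by (simp add: cp.target.differential_uminus w)
      finally show "differential \<A> (zeta \<A> (\<lambda>p. - y p) 0) p v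
        = cq.Rot p (Re 1 *\<^sub>R differential \<A> (zeta \<A> x 0) p v + Im 1 *\<^sub>R cross3 (unit_normal \<A> x p) (differential \<A> (zeta \<A> x 0) p v))"
        unfolding z0 cp.target.unit_normal_uminus by (simp add: \<omega>_def)
    qed
    then obtain g d where g: "linear g" "\<And>v w. g v \<bullet> g w = v \<bullet> w" "\<And>v w. cross3 (g v) (g w) = g (cross3 v w)"
      and d: "\<And>p. - y p = g (x p) + d" using cq.phase_one_rigid[OF conn] by blast
    have "y p = g (- x p) + (- d)" for p
      using d[of p] by (simp add: linear_neg[OF g(1)]) (metis add_uminus_conv_diff minus_add_distrib minus_minus)
    then have "y = (\<lambda>q. g q + - d) \<circ> (\<lambda>p. - x p)" by (simp add: fun_eq_iff)
    then show ?thesis unfolding congruent_immersions_def using congruence_rigid[OF g] by blast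
  qed
qed

end

theorem theorem5p2:
  fixes \<A> :: "'m::{t2_space, second_countable_topology} chart set"
    and x :: "'m \<Rightarrow> real^3" and H L :: real and \<gamma> :: "real \<Rightarrow> 'm"
    and P :: "(real^3) set" and V orig :: "real^3"
  assumes "oriented_surface \<A>"
    and "immersion \<A> x"
    and "constant_mean_curvature \<A> x H"
    and "plane P" and "unit_normal_to_plane P V" and "orig \<in> P"
    and "smooth_closed_curve \<A> L \<gamma>" and "unit_speed \<A> x \<gamma>"
    and "meets_plane_transversally_in \<A> x P \<gamma>"
  shows "force \<A> x L \<gamma> \<bullet> V = plane_curve_integral \<A> x H V orig L \<gamma> \<and>
    (plane_curve_integral \<A> x H V orig L \<gamma> \<noteq> 0 \<longrightarrow>
       \<not> admits_nontrivial_isometric_cmc_deformation \<A> x H) \<and>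
    (H = 0 \<longrightarrow>
       minimal_isometric_immersion \<A> x (\<lambda>p. - x p) \<and>
       \<not> congruent_immersions x (\<lambda>p. - x p) \<and>
       (\<forall>y. minimal_isometric_immersion \<A> x y \<longrightarrow>
          congruent_immersions x y \<or> congruent_immersions (\<lambda>p. - x p) y))"
proof -
  have conn: "connected (UNIV :: 'm set)" and at: "oriented_smooth_atlas \<A>"
    using assms(1) by (simp_all add: oriented_surface_def)
  interpret plane_curve \<A> x H L \<gamma> P V
    by unfold_locales (fact at assms)+
  note F = force_formula[OF assms(6)]
  show ?thesis
  proof (intro conjI impI allI)
    show "force \<A> x L \<gamma> \<bullet> V = plane_curve_integral \<A> x H V orig L \<gamma>" by (rule F)
  next
    assume "plane_curve_integral \<A> x H V orig L \<gamma> \<noteq> 0"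
    then have "force \<A> x L \<gamma> \<noteq> 0" using F by auto
    then show "\<not> admits_nontrivial_isometric_cmc_deformation \<A> x H"
      by (rule no_deformation[OF conn assms(3,7)])
  next
    assume H0: "H = 0"
    then have "constant_mean_curvature \<A> x 0" using assms(3) by simp
    then show "minimal_isometric_immersion \<A> x (\<lambda>p. - x p)"
      unfolding minimal_isometric_immersion_def isometric_immersion_def
      using immersed.immersion[OF immersed_uminus] minimal_uminus induced_metric_uminus by blast
    show "\<not> congruent_immersions x (\<lambda>p. - x p)"
      by (rule minimal_not_congruent_uminus[OF H0 assms(6)])
    fix y assume "minimal_isometric_immersion \<A> x y"
    then show "congruent_immersions x y \<or> congruent_immersions (\<lambda>p. - x p) y"
      by (rule minimal_classification[OF conn H0 assms(6)])
  qed
qed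

end
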